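(* The Double Matroid-constrained Multiway Cut problem can be solved in polynomial time if the input graph $G$ is a tree.
   Context: Double Matroid-constrained Multiway Cut: given a graph $G=(V,E)$, edge weights $w\in\mathbb{R}^E_{\ge 0}$, and two rank-$k$ matroids $\mathcal{M}_1,\mathcal{M}_2$ on $V$ given by independence oracles with basis families $\mathcal{B}_1,\mathcal{B}_2$, find a partition $\{V_1,\dots,V_k\}$ of $V$ for which there exist $B_1\in\mathcal{B}_1$ and $B_2\in\mathcal{B}_2$ (not necessarily equal) with $|B_j\cap V_i|=1$ for all $i\in[k]$, $j\in[2]$, minimizing $\sum_{i=1}^k d_w(V_i)$, where $d_w(X)$ is the total weight of edges with exactly one endpoint in $X$. Polynomial time means polynomially many oracle calls and elementary operations in the input size. *)

theory Defs
  imports Complex_Main "HOL-Library.Disjoint_Sets" "HOL-Computational_Algebra.Polynomial"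
begin

section \<open>Graphs and matroids\<close>

definition simple_graph :: "'a set \<Rightarrow> 'a set set \<Rightarrow> bool" where
  "simple_graph V E \<longleftrightarrow> finite V \<and> (\<forall>e\<in>E. e \<subseteq> V \<and> card e = 2)"

definition graph_connected :: "'a set \<Rightarrow> 'a set set \<Rightarrow> bool" where
  "graph_connected V E \<longleftrightarrow> V \<noteq> {} \<and> (\<forall>u\<in>V. \<forall>v\<in>V. (u, v) \<in> {(x, y). {x, y} \<in> E}\<^sup>*)"

definition graph_cycle :: "'a set set \<Rightarrow> 'a list \<Rightarrow> bool" where
  "graph_cycle E c \<longleftrightarrow> length c \<ge> 3 \<and> distinct c \<and>
     (\<forall>i. Suc i < length c \<longrightarrow> {c ! i, c ! Suc i} \<in> E) \<and> {last c, hd c} \<in> E"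

text \<open>The predicate of the same name in the AFP entry Graph\_Theory only excludes directed cycles
  of a digraph, so it does not describe undirected trees.\<close>

definition tree :: "'a set \<Rightarrow> 'a set set \<Rightarrow> bool" where
  "tree V E \<longleftrightarrow> simple_graph V E \<and> graph_connected V E \<and> (\<nexists>c. graph_cycle E c)"

definition cut_weight :: "'a set set \<Rightarrow> ('a set \<Rightarrow> real) \<Rightarrow> 'a set \<Rightarrow> real" where
  "cut_weight E w X = (\<Sum>e | e \<in> E \<and> card (e \<inter> X) = 1. w e)"

definition matroid :: "'a set \<Rightarrow> 'a set set \<Rightarrow> bool" where
  "matroid V I \<longleftrightarrow> finite V \<and> I \<subseteq> Pow V \<and> {} \<in> I \<and>
     (\<forall>X\<in>I. \<forall>Y. Y \<subseteq> X \<longrightarrow> Y \<in> I) \<and>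
     (\<forall>X\<in>I. \<forall>Y\<in>I. card X < card Y \<longrightarrow> (\<exists>y\<in>Y - X. insert y X \<in> I))"

definition bases :: "'a set set \<Rightarrow> 'a set set" where
  "bases I = {B \<in> I. \<forall>X\<in>I. B \<subseteq> X \<longrightarrow> X = B}"

definition matroid_rank :: "'a set set \<Rightarrow> nat" where
  "matroid_rank I = Max (card ` I)"


section \<open>Double Matroid-constrained Multiway Cut\<close>

definition dmmc_instance ::
    "'a set \<Rightarrow> 'a set set \<Rightarrow> ('a set \<Rightarrow> real) \<Rightarrow> nat \<Rightarrow> 'a set set \<Rightarrow> 'a set set \<Rightarrow> bool" where
  "dmmc_instance V E w k I\<^sub>1 I\<^sub>2 \<longleftrightarrow> simple_graph V E \<and> (\<forall>e\<in>E. 0 \<le> w e) \<and>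
     matroid V I\<^sub>1 \<and> matroid_rank I\<^sub>1 = k \<and> matroid V I\<^sub>2 \<and> matroid_rank I\<^sub>2 = k"

definition dmmc_feasible ::
    "'a set \<Rightarrow> nat \<Rightarrow> 'a set set \<Rightarrow> 'a set set \<Rightarrow> 'a set set \<Rightarrow> bool" where
  "dmmc_feasible V k I\<^sub>1 I\<^sub>2 P \<longleftrightarrow> partition_on V P \<and> card P = k \<and>
     (\<exists>B\<^sub>1\<in>bases I\<^sub>1. \<exists>B\<^sub>2\<in>bases I\<^sub>2. \<forall>X\<in>P. card (B\<^sub>1 \<inter> X) = 1 \<and> card (B\<^sub>2 \<inter> X) = 1)"

definition dmmc_optimal ::
    "'a set \<Rightarrow> 'a set set \<Rightarrow> ('a set \<Rightarrow> real) \<Rightarrow> nat \<Rightarrow> 'a set set \<Rightarrow> 'a set set \<Rightarrow> 'a set set \<Rightarrow> bool"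
  where
  "dmmc_optimal V E w k I\<^sub>1 I\<^sub>2 P \<longleftrightarrow> dmmc_feasible V k I\<^sub>1 I\<^sub>2 P \<and>
     (\<forall>Q. dmmc_feasible V k I\<^sub>1 I\<^sub>2 Q \<longrightarrow>
        (\<Sum>X\<in>P. cut_weight E w X) \<le> (\<Sum>X\<in>Q. cut_weight E w X))"


section \<open>Oracle programs and their running time\<close>

text \<open>
  A first-order LISP in the style of Jones's language F: values are binary trees, a program
  is a main expression together with finitely many (mutually recursive) functions, and every
  evaluated expression node costs one step, an oracle query included. Pairs are thought of as
  pointers, so passing a value around is one step.

  The atoms are real numbers, since edge weights are real. To keep unit cost honest, the only
  numeric operations are addition, subtraction and comparison (with rational inputs, every step
  lengthens the numbers by at most one bit beyond a common denominator, so that repeated squaring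
  is impossible), and the only numeric constants are 0 and 1 (an arbitrary real constant could
  carry infinitely many bits of advice).
\<close>

datatype val = VNil | VNum real | VCons val val

datatype expr =
    Var nat
  | Empty
  | Zero
  | One
  | MkPair expr expr
  | Fst expr
  | Snd expr
  | Add expr expr
  | Sub expr expr
  | Leq expr expr
  | Cond expr expr expr
  | Bind expr expr
  | Call nat "expr list"
  | Query nat expr

fun val_list :: "val list \<Rightarrow> val" where
  "val_list [] = VNil"
| "val_list (x # xs) = VCons x (val_list xs)"

definition val_nat :: "nat \<Rightarrow> val" where
  "val_nat n = VNum (real n)"

definition val_bool :: "bool \<Rightarrow> val" where
  "val_bool b = (if b then VNum 1 else VNil)"

text \<open>
  \<open>eval fs orc \<rho> e x t\<close>: with functions \<open>fs\<close>, oracles \<open>orc\<close> and environment \<open>\<rho>\<close>, the expression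
  \<open>e\<close> terminates with value \<open>x\<close> after \<open>t\<close> steps. \<open>Bind\<close> binds de Bruijn variable 0; a function
  body sees exactly its arguments; anything but \<open>VNil\<close> counts as true. An ill-formed operation
  has no result. Query \<open>j\<close> passes a set of naturals, written as a list, to oracle \<open>j\<close>.
\<close>

inductive eval :: "expr list \<Rightarrow> (nat \<Rightarrow> nat set \<Rightarrow> bool) \<Rightarrow> val list \<Rightarrow> expr \<Rightarrow> val \<Rightarrow> nat \<Rightarrow> bool"
  and evals :: "expr list \<Rightarrow> (nat \<Rightarrow> nat set \<Rightarrow> bool) \<Rightarrow> val list \<Rightarrow> expr list \<Rightarrow> val list \<Rightarrow> nat \<Rightarrow> bool"
  for fs :: "expr list" and orc :: "nat \<Rightarrow> nat set \<Rightarrow> bool"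
where
  eval_Var: "i < length \<rho> \<Longrightarrow> eval fs orc \<rho> (Var i) (\<rho> ! i) 1"
| eval_Empty: "eval fs orc \<rho> Empty VNil 1"
| eval_Zero: "eval fs orc \<rho> Zero (VNum 0) 1"
| eval_One: "eval fs orc \<rho> One (VNum 1) 1"
| eval_MkPair: "\<lbrakk>eval fs orc \<rho> a x s; eval fs orc \<rho> b y t\<rbrakk>
    \<Longrightarrow> eval fs orc \<rho> (MkPair a b) (VCons x y) (s + t + 1)"
| eval_Fst: "eval fs orc \<rho> a (VCons x y) t \<Longrightarrow> eval fs orc \<rho> (Fst a) x (t + 1)"
| eval_Snd: "eval fs orc \<rho> a (VCons x y) t \<Longrightarrow> eval fs orc \<rho> (Snd a) y (t + 1)"
| eval_Add: "\<lbrakk>eval fs orc \<rho> a (VNum x) s; eval fs orc \<rho> b (VNum y) t\<rbrakk>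
    \<Longrightarrow> eval fs orc \<rho> (Add a b) (VNum (x + y)) (s + t + 1)"
| eval_Sub: "\<lbrakk>eval fs orc \<rho> a (VNum x) s; eval fs orc \<rho> b (VNum y) t\<rbrakk>
    \<Longrightarrow> eval fs orc \<rho> (Sub a b) (VNum (x - y)) (s + t + 1)"
| eval_Leq: "\<lbrakk>eval fs orc \<rho> a (VNum x) s; eval fs orc \<rho> b (VNum y) t\<rbrakk>
    \<Longrightarrow> eval fs orc \<rho> (Leq a b) (val_bool (x \<le> y)) (s + t + 1)"
| eval_Cond_True: "\<lbrakk>eval fs orc \<rho> c x s; x \<noteq> VNil; eval fs orc \<rho> a y t\<rbrakk>
    \<Longrightarrow> eval fs orc \<rho> (Cond c a b) y (s + t + 1)"
| eval_Cond_False: "\<lbrakk>eval fs orc \<rho> c VNil s; eval fs orc \<rho> b y t\<rbrakk>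
    \<Longrightarrow> eval fs orc \<rho> (Cond c a b) y (s + t + 1)"
| eval_Bind: "\<lbrakk>eval fs orc \<rho> a x s; eval fs orc (x # \<rho>) b y t\<rbrakk>
    \<Longrightarrow> eval fs orc \<rho> (Bind a b) y (s + t + 1)"
| eval_Call: "\<lbrakk>f < length fs; evals fs orc \<rho> as xs s; eval fs orc xs (fs ! f) y t\<rbrakk>
    \<Longrightarrow> eval fs orc \<rho> (Call f as) y (s + t + 1)"
| eval_Query: "eval fs orc \<rho> a (val_list (map val_nat us)) t
    \<Longrightarrow> eval fs orc \<rho> (Query j a) (val_bool (orc j (set us))) (t + 1)"
| evals_Nil: "evals fs orc \<rho> [] [] 0"
| evals_Cons: "\<lbrakk>eval fs orc \<rho> a x s; evals fs orc \<rho> as xs t\<rbrakk>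
    \<Longrightarrow> evals fs orc \<rho> (a # as) (x # xs) (s + t)"

lemma val_list_inject: "val_list xs = val_list ys \<longleftrightarrow> xs = ys"
proof (induction xs arbitrary: ys)
  case Nil
  then show ?case by (cases ys) auto
next
  case (Cons x xs)
  then show ?case by (cases ys) auto
qed

lemma val_list_nats_inject:
  "val_list (map val_nat us) = val_list (map val_nat vs) \<longleftrightarrow> us = vs"
proof -
  have "inj val_nat" by (auto simp: inj_def val_nat_def)
  then show ?thesis by (simp add: val_list_inject inj_map_eq_map)
qed

inductive_cases eval_VarE: "eval fs orc \<rho> (Var i) x t"
inductive_cases eval_EmptyE: "eval fs orc \<rho> Empty x t"
inductive_cases eval_ZeroE: "eval fs orc \<rho> Zero x t"
inductive_cases eval_OneE: "eval fs orc \<rho> One x t"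
inductive_cases eval_MkPairE: "eval fs orc \<rho> (MkPair a b) x t"
inductive_cases eval_FstE: "eval fs orc \<rho> (Fst a) x t"
inductive_cases eval_SndE: "eval fs orc \<rho> (Snd a) x t"
inductive_cases eval_AddE: "eval fs orc \<rho> (Add a b) x t"
inductive_cases eval_SubE: "eval fs orc \<rho> (Sub a b) x t"
inductive_cases eval_LeqE: "eval fs orc \<rho> (Leq a b) x t"
inductive_cases eval_CondE: "eval fs orc \<rho> (Cond c a b) x t"
inductive_cases eval_BindE: "eval fs orc \<rho> (Bind a b) x t"
inductive_cases eval_CallE: "eval fs orc \<rho> (Call f as) x t"
inductive_cases eval_QueryE: "eval fs orc \<rho> (Query j a) x t"
inductive_cases evals_NilE: "evals fs orc \<rho> [] xs t"
inductive_cases evals_ConsE: "evals fs orc \<rho> (a # as) xs t"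

lemma eval_deterministic:
  "eval fs orc \<rho> e x t \<Longrightarrow> (\<forall>x' t'. eval fs orc \<rho> e x' t' \<longrightarrow> x' = x \<and> t' = t)"
  "evals fs orc \<rho> es xs t \<Longrightarrow> (\<forall>xs' t'. evals fs orc \<rho> es xs' t' \<longrightarrow> xs' = xs \<and> t' = t)"
proof (induction rule: eval_evals.inducts)
  case eval_Var then show ?case by (intro allI impI; elim eval_VarE; metis val.inject One_nat_def Suc_eq_plus1)
next
  case eval_Empty then show ?case by (intro allI impI; elim eval_EmptyE; metis val.inject One_nat_def Suc_eq_plus1)
next
  case eval_Zero then show ?case by (intro allI impI; elim eval_ZeroE; metis val.inject One_nat_def Suc_eq_plus1)
next
  case eval_One then show ?case by (intro allI impI; elim eval_OneE; metis val.inject One_nat_def Suc_eq_plus1)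
next
  case eval_MkPair then show ?case by (intro allI impI; elim eval_MkPairE; metis val.inject One_nat_def Suc_eq_plus1)
next
  case eval_Fst then show ?case by (intro allI impI; elim eval_FstE; metis val.inject One_nat_def Suc_eq_plus1)
next
  case eval_Snd then show ?case by (intro allI impI; elim eval_SndE; metis val.inject One_nat_def Suc_eq_plus1)
next
  case eval_Add then show ?case by (intro allI impI; elim eval_AddE; metis val.inject One_nat_def Suc_eq_plus1)
next
  case eval_Sub then show ?case by (intro allI impI; elim eval_SubE; metis val.inject One_nat_def Suc_eq_plus1)
next
  case eval_Leq then show ?case by (intro allI impI; elim eval_LeqE; metis val.inject One_nat_def Suc_eq_plus1)
next
  case eval_Cond_True then show ?case by (intro allI impI; elim eval_CondE; metis val.inject One_nat_def Suc_eq_plus1)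
next
  case eval_Cond_False then show ?case by (intro allI impI; elim eval_CondE; metis val.inject One_nat_def Suc_eq_plus1)
next
  case eval_Bind then show ?case by (intro allI impI; elim eval_BindE; metis val.inject One_nat_def Suc_eq_plus1)
next
  case eval_Call then show ?case by (intro allI impI; elim eval_CallE; metis val.inject One_nat_def Suc_eq_plus1)
next
  case (eval_Query \<rho> a us t j)
  show ?case
  proof (intro allI impI)
    fix x' t' assume "eval fs orc \<rho> (Query j a) x' t'"
    then obtain us' s where "eval fs orc \<rho> a (val_list (map val_nat us')) s"
      and "x' = val_bool (orc j (set us'))" and "t' = s + 1"
      by (auto elim: eval_QueryE)
    with eval_Query.IH show "x' = val_bool (orc j (set us)) \<and> t' = t + 1"
      by (metis val_list_nats_inject)
  qed
next
  case evals_Nil then show ?case by (intro allI impI; elim evals_NilE; metis val.inject One_nat_def Suc_eq_plus1)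
next
  case evals_Cons then show ?case by (intro allI impI; elim evals_ConsE; metis val.inject One_nat_def Suc_eq_plus1)
qed


section \<open>Inputs and outputs\<close>

definition independence_oracles :: "nat set set \<Rightarrow> nat set set \<Rightarrow> nat \<Rightarrow> nat set \<Rightarrow> bool" where
  "independence_oracles I\<^sub>1 I\<^sub>2 j X \<longleftrightarrow> j = 1 \<and> X \<in> I\<^sub>1 \<or> j = 2 \<and> X \<in> I\<^sub>2"

text \<open>The vertices and edges are listed in any order, and each edge is written with its endpoints
  in either order. The matroids are accessible through the oracles only.\<close>

definition dmmc_input ::
    "nat set \<Rightarrow> nat set set \<Rightarrow> (nat set \<Rightarrow> real) \<Rightarrow> nat \<Rightarrow> val \<Rightarrow> bool" where
  "dmmc_input V E w k x \<longleftrightarrow> (\<exists>vs es.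
     distinct vs \<and> set vs = V \<and>
     distinct (map (\<lambda>(u, v). {u, v}) es) \<and> set (map (\<lambda>(u, v). {u, v}) es) = E \<and>
     x = val_list
       [val_list (map val_nat vs),
        val_list (map (\<lambda>(u, v). val_list [val_nat u, val_nat v, VNum (w {u, v})]) es),
        val_nat k])"

text \<open>The answer is an optimal partition, as a list of lists of vertices, or the atom 0, which is
  not the code of any list, if there is no feasible partition.\<close>

definition dmmc_answer ::
    "nat set \<Rightarrow> nat set set \<Rightarrow> (nat set \<Rightarrow> real) \<Rightarrow> nat \<Rightarrow> nat set set \<Rightarrow> nat set set \<Rightarrow> val \<Rightarrow> bool"
  where
  "dmmc_answer V E w k I\<^sub>1 I\<^sub>2 y \<longleftrightarrow>
     (if \<exists>P. dmmc_feasible V k I\<^sub>1 I\<^sub>2 P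
      then \<exists>ps. y = val_list (map (\<lambda>p. val_list (map val_nat p)) ps) \<and>
                dmmc_optimal V E w k I\<^sub>1 I\<^sub>2 (set (map set ps))
      else y = VNum 0)"

end

theory Submission
  imports Defs
begin

text \<open>
  Root the tree. A partition is feasible at cost \<open>2 * w(F)\<close> for a set \<open>F\<close> of cut edges if and only if
  some bases \<open>B\<^sub>1\<close> and \<open>B\<^sub>2\<close> have at most one element in each component of the forest \<open>T - F\<close>: the
  components that contain only an element of \<open>B\<^sub>1\<close> can be paired arbitrarily with those that contain
  only an element of \<open>B\<^sub>2\<close>. Equivalently, \<open>B\<^sub>1\<close> and \<open>B\<^sub>2\<close> are linked by vertex-disjoint upward
  paths to tops of components, the top of a component being the lower end of the cut edge above
  it. Joining the two path systems at the cuts gives \<open>k\<close> disjoint paths from \<open>B\<^sub>1\<close> up and down to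
  \<open>B\<^sub>2\<close>, hence a matching of a bipartite graph whose left and right sides carry the two matroids
  (extended by free elements). Cheapest cuts are therefore cheapest common independent sets of maximum
  size of two matroids on the edges of this graph.

  They are found by successive shortest augmenting paths in the exchange graph. The invariant is a
  splitting of the costs into two parts, one for each matroid, such that the current set is cheapest of
  its size in both; the distances in the exchange graph provide the next splitting. Bellman-Ford
  labels make the chosen path have the fewest arcs among the shortest ones, which rules out shortcuts
  along tight arcs and makes the exchange valid.
\<close>

section \<open>Fold programs and their compilation\<close>

text \<open>Feasibility is enforced by cardinality, not by cost. Each vertex has nodes of kinds 1
  and 2 on either side, and a node off all paths is matched to itself at cost 0. A common
  independent set thus has at most \<open>2 * card V + k\<close> elements, and equality forces a
  basis at either end and a partner for every node; this alone makes the paths climb until a cut or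
  the root stops them. The tops of the two path systems need not agree, so \<open>cross\<close>
  joins any two of them and pays for both cut edges, or once for a common one. The cost is then at
  least the weight of the cuts, and a pairing that fixes the common tops attains it. The root, which
  has no edge above it, serves as a cut of weight 0. Splittings of the costs occur in the proof
  only. The program compares lengths of walks, which are signed sums of costs, so addition,
  subtraction and comparison suffice. For the running time, programs iterate only by folding over
  lists and fail on lists longer than \<open>N\<close>. It is enough to show that the program has a
  result for some \<open>N\<close> polynomial in the input; the step count then follows from the
  shape of the program.\<close>

datatype prog =
    PVar nat
  | PNil
  | PZero
  | POne
  | PCons prog prog
  | PFst prog
  | PSnd prog
  | PAdd prog prog
  | PSub prog prog
  | PLeq prog prog
  | PIf prog prog prog
  | PLet prog prog
  | PApp prog "prog list"
  | PQuery nat prog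
  | PFold prog prog prog

text \<open>A list longer than \<open>n\<close> makes the fold fail rather than stop early, so that
  a defined result certifies the length bound on which the running time rests.\<close>

fun bounded_fold :: "nat \<Rightarrow> (val \<Rightarrow> val \<Rightarrow> val option) \<Rightarrow> val \<Rightarrow> val \<Rightarrow> val option" where
  "bounded_fold n f VNil a = Some a"
| "bounded_fold (Suc n) f (VCons x xs) a =
     (case f x a of None \<Rightarrow> None | Some b \<Rightarrow> bounded_fold n f xs b)"
| "bounded_fold n f xs a = None"

definition query_result :: "(nat set \<Rightarrow> bool) \<Rightarrow> val \<Rightarrow> val option" where
  "query_result q v =
     (if \<exists>us. v = val_list (map val_nat us)
      then Some (val_bool (q (set (SOME us. v = val_list (map val_nat us))))) else None)"

lemma query_result_nats [simp]:
  "query_result q (val_list (map val_nat us)) = Some (val_bool (q (set us)))"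
  by (auto simp: query_result_def val_list_nats_inject)

fun val_fst :: "val \<Rightarrow> val option" where
  "val_fst (VCons x y) = Some x"
| "val_fst _ = None"

fun val_snd :: "val \<Rightarrow> val option" where
  "val_snd (VCons x y) = Some y"
| "val_snd _ = None"

fun val_num2 :: "(real \<Rightarrow> real \<Rightarrow> val) \<Rightarrow> val \<Rightarrow> val \<Rightarrow> val option" where
  "val_num2 f (VNum x) (VNum y) = Some (f x y)"
| "val_num2 f _ _ = None"

text \<open>The number \<open>N\<close> bounds the length of all lists that are folded over. A program with a defined
  denotation therefore runs in time polynomial in \<open>N\<close>.\<close>

fun den :: "nat \<Rightarrow> (nat \<Rightarrow> nat set \<Rightarrow> bool) \<Rightarrow> prog \<Rightarrow> val list \<Rightarrow> val option" where
  "den N orc (PVar i) \<rho> = (if i < length \<rho> then Some (\<rho> ! i) else None)"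
| "den N orc PNil \<rho> = Some VNil"
| "den N orc PZero \<rho> = Some (VNum 0)"
| "den N orc POne \<rho> = Some (VNum 1)"
| "den N orc (PCons p q) \<rho> =
     Option.bind (den N orc p \<rho>) (\<lambda>x. Option.bind (den N orc q \<rho>) (\<lambda>y. Some (VCons x y)))"
| "den N orc (PFst p) \<rho> = Option.bind (den N orc p \<rho>) val_fst"
| "den N orc (PSnd p) \<rho> = Option.bind (den N orc p \<rho>) val_snd"
| "den N orc (PAdd p q) \<rho> =
     Option.bind (den N orc p \<rho>) (\<lambda>x. Option.bind (den N orc q \<rho>) (val_num2 (\<lambda>x y. VNum (x + y)) x))"
| "den N orc (PSub p q) \<rho> =
     Option.bind (den N orc p \<rho>) (\<lambda>x. Option.bind (den N orc q \<rho>) (val_num2 (\<lambda>x y. VNum (x - y)) x))"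
| "den N orc (PLeq p q) \<rho> =
     Option.bind (den N orc p \<rho>) (\<lambda>x. Option.bind (den N orc q \<rho>) (val_num2 (\<lambda>x y. val_bool (x \<le> y)) x))"
| "den N orc (PIf c p q) \<rho> =
     Option.bind (den N orc c \<rho>) (\<lambda>x. if x = VNil then den N orc q \<rho> else den N orc p \<rho>)"
| "den N orc (PLet p q) \<rho> = Option.bind (den N orc p \<rho>) (\<lambda>x. den N orc q (x # \<rho>))"
| "den N orc (PApp q ps) \<rho> = Option.bind (those (map (\<lambda>p. den N orc p \<rho>) ps)) (den N orc q)"
| "den N orc (PQuery j p) \<rho> = Option.bind (den N orc p \<rho>) (query_result (orc j))"
| "den N orc (PFold b p q) \<rho> =
     Option.bind (den N orc p \<rho>) (\<lambda>x. Option.bind (den N orc q \<rho>)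
       (bounded_fold N (\<lambda>x a. den N orc b (x # a # \<rho>)) x))"

section \<open>Translation into the target language\<close>

datatype fun_id = Body nat prog | Loop nat prog

text \<open>Target functions are named by the source program they implement, so that a loop can
  refer to itself before any position is assigned; \<open>idx\<close> assigns the positions. A
  target function sees only its arguments, so a fold hands all \<open>n\<close> variables of the
  current environment to its loop.\<close>

fun code :: "(fun_id \<Rightarrow> nat) \<Rightarrow> nat \<Rightarrow> prog \<Rightarrow> expr" where
  "code idx n (PVar i) = Var i"
| "code idx n PNil = Empty"
| "code idx n PZero = Zero"
| "code idx n POne = One"
| "code idx n (PCons p q) = MkPair (code idx n p) (code idx n q)"
| "code idx n (PFst p) = Fst (code idx n p)"
| "code idx n (PSnd p) = Snd (code idx n p)"
| "code idx n (PAdd p q) = Add (code idx n p) (code idx n q)"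
| "code idx n (PSub p q) = Sub (code idx n p) (code idx n q)"
| "code idx n (PLeq p q) = Leq (code idx n p) (code idx n q)"
| "code idx n (PIf c p q) = Cond (code idx n c) (code idx n p) (code idx n q)"
| "code idx n (PLet p q) = Bind (code idx n p) (code idx (Suc n) q)"
| "code idx n (PApp q ps) = Call (idx (Body (length ps) q)) (map (code idx n) ps)"
| "code idx n (PQuery j p) = Query j (code idx n p)"
| "code idx n (PFold b p q) =
     Call (idx (Loop n b)) (code idx n p # code idx n q # map Var [0..<n])"

fun fun_code :: "(fun_id \<Rightarrow> nat) \<Rightarrow> fun_id \<Rightarrow> expr" where
  "fun_code idx (Body n p) = code idx n p"
| "fun_code idx (Loop n b) =
     Cond (Var 0)
       (Call (idx (Loop n b))
         (Snd (Var 0)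
          # Call (idx (Body (Suc (Suc n)) b)) (Fst (Var 0) # Var 1 # map Var [2..<n + 2])
          # map Var [2..<n + 2]))
       (Var 1)"

fun fun_ids :: "nat \<Rightarrow> prog \<Rightarrow> fun_id set" where
  "fun_ids n (PCons p q) = fun_ids n p \<union> fun_ids n q"
| "fun_ids n (PFst p) = fun_ids n p"
| "fun_ids n (PSnd p) = fun_ids n p"
| "fun_ids n (PAdd p q) = fun_ids n p \<union> fun_ids n q"
| "fun_ids n (PSub p q) = fun_ids n p \<union> fun_ids n q"
| "fun_ids n (PLeq p q) = fun_ids n p \<union> fun_ids n q"
| "fun_ids n (PIf c p q) = fun_ids n c \<union> fun_ids n p \<union> fun_ids n q"
| "fun_ids n (PLet p q) = fun_ids n p \<union> fun_ids (Suc n) q"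
| "fun_ids n (PApp q ps) =
     insert (Body (length ps) q) (fun_ids (length ps) q \<union> \<Union> (set (map (fun_ids n) ps)))"
| "fun_ids n (PQuery j p) = fun_ids n p"
| "fun_ids n (PFold b p q) =
     {Loop n b, Body (Suc (Suc n)) b} \<union> fun_ids (Suc (Suc n)) b \<union> fun_ids n p \<union> fun_ids n q"
| "fun_ids n _ = {}"

text \<open>The monomial \<open>[:0, 1:]\<close> stands for the bound \<open>N\<close> on the number
  of iterations. A maximum of polynomials is not a polynomial, so \<open>PIf\<close> charges both
  branches. In the constant \<open>n + 4\<close> of a fold, \<open>n\<close> steps copy the
  environment, 3 leave the loop and 1 is the call.\<close>

fun time_poly :: "nat \<Rightarrow> prog \<Rightarrow> nat poly" where
  "time_poly n (PCons p q) = time_poly n p + time_poly n q + 1"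
| "time_poly n (PFst p) = time_poly n p + 1"
| "time_poly n (PSnd p) = time_poly n p + 1"
| "time_poly n (PAdd p q) = time_poly n p + time_poly n q + 1"
| "time_poly n (PSub p q) = time_poly n p + time_poly n q + 1"
| "time_poly n (PLeq p q) = time_poly n p + time_poly n q + 1"
| "time_poly n (PIf c p q) = time_poly n c + (time_poly n p + time_poly n q) + 1"
| "time_poly n (PLet p q) = time_poly n p + time_poly (Suc n) q + 1"
| "time_poly n (PApp q ps) = sum_list (map (time_poly n) ps) + time_poly (length ps) q + 1"
| "time_poly n (PQuery j p) = time_poly n p + 1"
| "time_poly n (PFold b p q) = time_poly n p + time_poly n q +
     [:0, 1:] * (time_poly (Suc (Suc n)) b + [:2 * n + 10:]) + [:n + 4:]"
| "time_poly n _ = 1"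

lemma evals_vars:
  "m \<le> length \<rho> \<Longrightarrow> evals fs orc \<rho> (map Var [i..<m]) (drop i (take m \<rho>)) (m - i)"
proof (induction "m - i" arbitrary: i)
  case 0
  then show ?case by (auto intro: evals_Nil)
next
  case (Suc d)
  then have "i < m" by linarith
  then have d: "drop i (take m \<rho>) = \<rho> ! i # drop (Suc i) (take m \<rho>)"
    using Suc.prems by (metis Cons_nth_drop_Suc length_take min.absorb2 nth_take)
  have u: "map Var [i..<m] = Var i # map Var [Suc i..<m]"
    using \<open>i < m\<close> by (simp add: upt_conv_Cons)
  have "evals fs orc \<rho> (map Var [Suc i..<m]) (drop (Suc i) (take m \<rho>)) (m - Suc i)"
    using Suc by (metis Suc_diff_Suc \<open>i < m\<close> diff_Suc_1)
  from evals_Cons[OF eval_Var this, of i]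
  have "evals fs orc \<rho> (map Var [i..<m]) (drop i (take m \<rho>)) (1 + (m - Suc i))"
    unfolding d u using \<open>i < m\<close> Suc.prems by simp
  then show ?case using \<open>i < m\<close> by (simp add: Suc_diff_Suc)
qed

lemma evals_all_vars: "evals fs orc \<rho> (map Var [0..<length \<rho>]) \<rho> (length \<rho>)"
  using evals_vars[of "length \<rho>" \<rho> fs orc 0] by simp

lemma evals_loop_vars:
  "evals fs orc (a # b # \<rho>) (map Var [2..<length \<rho> + 2]) \<rho> (length \<rho>)"
  using evals_vars[of "length \<rho> + 2" "a # b # \<rho>" fs orc 2] by simp

abbreviation has_code :: "(fun_id \<Rightarrow> nat) \<Rightarrow> expr list \<Rightarrow> fun_id set \<Rightarrow> bool" where
  "has_code idx fs D \<equiv> (\<forall>f\<in>D. idx f < length fs \<and> fs ! idx f = fun_code idx f)"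

definition eval_within ::
    "expr list \<Rightarrow> (nat \<Rightarrow> nat set \<Rightarrow> bool) \<Rightarrow> val list \<Rightarrow> expr \<Rightarrow> val \<Rightarrow> nat \<Rightarrow> bool" where
  "eval_within fs orc \<rho> e x T \<longleftrightarrow> (\<exists>t\<le>T. eval fs orc \<rho> e x t)"

lemma eval_within_unary:
  assumes "\<And>s. eval fs orc \<rho> e x s \<Longrightarrow> eval fs orc \<rho>' e' x' (s + 1)"
    and "eval_within fs orc \<rho> e x (poly S N)"
  shows "eval_within fs orc \<rho>' e' x' (poly (S + 1) N)"
proof -
  obtain s where "s \<le> poly S N" "eval fs orc \<rho> e x s"
    using assms unfolding eval_within_def by blast
  then show ?thesis using assms(1) unfolding eval_within_def
    by (intro exI[of _ "s + 1"]) auto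
qed

lemma eval_within_binary:
  assumes "\<And>s t. eval fs orc \<rho>1 e1 x1 s \<Longrightarrow> eval fs orc \<rho>2 e2 x2 t \<Longrightarrow>
      eval fs orc \<rho>' e' x' (s + t + 1)"
    and "eval_within fs orc \<rho>1 e1 x1 (poly S N)" and "eval_within fs orc \<rho>2 e2 x2 (poly T N)"
  shows "eval_within fs orc \<rho>' e' x' (poly (S + T + 1) N)"
proof -
  obtain s t where "s \<le> poly S N" "t \<le> poly T N" "eval fs orc \<rho>1 e1 x1 s" "eval fs orc \<rho>2 e2 x2 t"
    using assms unfolding eval_within_def by blast
  then show ?thesis using assms(1) unfolding eval_within_def
    by (intro exI[of _ "s + t + 1"]) auto
qed

text \<open>An iteration costs the body, two copies of the environment (for the body and for the
  recursive call) and nine steps of the loop itself, which \<open>T + 2 * n + 10\<close> covers; the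
  final 3 is the price of leaving the loop.\<close>

lemma loop_eval:
  assumes code: "has_code idx fs {Loop n b, Body (Suc (Suc n)) b}" and "length \<rho> = n"
    and body: "\<And>x a y. den N orc b (x # a # \<rho>) = Some y \<Longrightarrow>
      eval_within fs orc (x # a # \<rho>) (code idx (Suc (Suc n)) b) y T"
  shows "bounded_fold m (\<lambda>x a. den N orc b (x # a # \<rho>)) x a = Some y \<Longrightarrow>
    eval_within fs orc (x # a # \<rho>) (fun_code idx (Loop n b)) y (m * (T + 2 * n + 10) + 3)"
proof (induction m "\<lambda>x a. den N orc b (x # a # \<rho>)" x a rule: bounded_fold.induct)
  case (1 m a)
  have "eval fs orc (VNil # a # \<rho>) (fun_code idx (Loop n b)) y (1 + 1 + 1)"
    using "1" unfolding fun_code.simps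
    using eval_Var[of 0 "VNil # a # \<rho>" fs orc] eval_Var[of 1 "VNil # a # \<rho>" fs orc]
    by (intro eval_Cond_False) simp_all
  then show ?case unfolding eval_within_def by (rule exI[of _ "1 + 1 + 1", OF conjI, rotated]) simp
next
  case (2 m x xs a)
  let ?\<rho> = "VCons x xs # a # \<rho>"
  obtain z where z: "den N orc b (x # a # \<rho>) = Some z"
    and rest: "bounded_fold m (\<lambda>x a. den N orc b (x # a # \<rho>)) xs z = Some y"
    using "2.prems" by (auto split: option.splits)
  obtain t where t: "t \<le> T" "eval fs orc (x # a # \<rho>) (code idx (Suc (Suc n)) b) z t"
    using body[OF z] unfolding eval_within_def by blast
  obtain s where s: "s \<le> m * (T + 2 * n + 10) + 3"
    "eval fs orc (xs # z # \<rho>) (fun_code idx (Loop n b)) y s"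
    using "2.hyps"[OF z rest] unfolding eval_within_def by blast
  have v0: "eval fs orc ?\<rho> (Var 0) (VCons x xs) 1" using eval_Var[of 0 ?\<rho> fs orc] by simp
  have v1: "eval fs orc ?\<rho> (Var 1) a 1" using eval_Var[of 1 ?\<rho> fs orc] by simp
  note vs = evals_loop_vars[of fs orc "VCons x xs" a \<rho>, unfolded \<open>length \<rho> = n\<close>]
  have "eval fs orc ?\<rho> (Call (idx (Body (Suc (Suc n)) b)) (Fst (Var 0) # Var 1 # map Var [2..<n + 2])) z
    (((1 + 1) + (1 + n)) + t + 1)"
    by (rule eval_Call[OF _ evals_Cons[OF eval_Fst[OF v0] evals_Cons[OF v1 vs]]])
      (use code t(2) in simp_all)
  note call = this
  have "eval fs orc ?\<rho> (fun_code idx (Loop n b)) y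
    (1 + (((1 + 1) + ((((1 + 1) + (1 + n)) + t + 1) + n)) + s + 1) + 1)"
    unfolding fun_code.simps
    by (rule eval_Cond_True[OF v0 _
          eval_Call[OF _ evals_Cons[OF eval_Snd[OF v0] evals_Cons[OF call vs]]]])
      (use code s(2) in simp_all)
  moreover have "1 + (((1 + 1) + ((((1 + 1) + (1 + n)) + t + 1) + n)) + s + 1) + 1
      \<le> Suc m * (T + 2 * n + 10) + 3"
    using s(1) t(1) by simp
  ultimately show ?case unfolding eval_within_def by blast
qed auto

lemma those_eq_Some_conv: "those xs = Some ys \<longleftrightarrow> xs = map Some ys"
  by (induction xs arbitrary: ys) (auto split: option.splits simp: map_eq_Cons_conv Cons_eq_map_conv)

text \<open>A defined denotation limits every fold to \<open>N\<close> iterations, so costs add and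
  multiply along the structure of the program, and the bound depends on \<open>N\<close> alone, not
  on the environment or the oracle.\<close>

theorem code_correct:
  assumes "den N orc p \<rho> = Some x" and "length \<rho> = n" and "has_code idx fs (fun_ids n p)"
  shows "eval_within fs orc \<rho> (code idx n p) x (poly (time_poly n p) N)"
  using assms
proof (induction p arbitrary: \<rho> n x)
  case (PVar i)
  then show ?case
    by (auto simp: eval_within_def split: if_splits intro!: exI[of _ 1] eval_Var[simplified])
next
  case (PApp q ps)
  obtain xs where xs: "map (\<lambda>p. den N orc p \<rho>) ps = map Some xs" "den N orc q xs = Some x"
    using PApp.prems(1) by (auto simp: bind_eq_Some_conv those_eq_Some_conv)
  have "set ps' \<subseteq> set ps \<Longrightarrow> map (\<lambda>p. den N orc p \<rho>) ps' = map Some xs' \<Longrightarrow>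
    \<exists>t\<le>poly (sum_list (map (time_poly n) ps')) N. evals fs orc \<rho> (map (code idx n) ps') xs' t"
    for ps' xs'
  proof (induction ps' arbitrary: xs')
    case Nil
    then show ?case by (auto intro: evals_Nil)
  next
    case (Cons p ps')
    then obtain x' xs'' where x': "xs' = x' # xs''" "den N orc p \<rho> = Some x'"
      "map (\<lambda>p. den N orc p \<rho>) ps' = map Some xs''" by (auto simp: Cons_eq_map_conv)
    have "eval_within fs orc \<rho> (code idx n p) x' (poly (time_poly n p) N)"
      using Cons.prems(1) PApp.prems(3) by (intro PApp.IH(2)[OF _ x'(2) PApp.prems(2)]) auto
    then obtain s where s: "s \<le> poly (time_poly n p) N" "eval fs orc \<rho> (code idx n p) x' s"
      by (auto simp: eval_within_def)
    obtain t where t: "t \<le> poly (sum_list (map (time_poly n) ps')) N"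
      "evals fs orc \<rho> (map (code idx n) ps') xs'' t"
      using Cons.IH[OF _ x'(3)] Cons.prems(1) by auto
    show ?case using evals_Cons[OF s(2) t(2)] s(1) t(1) x'(1)
      by (intro exI[of _ "s + t"]) simp
  qed
  from this[OF _ xs(1)] obtain s where
    s: "s \<le> poly (sum_list (map (time_poly n) ps)) N" "evals fs orc \<rho> (map (code idx n) ps) xs s"
    by blast
  have len: "length xs = length ps" using xs(1) by (metis length_map)
  have "eval_within fs orc xs (code idx (length ps) q) x (poly (time_poly (length ps) q) N)"
    using PApp.prems(3) by (intro PApp.IH(1)[OF xs(2) len]) auto
  then obtain t where t: "t \<le> poly (time_poly (length ps) q) N"
    "eval fs orc xs (code idx (length ps) q) x t" by (auto simp: eval_within_def)
  have "eval fs orc \<rho> (code idx n (PApp q ps)) x (s + t + 1)"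
    unfolding code.simps using PApp.prems(3) s t by (intro eval_Call) auto
  then show ?case unfolding eval_within_def
    by (rule exI[of _ "s + t + 1", OF conjI, rotated]) (use s(1) t(1) in simp)
next
  case (PFold b p q)
  obtain xs a where den: "den N orc p \<rho> = Some xs" "den N orc q \<rho> = Some a"
    "bounded_fold N (\<lambda>x a. den N orc b (x # a # \<rho>)) xs a = Some x"
    using PFold.prems(1) by (auto simp: bind_eq_Some_conv)
  obtain s where s: "s \<le> poly (time_poly n p) N" "eval fs orc \<rho> (code idx n p) xs s"
    using PFold.IH(2)[OF den(1)] PFold.prems by (auto simp: eval_within_def)
  obtain t where t: "t \<le> poly (time_poly n q) N" "eval fs orc \<rho> (code idx n q) a t"
    using PFold.IH(3)[OF den(2)] PFold.prems by (auto simp: eval_within_def)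
  have "eval_within fs orc (xs # a # \<rho>) (fun_code idx (Loop n b)) x
    (N * (poly (time_poly (Suc (Suc n)) b) N + 2 * n + 10) + 3)"
    using PFold.prems by (intro loop_eval[OF _ _ _ den(3)] PFold.IH(1)) auto
  then obtain u where u: "u \<le> N * (poly (time_poly (Suc (Suc n)) b) N + 2 * n + 10) + 3"
    "eval fs orc (xs # a # \<rho>) (fun_code idx (Loop n b)) x u" by (auto simp: eval_within_def)
  have "eval fs orc \<rho> (code idx n (PFold b p q)) x ((s + (t + n)) + u + 1)"
    unfolding code.simps
    by (rule eval_Call[OF _ evals_Cons[OF s(2) evals_Cons[OF t(2)
              evals_all_vars[of fs orc \<rho>, unfolded PFold.prems(2)]]]])
      (use PFold.prems(3) u(2) in simp_all)
  moreover have "(s + (t + n)) + u + 1 \<le> poly (time_poly n (PFold b p q)) N"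
    using s t u by (simp add: algebra_simps)
  ultimately show ?case unfolding eval_within_def by blast
next
  case (PIf c p q)
  then obtain z where z: "den N orc c \<rho> = Some z" by (auto simp: bind_eq_Some_conv)
  obtain s where s: "s \<le> poly (time_poly n c) N" "eval fs orc \<rho> (code idx n c) z s"
    using PIf.IH(1)[OF z] PIf.prems by (auto simp: eval_within_def)
  show ?case
  proof (cases "z = VNil")
    case True
    then obtain t where "t \<le> poly (time_poly n q) N" "eval fs orc \<rho> (code idx n q) x t"
      using PIf.IH(3)[of \<rho> x n] PIf.prems z by (auto simp: eval_within_def)
    then show ?thesis using s True
      by (auto simp: eval_within_def intro!: exI[of _ "s + t + 1"] eval_Cond_False)
  next
    case False
    then obtain t where "t \<le> poly (time_poly n p) N" "eval fs orc \<rho> (code idx n p) x t"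
      using PIf.IH(2)[of \<rho> x n] PIf.prems z by (auto simp: eval_within_def)
    then show ?thesis using s False
      by (auto simp: eval_within_def intro!: exI[of _ "s + t + 1"] intro: eval_Cond_True)
  qed
next
  case (PQuery j p)
  then obtain z where z: "den N orc p \<rho> = Some z" "query_result (orc j) z = Some x"
    by (auto simp: bind_eq_Some_conv)
  then obtain us where us: "z = val_list (map val_nat us)"
    by (auto simp: query_result_def split: if_splits)
  have x: "x = val_bool (orc j (set us))" using z(2) us by simp
  show ?case using PQuery.prems(2,3) unfolding x code.simps time_poly.simps
    by (intro eval_within_unary[OF eval_Query PQuery.IH[OF z(1)[unfolded us]]]) auto
next
  case (PLet p q)
  then obtain z where z: "den N orc p \<rho> = Some z" "den N orc q (z # \<rho>) = Some x"
    by (auto simp: bind_eq_Some_conv)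
  show ?case using PLet.prems(2,3) unfolding code.simps time_poly.simps
    by (intro eval_within_binary[OF eval_Bind PLet.IH(1)[OF z(1)] PLet.IH(2)[OF z(2)]]) auto
next
  case (PCons p q)
  then obtain y z where z: "den N orc p \<rho> = Some y" "den N orc q \<rho> = Some z" "x = VCons y z"
    by (auto simp: bind_eq_Some_conv)
  show ?case using PCons.prems(2,3) unfolding z(3) code.simps time_poly.simps
    by (intro eval_within_binary[OF eval_MkPair PCons.IH(1)[OF z(1)] PCons.IH(2)[OF z(2)]]) auto
next
  case (PFst p)
  then obtain y z where z: "den N orc p \<rho> = Some (VCons y z)" "x = y"
    by (auto simp: bind_eq_Some_conv elim!: val_fst.elims)
  show ?case using PFst.prems(2,3) unfolding z(2) code.simps time_poly.simps
    by (intro eval_within_unary[OF eval_Fst PFst.IH[OF z(1)]]) auto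
next
  case (PSnd p)
  then obtain y z where z: "den N orc p \<rho> = Some (VCons y z)" "x = z"
    by (auto simp: bind_eq_Some_conv elim!: val_snd.elims)
  show ?case using PSnd.prems(2,3) unfolding z(2) code.simps time_poly.simps
    by (intro eval_within_unary[OF eval_Snd PSnd.IH[OF z(1)]]) auto
next
  case (PAdd p q)
  then obtain y z where z: "den N orc p \<rho> = Some (VNum y)" "den N orc q \<rho> = Some (VNum z)"
    "x = VNum (y + z)"
    by (auto simp: bind_eq_Some_conv elim!: val_num2.elims)
  show ?case using PAdd.prems(2,3) unfolding z(3) code.simps time_poly.simps
    by (intro eval_within_binary[OF eval_Add PAdd.IH(1)[OF z(1)] PAdd.IH(2)[OF z(2)]]) auto
next
  case (PSub p q)
  then obtain y z where z: "den N orc p \<rho> = Some (VNum y)" "den N orc q \<rho> = Some (VNum z)"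
    "x = VNum (y - z)"
    by (auto simp: bind_eq_Some_conv elim!: val_num2.elims)
  show ?case using PSub.prems(2,3) unfolding z(3) code.simps time_poly.simps
    by (intro eval_within_binary[OF eval_Sub PSub.IH(1)[OF z(1)] PSub.IH(2)[OF z(2)]]) auto
next
  case (PLeq p q)
  then obtain y z where z: "den N orc p \<rho> = Some (VNum y)" "den N orc q \<rho> = Some (VNum z)"
    "x = val_bool (y \<le> z)"
    by (auto simp: bind_eq_Some_conv elim!: val_num2.elims)
  show ?case using PLeq.prems(2,3) unfolding z(3) code.simps time_poly.simps
    by (intro eval_within_binary[OF eval_Leq PLeq.IH(1)[OF z(1)] PLeq.IH(2)[OF z(2)]]) auto
qed (auto simp: eval_within_def intro: eval_Empty[simplified] eval_Zero[simplified] eval_One[simplified])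

lemma finite_fun_ids: "finite (fun_ids n p)"
  by (induction n p rule: fun_ids.induct) auto

text \<open>The code is fixed before \<open>N\<close>, the oracle and the environment are known. The
  program mentions finitely many functions, and any listing of them gives the positions
  \<open>idx\<close>.\<close>

theorem compile:
  obtains main :: expr and fs :: "expr list" where
    "\<And>N orc \<rho> x. den N orc p \<rho> = Some x \<Longrightarrow> length \<rho> = n \<Longrightarrow>
      \<exists>t\<le>poly (time_poly n p) N. eval fs orc \<rho> main x t"
proof -
  obtain ids where ids: "set ids = fun_ids n p" using finite_list[OF finite_fun_ids] by blast
  define idx where "idx f = (SOME i. i < length ids \<and> ids ! i = f)" for f
  define fs where "fs = map (fun_code idx) ids"
  have "idx f < length ids \<and> ids ! idx f = f" if "f \<in> fun_ids n p" for f
    unfolding idx_def using that ids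
    by - (rule someI_ex[of "\<lambda>i. i < length ids \<and> ids ! i = f"], simp add: in_set_conv_nth[symmetric])
  then have "has_code idx fs (fun_ids n p)" by (auto simp: fs_def)
  then show thesis
    using code_correct[where fs = fs and idx = idx and p = p and n = n]
    by (intro that[of fs "code idx n p"]) (auto simp: eval_within_def)
qed

section \<open>Matroids\<close>

lemma matroid_finite: "matroid S A \<Longrightarrow> X \<in> A \<Longrightarrow> finite X"
  unfolding matroid_def by (meson PowD finite_subset in_mono)

lemma matroid_carrier: "matroid S A \<Longrightarrow> X \<in> A \<Longrightarrow> X \<subseteq> S"
  unfolding matroid_def by blast

lemma matroid_subset: "matroid S A \<Longrightarrow> X \<in> A \<Longrightarrow> Y \<subseteq> X \<Longrightarrow> Y \<in> A"
  unfolding matroid_def by blast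

lemma matroid_augment:
  "matroid S A \<Longrightarrow> X \<in> A \<Longrightarrow> Y \<in> A \<Longrightarrow> card X < card Y \<Longrightarrow> \<exists>y\<in>Y - X. insert y X \<in> A"
  unfolding matroid_def by blast

lemma matroid_extend:
  assumes "matroid S A" and "X \<in> A" and "Y \<in> A" and "card X \<le> card Y"
  shows "\<exists>Z. X \<subseteq> Z \<and> Z \<subseteq> X \<union> Y \<and> Z \<in> A \<and> card Z = card Y"
  using assms(2,4)
proof (induction "card Y - card X" arbitrary: X)
  case 0
  then show ?case by (intro exI[of _ X]) auto
next
  case (Suc d)
  then obtain y where y: "y \<in> Y - X" "insert y X \<in> A"
    using matroid_augment[OF assms(1) Suc.prems(1) assms(3)] Suc.hyps(2) by (metis zero_less_Suc zero_less_diff)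
  have "card (insert y X) = Suc (card X)"
    using y matroid_finite[OF assms(1) Suc.prems(1)] by simp
  then have "d = card Y - card (insert y X)" "card (insert y X) \<le> card Y"
    using Suc.hyps(2) by simp_all
  from Suc.hyps(1)[OF this(1) y(2) this(2)] obtain Z
    where "insert y X \<subseteq> Z" "Z \<subseteq> insert y X \<union> Y" "Z \<in> A" "card Z = card Y" by blast
  then show ?case using y by (intro exI[of _ Z]) auto
qed

lemma matroid_rank_ge: assumes "matroid U I" "X \<in> I" shows "card X \<le> matroid_rank I"
proof -
  have "finite I" using assms(1) unfolding matroid_def by (meson finite_Pow_iff finite_subset)
  then show ?thesis unfolding matroid_rank_def using assms(2) by simp
qed

lemma bases_iff: assumes M: "matroid U I" shows "X \<in> bases I \<longleftrightarrow> X \<in> I \<and> card X = matroid_rank I"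
proof
  assume X: "X \<in> bases I"
  then have XI: "X \<in> I" unfolding bases_def by simp
  have "finite I" using M unfolding matroid_def by (meson finite_Pow_iff finite_subset)
  then have "matroid_rank I \<in> card ` I" unfolding matroid_rank_def using XI by (intro Max_in) auto
  then obtain Y where Y: "Y \<in> I" "card Y = matroid_rank I" by auto
  have "\<not> card X < card Y"
  proof
    assume "card X < card Y"
    then obtain y where "y \<in> Y - X" "insert y X \<in> I" using matroid_augment[OF M XI Y(1)] by blast
    then show False using X unfolding bases_def by blast
  qed
  then show "X \<in> I \<and> card X = matroid_rank I" using XI Y matroid_rank_ge[OF M XI] by simp
next
  assume X: "X \<in> I \<and> card X = matroid_rank I"
  have "Y = X" if "Y \<in> I" "X \<subseteq> Y" for Y
    using card_seteq[OF matroid_finite[OF M that(1)] that(2)] X matroid_rank_ge[OF M that(1)] by simp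
  then show "X \<in> bases I" using X unfolding bases_def by blast
qed

lemma bases_nonempty: assumes M: "matroid U I" shows "bases I \<noteq> {}"
proof -
  have "finite I" using M unfolding matroid_def by (meson finite_Pow_iff finite_subset)
  moreover have "I \<noteq> {}" using M unfolding matroid_def by blast
  ultimately have "matroid_rank I \<in> card ` I" unfolding matroid_rank_def by (intro Max_in) auto
  then obtain B where "B \<in> I" "card B = matroid_rank I" by auto
  then show ?thesis using bases_iff[OF M] by blast
qed

text \<open>Only sets of equal size compete: weights may be negative, and the set grows by one
  element at a time.\<close>

definition min_weight :: "'a set set \<Rightarrow> ('a \<Rightarrow> real) \<Rightarrow> 'a set \<Rightarrow> bool" where
  "min_weight A p I \<longleftrightarrow> I \<in> A \<and> (\<forall>J\<in>A. card J = card I \<longrightarrow> sum p I \<le> sum p J)"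

lemma sum_swap:
  fixes p :: "'a \<Rightarrow> real"
  assumes "finite J" "v \<in> J" "u \<notin> J"
  shows "sum p (insert u (J - {v})) = sum p J - p v + p u"
  using assms by (simp add: sum_diff1)

lemma card_swap: "finite J \<Longrightarrow> v \<in> J \<Longrightarrow> u \<notin> J \<Longrightarrow> card (insert u (J - {v})) = card J"
  using card.remove[of J v] by simp

lemma min_weight_swap:
  assumes "matroid S A" "min_weight A p I" "u \<in> I" "v \<notin> I" "insert v (I - {u}) \<in> A"
  shows "p u \<le> p v"
proof -
  have "finite I" using assms(1,2) by (auto simp: min_weight_def intro: matroid_finite)
  then have "sum p I \<le> sum p (insert v (I - {u}))"
    using assms card_swap[of I u v] unfolding min_weight_def by blast
  then show ?thesis using sum_swap[of I u v p] \<open>finite I\<close> assms by simp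
qed

text \<open>Given a competitor \<open>J\<close>, take the heaviest \<open>x\<close> in
  \<open>I - J\<close>. Some \<open>v\<close> of \<open>J - I\<close> can replace it in
  \<open>I\<close>, so \<open>p x \<le> p v\<close>; some \<open>u\<close> of \<open>I - J\<close>
  can then replace \<open>v\<close> in \<open>J\<close>, and \<open>p u \<le> p x\<close>. The new
  competitor is no heavier and agrees with \<open>I\<close> in one more element.\<close>

lemma min_weightI:
  assumes M: "matroid S A" and I: "I \<in> A"
    and opt: "\<And>u v. u \<in> I \<Longrightarrow> v \<in> S - I \<Longrightarrow> insert v (I - {u}) \<in> A \<Longrightarrow> p u \<le> p v"
  shows "min_weight A p I"
proof -
  have fI: "finite I" using matroid_finite[OF M I] .
  have "sum p I \<le> sum p J" if "J \<in> A" "card J = card I" for J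
    using that
  proof (induction "card (I - J)" arbitrary: J)
    case 0
    then have "I \<subseteq> J" using fI by simp
    then have "I = J" using 0 card_subset_eq[OF matroid_finite[OF M 0(2)]] by simp
    then show ?case by simp
  next
    case (Suc n)
    have fJ: "finite J" using matroid_finite[OF M Suc.prems(1)] .
    have "I - J \<noteq> {}" using Suc.hyps(2) by force
    then obtain x where x: "x \<in> I - J" "\<And>u. u \<in> I - J \<Longrightarrow> p u \<le> p x"
    proof -
      have "finite (p ` (I - J))" "p ` (I - J) \<noteq> {}" using fI \<open>I - J \<noteq> {}\<close> by auto
      from Max_in[OF this] Max_ge[OF this(1)] show thesis using that by (metis imageE imageI)
    qed
    have "card (I - {x}) < card J" using x fI Suc.prems(2) by (metis DiffD1 card_Diff1_less)
    then obtain v where v: "v \<in> J - (I - {x})" "insert v (I - {x}) \<in> A"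
      using matroid_augment[OF M matroid_subset[OF M I, of "I - {x}"] Suc.prems(1)] by auto
    have v': "v \<in> J" "v \<notin> I" using v x by auto
    have pxv: "p x \<le> p v" using opt[of x v] v v' x matroid_carrier[OF M Suc.prems(1)] by auto
    have "card (J - {v}) < card I" using v' fJ Suc.prems(2) by (metis card_Diff1_less)
    then obtain u where u: "u \<in> I - (J - {v})" "insert u (J - {v}) \<in> A"
      using matroid_augment[OF M matroid_subset[OF M Suc.prems(1), of "J - {v}"] I] by auto
    have u': "u \<in> I" "u \<notin> J" using u v' by auto
    let ?J = "insert u (J - {v})"
    have "I - J = insert u (I - ?J)" "u \<notin> I - ?J" using u' v' by auto
    then have "card (I - ?J) = n" using Suc.hyps(2) fI by (metis card_insert_disjoint finite_Diff nat.inject)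
    then have "sum p I \<le> sum p ?J"
      using Suc.hyps(1)[of ?J] u(2) card_swap[OF fJ v'(1) u'(2)] Suc.prems(2) by simp
    also have "\<dots> = sum p J - p v + p u" by (rule sum_swap[OF fJ v'(1) u'(2)])
    also have "\<dots> \<le> sum p J" using x(2)[of u] u' pxv by simp
    finally show ?case .
  qed
  then show ?thesis using I by (simp add: min_weight_def)
qed

text \<open>The greedy step: a competitor with one more element contains some \<open>z\<close> that
  can be added to \<open>I\<close>. Without \<open>z\<close> it weighs at least as much as
  \<open>I\<close>, and \<open>z\<close> weighs at least as much as \<open>x\<close>.\<close>

lemma min_weight_add:
  assumes M: "matroid S A" and I: "min_weight A p I"
    and x: "insert x I \<in> A" "x \<notin> I" "\<And>z. z \<notin> I \<Longrightarrow> insert z I \<in> A \<Longrightarrow> p x \<le> p z"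
    and J: "J \<in> A" "card J = Suc (card I)"
  shows "sum p I + p x \<le> sum p J"
proof -
  have IA: "I \<in> A" using I by (simp add: min_weight_def)
  obtain z where z: "z \<in> J - I" "insert z I \<in> A" using matroid_augment[OF M IA J(1)] J(2) by auto
  have fJ: "finite J" using matroid_finite[OF M J(1)] .
  have "J - {z} \<in> A" "card (J - {z}) = card I"
    using matroid_subset[OF M J(1)] z J(2) fJ by auto
  then have "sum p I \<le> sum p (J - {z})" using I by (simp add: min_weight_def)
  moreover have "sum p (J - {z}) = sum p J - p z" using z fJ by (simp add: sum_diff1)
  moreover have "p x \<le> p z" using x(3) z by auto
  ultimately show ?thesis by simp
qed

text \<open>The sets \<open>I - {y}\<close> before and after the exchange differ only in
  \<open>yk\<close> and \<open>xk\<close>. Augmenting one of them from a set that contains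
  \<open>z\<close> adds either \<open>z\<close> or the missing one of these two, and the latter
  would make \<open>insert xk (I - {y})\<close> independent.\<close>

lemma swap_preserves_exchange:
  assumes M: "matroid S A" and I: "I \<in> A" and yk: "yk \<in> I" "xk \<notin> I" "insert xk (I - {yk}) \<in> A"
    and y: "y \<in> I" "y \<noteq> yk" "insert xk (I - {y}) \<notin> A" and z: "z \<notin> I" "z \<noteq> xk"
  shows "insert z (insert xk (I - {yk}) - {y}) \<in> A \<longleftrightarrow> insert z (I - {y}) \<in> A"
proof -
  let ?I = "insert xk (I - {yk})"
  have fI: "finite I" using matroid_finite[OF M I] .
  have ne: "xk \<noteq> y" using yk y by auto
  have sub: "I - {y} \<in> A" "?I - {y} \<in> A"
    using matroid_subset[OF M I] matroid_subset[OF M yk(3)] by auto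
  have c1: "card (I - {y}) = card I - 1" using y fI by simp
  have c2: "card (?I - {y}) = card I - 1"
    using card_swap[OF fI yk(1,2)] y ne fI by (simp add: card_Diff_singleton)
  have pos: "0 < card I" using y fI by (auto simp: card_gt_0_iff)
  have c3: "card (insert z (?I - {y})) = card I" using c2 z fI pos by auto
  have c4: "card (insert z (I - {y})) = card I" using c1 z fI pos by auto
  show ?thesis
  proof
    assume "insert z (?I - {y}) \<in> A"
    then obtain t where t: "t \<in> insert z (?I - {y}) - (I - {y})" "insert t (I - {y}) \<in> A"
      using matroid_augment[OF M sub(1)] c1 c3 pos by (metis diff_less zero_less_one)
    then have "t = z \<or> t = xk" by auto
    then show "insert z (I - {y}) \<in> A" using t y by auto
  next
    assume "insert z (I - {y}) \<in> A"
    then obtain t where t: "t \<in> insert z (I - {y}) - (?I - {y})" "insert t (?I - {y}) \<in> A"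
      using matroid_augment[OF M sub(2)] c2 c4 pos by (metis diff_less zero_less_one)
    then have "t = z \<or> t = yk" by auto
    moreover have "insert yk (?I - {y}) = insert xk (I - {y})" using yk y ne by auto
    ultimately show "insert z (?I - {y}) \<in> A" using t(2) y(3) by metis
  qed
qed

text \<open>The last hypothesis orders the pairs, by weight and then by decreasing index, such that
  every exchange between different pairs leads upwards. The given pairing is thus the only perfect
  matching of its exchange graph, which is what makes the simultaneous exchange valid.\<close>

lemma exchange_many:
  fixes x y :: "nat \<Rightarrow> 'a" and a :: "nat \<Rightarrow> real"
  assumes M: "matroid S A" and "finite K" and "I \<in> A"
    and "inj_on x K" "inj_on y K" "\<And>i. i \<in> K \<Longrightarrow> y i \<in> I" "\<And>i. i \<in> K \<Longrightarrow> x i \<notin> I"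
    and "\<And>i. i \<in> K \<Longrightarrow> insert (x i) (I - {y i}) \<in> A"
    and "\<And>i j. i \<in> K \<Longrightarrow> j \<in> K \<Longrightarrow> i \<noteq> j \<Longrightarrow> insert (x j) (I - {y i}) \<in> A \<Longrightarrow>
      a i < a j \<or> a i = a j \<and> j < i"
  shows "I - y ` K \<union> x ` K \<in> A"
  using assms(2-)
proof (induction "card K" arbitrary: K I)
  case 0
  then show ?case by simp
next
  case (Suc n)
  note IA = Suc.prems(2) and inj = Suc.prems(3,4) and yI = Suc.prems(5) and xI = Suc.prems(6)
    and ex = Suc.prems(7) and order = Suc.prems(8)
  \<comment> \<open>The pair of least weight, and of largest index among these, is exchanged first: its new element
    can replace none of the other removed elements, so the hypotheses survive for the other pairs.\<close>
  have "K \<noteq> {}" using Suc.hyps(2) by auto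
  define m where "m = Min (a ` K)"
  have m: "m \<in> a ` K" "\<And>i. i \<in> K \<Longrightarrow> m \<le> a i"
    unfolding m_def using Suc.prems(1) \<open>K \<noteq> {}\<close> by auto
  define k where "k = Max {i \<in> K. a i = m}"
  have "finite {i \<in> K. a i = m}" "{i \<in> K. a i = m} \<noteq> {}" using m Suc.prems(1) by auto
  from Max_in[OF this] Max_ge[OF this(1)]
  have k: "k \<in> K" "a k = m" "\<And>i. i \<in> K \<Longrightarrow> a i = m \<Longrightarrow> i \<le> k" unfolding k_def by auto
  have last: "insert (x k) (I - {y i}) \<notin> A" if "i \<in> K" "i \<noteq> k" for i
    using order[OF that(1) k(1) that(2)] m(2)[OF that(1)] k(2) k(3)[OF that(1)] by force
  let ?I = "insert (x k) (I - {y k})" and ?K = "K - {k}"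
  have yne: "y i \<noteq> y k" "x i \<noteq> x k" if "i \<in> ?K" for i
    using inj that k(1) by (auto simp: inj_on_def)
  have same: "insert (x j) (?I - {y i}) \<in> A \<longleftrightarrow> insert (x j) (I - {y i}) \<in> A"
    if "i \<in> ?K" "j \<in> ?K" for i j
    using that yne[OF that(1)] yne[OF that(2)] k(1) last[of i]
    by (intro swap_preserves_exchange[OF M IA yI xI ex]) (auto simp: yI xI)
  have "?I - y ` ?K \<union> x ` ?K \<in> A"
  proof (rule Suc.hyps(1))
    show "n = card ?K" using Suc.hyps(2) Suc.prems(1) k(1) by simp
    show "finite ?K" using Suc.prems(1) by simp
    show "?I \<in> A" using ex[OF k(1)] .
    show "inj_on x ?K" "inj_on y ?K" using inj by (auto simp: inj_on_def)
    show "y i \<in> ?I" "x i \<notin> ?I" "insert (x i) (?I - {y i}) \<in> A" if "i \<in> ?K" for i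
      using that yne[OF that] same[OF that that] by (auto simp: yI xI ex)
    show "a i < a j \<or> a i = a j \<and> j < i"
      if "i \<in> ?K" "j \<in> ?K" "i \<noteq> j" "insert (x j) (?I - {y i}) \<in> A" for i j
      using that same[of i j] order[of i j] by auto
  qed
  moreover have "?I - y ` ?K \<union> x ` ?K = I - y ` K \<union> x ` K"
  proof -
    have "x ` K = insert (x k) (x ` ?K)" "y ` K = insert (y k) (y ` ?K)" using k(1) by auto
    moreover have "x k \<notin> y ` ?K" using yI xI[OF k(1)] by (metis DiffD1 imageE)
    ultimately show ?thesis by auto
  qed
  ultimately show ?case by simp
qed

text \<open>\<open>x 0\<close> is added first, then all pairs are exchanged at once. Tightness
  balances the pairs, so the weight grows by exactly \<open>p (x 0)\<close>, the least possible.
  \<open>short\<close> excludes tight exchanges that skip ahead, and \<open>start\<close> excludes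
  other additions that are equally cheap; both come from a walk with fewest arcs.\<close>

lemma augment_min_weight:
  fixes x y :: "nat \<Rightarrow> 'a" and p :: "'a \<Rightarrow> real"
  assumes M: "matroid S A" and min: "min_weight A p I"
    and inj: "inj_on x {0..k}" "inj_on y {1..k}"
    and yI: "\<And>i. i \<in> {1..k} \<Longrightarrow> y i \<in> I" and xI: "\<And>i. i \<in> {0..k} \<Longrightarrow> x i \<notin> I"
    and x0: "insert (x 0) I \<in> A" "\<And>z. z \<notin> I \<Longrightarrow> insert z I \<in> A \<Longrightarrow> p (x 0) \<le> p z"
    and ex: "\<And>i. i \<in> {1..k} \<Longrightarrow> insert (x i) (I - {y i}) \<in> A"
    and tight: "\<And>i. i \<in> {1..k} \<Longrightarrow> p (x i) = p (y i)"
    and short: "\<And>i j. i \<in> {1..k} \<Longrightarrow> j \<in> {1..k} \<Longrightarrow> i < j \<Longrightarrow>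
      insert (x j) (I - {y i}) \<in> A \<Longrightarrow> p (x j) = p (y i) \<Longrightarrow> False"
    and start: "\<And>j. j \<in> {1..k} \<Longrightarrow> insert (x j) I \<in> A \<Longrightarrow> p (x j) = p (x 0) \<Longrightarrow> False"
  shows "min_weight A p (I - y ` {1..k} \<union> x ` {0..k})"
    and "card (I - y ` {1..k} \<union> x ` {0..k}) = Suc (card I)"
proof -
  have IA: "I \<in> A" using min by (simp add: min_weight_def)
  have fI: "finite I" using matroid_finite[OF M IA] .
  let ?I0 = "insert (x 0) I"
  have x0I: "x 0 \<notin> I" using xI by simp
  have ne0: "x j \<noteq> x 0" if "j \<in> {1..k}" for j
    using inj_onD[OF inj(1), of j 0] that by auto
  have le0: "p (y i) \<le> p (x 0)" if "i \<in> {1..k}" for i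
    by (rule min_weight_swap[OF M min yI[OF that] x0I matroid_subset[OF M x0(1)]]) auto
  \<comment> \<open>An addable \<open>x j\<close> would weigh at least \<open>p (x 0)\<close>, while
    tightness and \<open>le0\<close> bound it by \<open>p (x 0)\<close>; equality is excluded by
    \<open>start\<close>.\<close>
  have nosrc: "insert (x j) I \<notin> A" if "j \<in> {1..k}" for j
    using start[OF that] x0(2)[of "x j"] le0[OF that] tight[OF that] xI[of j] that by force
  \<comment> \<open>A set with \<open>x j\<close> in place of \<open>y i\<close> can be enlarged
    from \<open>?I0\<close> only by \<open>x 0\<close>, since enlarging it by \<open>y i\<close>
    would make \<open>x j\<close> addable. Hence the addition of \<open>x 0\<close> changes no
    exchange.\<close>
  have same: "insert (x j) (?I0 - {y i}) \<in> A \<longleftrightarrow> insert (x j) (I - {y i}) \<in> A"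
    if ij: "i \<in> {1..k}" "j \<in> {1..k}" for i j
  proof
    assume "insert (x j) (?I0 - {y i}) \<in> A"
    then show "insert (x j) (I - {y i}) \<in> A" by (rule matroid_subset[OF M]) auto
  next
    assume asm: "insert (x j) (I - {y i}) \<in> A"
    have "card (insert (x j) (I - {y i})) < card ?I0"
      using card_swap[OF fI yI[OF ij(1)] xI[of j]] ij fI x0I by simp
    then obtain t where t: "t \<in> ?I0 - insert (x j) (I - {y i})"
      "insert t (insert (x j) (I - {y i})) \<in> A"
      using matroid_augment[OF M asm x0(1)] by auto
    have "insert (y i) (insert (x j) (I - {y i})) = insert (x j) I" using yI[OF ij(1)] by auto
    then have "t = x 0" using t nosrc[OF ij(2)] by auto
    moreover have "insert (x 0) (insert (x j) (I - {y i})) = insert (x j) (?I0 - {y i})"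
      using yI[OF ij(1)] x0I by auto
    ultimately show "insert (x j) (?I0 - {y i}) \<in> A" using t by simp
  qed
  have "?I0 - y ` {1..k} \<union> x ` {1..k} \<in> A"
  proof (rule exchange_many[OF M _ x0(1), where a = "\<lambda>i. p (x i)"])
    show "inj_on x {1..k}" using inj(1) by (auto simp: inj_on_def)
    show "inj_on y {1..k}" by fact
    show "y i \<in> ?I0" "x i \<notin> ?I0" "insert (x i) (?I0 - {y i}) \<in> A" if "i \<in> {1..k}" for i
      using that same[OF that that] yI[OF that] xI[of i] ne0[OF that] ex[OF that] by auto
    show "p (x i) < p (x j) \<or> p (x i) = p (x j) \<and> j < i"
      if "i \<in> {1..k}" "j \<in> {1..k}" "i \<noteq> j" "insert (x j) (?I0 - {y i}) \<in> A" for i j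
    proof -
      have e: "insert (x j) (I - {y i}) \<in> A" using that same by blast
      have "p (y i) \<le> p (x j)"
        using min_weight_swap[OF M min yI[OF that(1)] _ e] xI[of j] that(2) by auto
      then show ?thesis
        using tight[OF that(1)] short[OF that(1,2) _ e] that(3) by (cases "j < i") force+
    qed
  qed simp
  moreover have x0_im: "x ` {0..k} = insert (x 0) (x ` {1..k})"
    using atLeastAtMost_insertL[of 0 k] by (metis One_nat_def image_insert zero_le)
  moreover have "x 0 \<notin> y ` {1..k}" using yI x0I by auto
  ultimately have I': "I - y ` {1..k} \<union> x ` {0..k} \<in> A" by (auto simp: insert_Diff_if)
  have disj: "(I - y ` {1..k}) \<inter> x ` {0..k} = {}" using xI by auto
  have ysub: "y ` {1..k} \<subseteq> I" using yI by auto
  have cy: "card (y ` {1..k}) = k" using card_image[OF inj(2)] by simp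
  then have kle: "k \<le> card I" using card_mono[OF fI ysub] by simp
  show card: "card (I - y ` {1..k} \<union> x ` {0..k}) = Suc (card I)"
    using card_Un_disjoint[OF _ _ disj] fI card_Diff_subset[OF _ ysub] cy card_image[OF inj(1)] kle
    by simp
  have "sum p (I - y ` {1..k} \<union> x ` {0..k}) = sum p I - sum p (y ` {1..k}) + sum p (x ` {0..k})"
    using sum.union_disjoint[OF _ _ disj, of p] fI sum_diff[OF fI ysub, of p] by simp
  also have "sum p (y ` {1..k}) = sum (\<lambda>i. p (y i)) {1..k}" 
    unfolding sum.reindex[OF inj(2)] by simp
  also have "sum p (x ` {0..k}) = p (x 0) + sum (\<lambda>i. p (x i)) {1..k}"
    unfolding sum.reindex[OF inj(1)] by (simp add: sum.atLeast_Suc_atMost[of 0])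
  also have "sum (\<lambda>i. p (x i)) {1..k} = sum (\<lambda>i. p (y i)) {1..k}" using tight by auto
  finally have w: "sum p (I - y ` {1..k} \<union> x ` {0..k}) = sum p I + p (x 0)" by simp
  show "min_weight A p (I - y ` {1..k} \<union> x ` {0..k})"
    unfolding min_weight_def using I' card w min_weight_add[OF M min x0(1) x0I x0(2)] by auto
qed

section \<open>Shortest walks with fewest arcs\<close>

text \<open>Walks are listed backwards: the head is the end vertex, the last entry the source.\<close>

fun walk :: "('a \<Rightarrow> 'a \<Rightarrow> bool) \<Rightarrow> 'a set \<Rightarrow> 'a list \<Rightarrow> bool" where
  "walk E X [] \<longleftrightarrow> False"
| "walk E X [x] \<longleftrightarrow> x \<in> X"
| "walk E X (x # y # P) \<longleftrightarrow> E y x \<and> walk E X (y # P)"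

abbreviation walk_length :: "('a \<Rightarrow> real) \<Rightarrow> 'a list \<Rightarrow> real" where
  "walk_length l P \<equiv> sum_list (map l P)"

lemma walk_Cons: "walk E X P \<Longrightarrow> E (hd P) x \<Longrightarrow> walk E X (x # P)"
  by (cases P) auto

lemma walk_suffix: "walk E X (P @ z # R) \<Longrightarrow> walk E X (z # R)"
proof (induction P)
  case (Cons a P)
  then show ?case by (cases P) auto
qed simp

lemma walk_replace: "walk E X (P @ z # R) \<Longrightarrow> walk E X (z # R') \<Longrightarrow> walk E X (P @ z # R')"
proof (induction P)
  case (Cons a P)
  then show ?case by (cases P) auto
qed simp

text \<open>A feasible potential excludes cycles of negative length, although the costs are signed.
  Lengths sit on the nodes, so an arc costs what its head costs.\<close>

definition potential :: "('a \<Rightarrow> 'a \<Rightarrow> bool) \<Rightarrow> ('a \<Rightarrow> real) \<Rightarrow> ('a \<Rightarrow> real) \<Rightarrow> bool" where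
  "potential E l \<pi> \<longleftrightarrow> (\<forall>x y. E x y \<longrightarrow> \<pi> y \<le> \<pi> x + l y)"

lemma walk_potential:
  assumes "potential E l \<pi>"
  shows "walk E X (P @ z # R) \<Longrightarrow> \<pi> (hd (P @ [z])) \<le> \<pi> z + walk_length l P"
proof (induction P)
  case (Cons a P)
  show ?case
  proof (cases P)
    case Nil
    then show ?thesis using Cons.prems assms unfolding potential_def by simp
  next
    case (Cons b Q)
    then have "\<pi> a \<le> \<pi> b + l a" using Cons.prems assms unfolding potential_def by simp
    then show ?thesis using Cons.IH Cons.prems Cons by simp
  qed
qed simp

text \<open>A closed piece of a walk has nonnegative length, because the potential takes the same
  value at both of its ends; so it can be cut out.\<close>

lemma walk_to_distinct:
  assumes pot: "potential E l \<pi>" and "walk E X W"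
  shows "\<exists>W'. walk E X W' \<and> distinct W' \<and> hd W' = hd W \<and>
    walk_length l W' \<le> walk_length l W \<and> length W' \<le> length W"
  using assms(2)
proof (induction "length W" arbitrary: W rule: less_induct)
  case less
  show ?case
  proof (cases "distinct W")
    case False
    then obtain xs y ys zs where W: "W = xs @ y # ys @ y # zs"
      using not_distinct_decomp[of W] by auto
    have w1: "walk E X (y # ys @ y # zs)" using less.prems W walk_suffix[of E X xs] by simp
    have w2: "walk E X (xs @ y # zs)"
      using walk_replace[of E X xs y "ys @ y # zs" zs] walk_suffix[of E X "y # ys" y zs] w1 less.prems W by simp
    have "\<pi> y \<le> \<pi> y + walk_length l (y # ys)"
      using walk_potential[of E l \<pi> X "y # ys" y zs] pot w1 by simp
    then have "walk_length l (xs @ y # zs) \<le> walk_length l W" using W by simp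
    moreover have "hd (xs @ y # zs) = hd W" using W by (cases xs) auto
    moreover have "length (xs @ y # zs) < length W" using W by simp
    ultimately show ?thesis using less.hyps[OF _ w2] by force
  qed (use less.prems in blast)
qed

lemma walk_nodes:
  assumes "\<And>x y. E x y \<Longrightarrow> y \<in> S" and "X \<subseteq> S"
  shows "walk E X W \<Longrightarrow> set W \<subseteq> S"
proof (induction W)
  case (Cons a W)
  then show ?case using assms by (cases W) auto
qed simp

text \<open>The values at unreachable nodes are arbitrary; \<open>splitting_from_distances\<close>
  has to replace them.\<close>

definition shortest_distances ::
    "('a \<Rightarrow> 'a \<Rightarrow> bool) \<Rightarrow> 'a set \<Rightarrow> ('a \<Rightarrow> real) \<Rightarrow> ('a \<Rightarrow> real) \<Rightarrow> bool" where
  "shortest_distances E X l d \<longleftrightarrow> (\<forall>W. walk E X W \<longrightarrow> d (hd W) \<le> walk_length l W \<and>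
     (\<exists>W'. walk E X W' \<and> hd W' = hd W \<and> walk_length l W' = d (hd W)))"

text \<open>Each distance is a minimum over walks without repetition, of which there are finitely
  many.\<close>

lemma distances_exist:
  assumes pot: "potential E l \<pi>"
    and S: "\<And>x y. E x y \<Longrightarrow> y \<in> S" "X \<subseteq> S" "finite S"
  shows "\<exists>d. shortest_distances E X l d"
proof -
  define D where "D x = {W. walk E X W \<and> distinct W \<and> hd W = x}" for x
  define d where "d x = Min (walk_length l ` D x)" for x
  have fin: "finite (D x)" for x
  proof (rule finite_subset)
    show "D x \<subseteq> {W. set W \<subseteq> S \<and> length W \<le> card S}"
    proof
      fix W assume "W \<in> D x"
      then have W: "walk E X W" "distinct W" unfolding D_def by auto
      have "set W \<subseteq> S" by (rule walk_nodes[OF _ S(2) W(1)]) (rule S(1))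
      then show "W \<in> {W. set W \<subseteq> S \<and> length W \<le> card S}"
        using card_mono[OF S(3)] distinct_card[OF W(2)] by (metis mem_Collect_eq)
    qed
    show "finite {W. set W \<subseteq> S \<and> length W \<le> card S}" using finite_lists_length_le[OF S(3)] .
  qed
  have "d (hd W) \<le> walk_length l W \<and>
      (\<exists>W'. walk E X W' \<and> hd W' = hd W \<and> walk_length l W' = d (hd W))" if w: "walk E X W" for W
  proof -
    obtain W' where W': "W' \<in> D (hd W)" "walk_length l W' \<le> walk_length l W"
      using walk_to_distinct[OF pot w] unfolding D_def by blast
    have "d (hd W) \<in> walk_length l ` D (hd W)"
      unfolding d_def using W'(1) fin by (intro Min_in) auto
    moreover have "d (hd W) \<le> walk_length l W'" unfolding d_def using W'(1) fin by simp
    ultimately show ?thesis using W'(2) unfolding D_def by force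
  qed
  then show ?thesis unfolding shortest_distances_def by blast
qed

definition best_walk ::
    "('a \<Rightarrow> 'a \<Rightarrow> bool) \<Rightarrow> 'a set \<Rightarrow> 'a set \<Rightarrow> ('a \<Rightarrow> real) \<Rightarrow> 'a list \<Rightarrow> bool" where
  "best_walk E X T l P \<longleftrightarrow> walk E X P \<and> hd P \<in> T \<and>
     (\<forall>W. walk E X W \<and> hd W \<in> T \<longrightarrow> walk_length l P < walk_length l W \<or>
        walk_length l P = walk_length l W \<and> length P \<le> length W)"

section \<open>Walks that are shortest and, among these, have fewest arcs\<close>

context
  fixes E :: "'a \<Rightarrow> 'a \<Rightarrow> bool" and X T :: "'a set" and l d :: "'a \<Rightarrow> real" and P :: "'a list"
  assumes best: "best_walk E X T l P"
    and dist: "shortest_distances E X l d"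
begin

lemma best_walk_no_better:
  "walk E X W \<Longrightarrow> hd W \<in> T \<Longrightarrow> walk_length l W \<le> walk_length l P \<Longrightarrow> length P \<le> length W"
  using best unfolding best_walk_def by force

text \<open>A shorter walk to an inner node \<open>z\<close> could be continued along
  \<open>P\<close> to a shorter walk to the same sink.\<close>

lemma best_walk_dist:
  assumes P: "P = Q @ z # R"
  shows "d z = walk_length l (z # R)"
proof (rule ccontr)
  assume ne: "d z \<noteq> walk_length l (z # R)"
  have wP: "walk E X P" "hd P \<in> T" using best unfolding best_walk_def by auto
  have wz: "walk E X (z # R)" using wP P walk_suffix by metis
  then have "d z < walk_length l (z # R)" using dist ne unfolding shortest_distances_def by fastforce
  moreover obtain W where W: "walk E X W" "hd W = z" "walk_length l W = d z"
    using dist wz unfolding shortest_distances_def by (metis list.sel(1))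
  then obtain R' where R': "W = z # R'" by (cases W) auto
  have "walk E X (Q @ z # R')" using walk_replace wP P W R' by metis
  moreover have "hd (Q @ z # R') \<in> T" using wP(2) P by (cases Q) auto
  ultimately show False using best P W R' unfolding best_walk_def by fastforce
qed

text \<open>By \<open>best_walk_dist\<close> the bypassed piece is as long as the tight arc, so the
  shortcut would save nodes at equal length.\<close>

lemma best_walk_no_shortcut:
  assumes P: "P = Q @ z' # Q' @ z # R" "Q' \<noteq> []" and "E z z'" "d z' = d z + l z'"
  shows False
proof -
  have wP: "walk E X P" "hd P \<in> T" using best unfolding best_walk_def by auto
  have wz: "walk E X (z # R)" using walk_suffix[of E X "Q @ z' # Q'" z R] wP(1) P(1) by simp
  have "walk E X (Q @ z' # z # R)"
    using walk_replace[of E X Q z' "Q' @ z # R" "z # R"] wP(1) P(1) wz assms(3) by simp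
  moreover have "hd (Q @ z' # z # R) \<in> T" using wP(2) P(1) by (cases Q) auto
  moreover have "d z = walk_length l (z # R)" "d z' = walk_length l (z' # Q' @ z # R)"
    using best_walk_dist[of "Q @ z' # Q'"] best_walk_dist[of Q] P(1) by auto
  then have "walk_length l (Q @ z' # z # R) \<le> walk_length l P" using assms(4) P(1) by simp
  ultimately have "length P \<le> length (Q @ z' # z # R)" by (rule best_walk_no_better)
  then show False using P by simp
qed

text \<open>Starting at \<open>z\<close> would cost no more and save nodes. The next lemma is the
  same argument at the other end.\<close>

lemma best_walk_no_inner_source:
  assumes P: "P = Q @ z # R" "R \<noteq> []" and "z \<in> X" "d z = l z"
  shows False
proof -
  have wP: "walk E X P" "hd P \<in> T" using best unfolding best_walk_def by auto
  have "walk E X (Q @ [z])" using walk_replace[of E X Q z R "[]"] wP(1) P(1) assms(3) by simp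
  moreover have "hd (Q @ [z]) \<in> T" using wP(2) P(1) by (cases Q) auto
  moreover have "walk_length l (Q @ [z]) \<le> walk_length l P"
    using best_walk_dist[OF P(1)] assms(4) P(1) by simp
  ultimately have "length P \<le> length (Q @ [z])" by (rule best_walk_no_better)
  then show False using P by simp
qed

lemma best_walk_no_inner_sink:
  assumes P: "P = Q @ z # R" "Q \<noteq> []" and "z \<in> T" "d z = walk_length l P"
  shows False
proof -
  have "walk E X (z # R)" using best P walk_suffix unfolding best_walk_def by metis
  moreover have "hd (z # R) \<in> T" using assms(3) by simp
  moreover have "walk_length l (z # R) \<le> walk_length l P"
    using best_walk_dist[OF P(1)] assms(4) by simp
  ultimately have "length P \<le> length (z # R)" by (rule best_walk_no_better)
  then show False using P by simp
qed

lemma best_walk_distinct: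
  assumes "potential E l \<pi>"
  shows "distinct P"
proof (rule ccontr)
  assume "\<not> distinct P"
  then obtain xs y ys zs where P: "P = xs @ y # ys @ y # zs" using not_distinct_decomp[of P] by auto
  have wP: "walk E X P" "hd P \<in> T" using best unfolding best_walk_def by auto
  have w1: "walk E X (y # ys @ y # zs)" using wP P walk_suffix[of E X xs] by simp
  have "walk E X (xs @ y # zs)"
    using walk_replace[of E X xs y "ys @ y # zs" zs] walk_suffix[of E X "y # ys" y zs] w1 wP P by simp
  moreover have "hd (xs @ y # zs) \<in> T" using wP(2) P by (cases xs) auto
  moreover have "\<pi> y \<le> \<pi> y + walk_length l (y # ys)"
    using walk_potential[of E l \<pi> X "y # ys" y zs] assms w1 by simp
  then have "walk_length l (xs @ y # zs) \<le> walk_length l P" using P by simp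
  ultimately have "length P \<le> length (xs @ y # zs)" by (rule best_walk_no_better)
  then show False using P by simp
qed

end

section \<open>Bellman-Ford labels that carry their walks\<close>

type_synonym 'a label = "(real \<times> 'a list) option"

text \<open>The invariant after \<open>h\<close> rounds: the label is best, by length and then by
  number of nodes, among the walks to \<open>x\<close> with at most \<open>Suc h\<close>
  nodes.\<close>

definition label_ok :: "('a \<Rightarrow> 'a \<Rightarrow> bool) \<Rightarrow> 'a set \<Rightarrow> ('a \<Rightarrow> real) \<Rightarrow> nat \<Rightarrow> 'a \<Rightarrow> 'a label \<Rightarrow> bool" where
  "label_ok E X l h x lab \<longleftrightarrow>
     (\<forall>d P. lab = Some (d, P) \<longrightarrow> walk E X P \<and> hd P = x \<and> d = walk_length l P \<and> length P \<le> Suc h) \<and>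
     (\<forall>W. walk E X W \<and> hd W = x \<and> length W \<le> Suc h \<longrightarrow>
        (\<exists>d P. lab = Some (d, P) \<and>
           (d < walk_length l W \<or> d = walk_length l W \<and> length P \<le> length W)))"

lemma label_ok_complete:
  "label_ok E X l h x lab \<Longrightarrow> walk E X W \<Longrightarrow> hd W = x \<Longrightarrow> length W \<le> Suc h \<Longrightarrow>
    \<exists>d P. lab = Some (d, P) \<and> (d < walk_length l W \<or> d = walk_length l W \<and> length P \<le> length W)"
  unfolding label_ok_def by blast

text \<open>Only a strictly shorter walk replaces a label. Ties are thus broken in favour of earlier
  rounds, that is, of fewer nodes.\<close>

definition relax :: "('a \<Rightarrow> 'a \<Rightarrow> bool) \<Rightarrow> ('a \<Rightarrow> real) \<Rightarrow> 'a \<Rightarrow> 'a \<times> 'a label \<Rightarrow> 'a label \<Rightarrow> 'a label" where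
  "relax E l x ul cur = (case snd ul of None \<Rightarrow> cur | Some (d, P) \<Rightarrow>
     if E (fst ul) x \<and> (case cur of None \<Rightarrow> True | Some (d', P') \<Rightarrow> \<not> d' \<le> d + l x)
     then Some (d + l x, x # P) else cur)"

text \<open>Here and below \<open>rev\<close> mirrors the programs, whose folds build lists by
  consing.\<close>

definition initial_labels :: "'a set \<Rightarrow> ('a \<Rightarrow> real) \<Rightarrow> 'a list \<Rightarrow> ('a \<times> 'a label) list" where
  "initial_labels X l es = rev (map (\<lambda>x. (x, if x \<in> X then Some (l x, [x]) else None)) es)"

text \<open>All new labels are computed from the labels of the previous round. Updates in place
  would let walks grow by several nodes in one round and spoil the tie-breaking.\<close>

definition relax_all ::
    "('a \<Rightarrow> 'a \<Rightarrow> bool) \<Rightarrow> ('a \<Rightarrow> real) \<Rightarrow> ('a \<times> 'a label) list \<Rightarrow> ('a \<times> 'a label) list" where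
  "relax_all E l labs = rev (map (\<lambda>xl. (fst xl, fold (relax E l (fst xl)) labs (snd xl))) labs)"

text \<open>The order is expressed by comparisons and negations only, as the program has to express
  it. Ties between different sinks are broken by counting nodes explicitly.\<close>

definition pick :: "'a set \<Rightarrow> 'a \<times> 'a label \<Rightarrow> 'a label \<Rightarrow> 'a label" where
  "pick T xl cur = (case snd xl of None \<Rightarrow> cur | Some (d, P) \<Rightarrow>
     if fst xl \<in> T \<and> (case cur of None \<Rightarrow> True | Some (d', P') \<Rightarrow>
       \<not> d' \<le> d \<or> d \<le> d' \<and> \<not> length P' \<le> length P)
     then Some (d, P) else cur)"

text \<open>The second part preserves the tie-breaking: a label that changes gets strictly shorter,
  so one that is as short as before is still the old one.\<close>

lemma fold_relax:
  assumes "\<And>u d P. (u, Some (d, P)) \<in> set labs \<Longrightarrow>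
      walk E X P \<and> hd P = u \<and> d = walk_length l P \<and> length P \<le> h"
    and "\<And>d P. lab = Some (d, P) \<Longrightarrow>
      walk E X P \<and> hd P = x \<and> d = walk_length l P \<and> length P \<le> Suc h"
  shows "fold (relax E l x) labs lab = Some (d, P) \<Longrightarrow>
      walk E X P \<and> hd P = x \<and> d = walk_length l P \<and> length P \<le> Suc h"
    and "lab = Some (d0, P0) \<Longrightarrow> fold (relax E l x) labs lab = lab \<or>
      (\<exists>d P. fold (relax E l x) labs lab = Some (d, P) \<and> d < d0)"
    and "(u, Some (d1, P1)) \<in> set labs \<Longrightarrow> E u x \<Longrightarrow>
      \<exists>d P. fold (relax E l x) labs lab = Some (d, P) \<and> d \<le> d1 + l x"
proof -
  have "(\<forall>d P. fold (relax E l x) labs lab = Some (d, P) \<longrightarrow>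
      walk E X P \<and> hd P = x \<and> d = walk_length l P \<and> length P \<le> Suc h) \<and>
    (\<forall>d0 P0. lab = Some (d0, P0) \<longrightarrow> fold (relax E l x) labs lab = lab \<or>
      (\<exists>d P. fold (relax E l x) labs lab = Some (d, P) \<and> d < d0)) \<and>
    (\<forall>u d1 P1. (u, Some (d1, P1)) \<in> set labs \<longrightarrow> E u x \<longrightarrow>
      (\<exists>d P. fold (relax E l x) labs lab = Some (d, P) \<and> d \<le> d1 + l x))"
    using assms
  proof (induction labs arbitrary: lab)
    case Nil
    then show ?case by auto
  next
    case (Cons ul labs)
    obtain u lu where ul: "ul = (u, lu)" by force
    let ?m = "relax E l x ul lab"
    have m: "walk E X P \<and> hd P = x \<and> d = walk_length l P \<and> length P \<le> Suc h" if "?m = Some (d, P)" for d P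
    proof (cases "?m = lab")
      case True
      then show ?thesis using Cons.prems(2)[of d P] that by simp
    next
      case False
      then obtain d' P' where "lu = Some (d', P')" "E u x" "?m = Some (d' + l x, x # P')"
        unfolding relax_def ul by (auto split: option.splits if_splits)
      then show ?thesis using that Cons.prems(1)[of u d' P'] walk_Cons[of E X P' x] ul by auto
    qed
    have mono: "?m = lab \<or> (\<exists>d P. ?m = Some (d, P) \<and> d < d0)" if "lab = Some (d0, P0)" for d0 P0
      using that unfolding relax_def by (auto split: option.splits)
    have new: "\<exists>d P. ?m = Some (d, P) \<and> d \<le> d1 + l x" if "lu = Some (d1, P1)" "E u x" for d1 P1
      using that unfolding relax_def ul by (cases lab) auto
    have IH: "(\<forall>d P. fold (relax E l x) labs ?m = Some (d, P) \<longrightarrow>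
        walk E X P \<and> hd P = x \<and> d = walk_length l P \<and> length P \<le> Suc h) \<and>
      (\<forall>d0 P0. ?m = Some (d0, P0) \<longrightarrow> fold (relax E l x) labs ?m = ?m \<or>
        (\<exists>d P. fold (relax E l x) labs ?m = Some (d, P) \<and> d < d0)) \<and>
      (\<forall>u d1 P1. (u, Some (d1, P1)) \<in> set labs \<longrightarrow> E u x \<longrightarrow>
        (\<exists>d P. fold (relax E l x) labs ?m = Some (d, P) \<and> d \<le> d1 + l x))"
      by (rule Cons.IH[OF Cons.prems(1) m]) simp_all
    show ?case
    proof (intro conjI allI impI)
      fix d P assume "fold (relax E l x) (ul # labs) lab = Some (d, P)"
      then have "fold (relax E l x) labs ?m = Some (d, P)" by simp
      then show "walk E X P" "hd P = x" "d = walk_length l P" "length P \<le> Suc h" using IH by blast+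
    next
      fix d0 P0 assume 2: "lab = Some (d0, P0)"
      have f: "fold (relax E l x) (ul # labs) lab = fold (relax E l x) labs ?m" by simp
      show "fold (relax E l x) (ul # labs) lab = lab \<or>
          (\<exists>d P. fold (relax E l x) (ul # labs) lab = Some (d, P) \<and> d < d0)"
      proof (cases "?m = lab")
        case True
        then show ?thesis using IH 2 unfolding f by simp
      next
        case False
        then obtain d P where m': "?m = Some (d, P)" "d < d0" using mono[OF 2] by blast
        then have "fold (relax E l x) labs ?m = Some (d, P) \<or>
            (\<exists>d' P. fold (relax E l x) labs ?m = Some (d', P) \<and> d' < d)" using IH by metis
        then show ?thesis using m'(2) unfolding f by (metis order.strict_trans)
      qed
    next
      fix u' d1 P1 assume 3: "(u', Some (d1, P1)) \<in> set (ul # labs)" "E u' x"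
      show "\<exists>d P. fold (relax E l x) (ul # labs) lab = Some (d, P) \<and> d \<le> d1 + l x"
      proof (cases "(u', Some (d1, P1)) = ul")
        case True
        then obtain d P where m': "?m = Some (d, P)" "d \<le> d1 + l x" using new[of d1 P1] 3 ul by blast
        then have "fold (relax E l x) labs ?m = ?m \<or>
            (\<exists>d' P. fold (relax E l x) labs ?m = Some (d', P) \<and> d' < d)"
          using IH by blast
        then show ?thesis using m' by (metis fold_simps(2) order.strict_implies_order order.trans)
      next
        case False
        then have "(u', Some (d1, P1)) \<in> set labs" using 3(1) by simp
        then show ?thesis using IH 3(2) unfolding fold_simps by blast
      qed
    qed
  qed
  then show "fold (relax E l x) labs lab = Some (d, P) \<Longrightarrow>
      walk E X P \<and> hd P = x \<and> d = walk_length l P \<and> length P \<le> Suc h"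
    and "lab = Some (d0, P0) \<Longrightarrow> fold (relax E l x) labs lab = lab \<or>
      (\<exists>d P. fold (relax E l x) labs lab = Some (d, P) \<and> d < d0)"
    and "(u, Some (d1, P1)) \<in> set labs \<Longrightarrow> E u x \<Longrightarrow>
      \<exists>d P. fold (relax E l x) labs lab = Some (d, P) \<and> d \<le> d1 + l x"
    by blast+
qed

definition labels_ok where
  "labels_ok E X l S h labs \<longleftrightarrow> fst ` set labs = S \<and> (\<forall>xl\<in>set labs. label_ok E X l h (fst xl) (snd xl))"

lemma initial_labels_ok: "labels_ok E X l (set es) 0 (initial_labels X l es)"
proof -
  have "label_ok E X l 0 x (if x \<in> X then Some (l x, [x]) else None)" for x
  proof -
    have single: "W = [x] \<and> x \<in> X" if "walk E X W \<and> hd W = x \<and> length W \<le> Suc 0" for W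
      using that by (cases W) auto
    have "\<exists>d P. (if x \<in> X then Some (l x, [x]) else None) = Some (d, P) \<and>
        (d < walk_length l W \<or> d = walk_length l W \<and> length P \<le> length W)"
      if "walk E X W \<and> hd W = x \<and> length W \<le> Suc 0" for W
      using single[OF that] by simp
    then show ?thesis unfolding label_ok_def by (auto split: if_splits)
  qed
  then show ?thesis unfolding labels_ok_def initial_labels_def by (auto simp: image_iff)
qed

text \<open>A walk with at most \<open>Suc h\<close> nodes is still beaten by the old label or by
  its strict improvement. One with \<open>Suc (Suc h)\<close> nodes is beaten through the label of
  the node before its end, and ties are harmless because no label of this round has more
  nodes.\<close>

lemma relax_all_ok:
  assumes ok: "labels_ok E X l S h labs" and S: "\<And>x y. E x y \<Longrightarrow> x \<in> S"
  shows "labels_ok E X l S (Suc h) (relax_all E l labs)"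
proof -
  have lab: "walk E X P \<and> hd P = u \<and> d = walk_length l P \<and> length P \<le> Suc h"
    if "(u, Some (d, P)) \<in> set labs" for u d P
    using ok that unfolding labels_ok_def label_ok_def by fastforce
  have "label_ok E X l (Suc h) x (fold (relax E l x) labs lab)" if xl: "(x, lab) \<in> set labs" for x lab
  proof -
    let ?r = "fold (relax E l x) labs lab"
    have lab_ok: "label_ok E X l h x lab" using ok xl unfolding labels_ok_def by fastforce
    have lab': "walk E X P \<and> hd P = x \<and> d = walk_length l P \<and> length P \<le> Suc (Suc h)"
      if "lab = Some (d, P)" for d P using lab[of x d P] xl that by simp
    note r = fold_relax[where labs = labs and E = E and X = X and l = l and h = "Suc h" and lab = lab and x = x]
    show ?thesis
      unfolding label_ok_def
    proof (intro conjI[OF _ allI] allI impI)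
      fix d P assume "?r = Some (d, P)"
      then show "walk E X P \<and> hd P = x \<and> d = walk_length l P \<and> length P \<le> Suc (Suc h)" 
        using r(1)[of d P] lab lab' by blast
    next
      fix W assume W: "walk E X W \<and> hd W = x \<and> length W \<le> Suc (Suc h)"
      show "\<exists>d P. ?r = Some (d, P) \<and> (d < walk_length l W \<or> d = walk_length l W \<and> length P \<le> length W)"
      proof (cases "length W \<le> Suc h")
        case True
        then obtain d0 P0 where 0: "lab = Some (d0, P0)"
          "d0 < walk_length l W \<or> d0 = walk_length l W \<and> length P0 \<le> length W"
          using label_ok_complete[OF lab_ok] W by blast
        have "?r = lab \<or> (\<exists>d P. ?r = Some (d, P) \<and> d < d0)" using r(2)[of d0 P0] lab lab' 0(1) by blast
        then show ?thesis using 0 by fastforce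
      next
        case False
        then have len: "length W = Suc (Suc h)" using W by simp
        then obtain u R where WR: "W = x # u # R" using W by (cases W; cases "tl W") auto
        have Eu: "E u x" and wu: "walk E X (u # R)" using W WR by auto
        obtain lu where lu: "(u, lu) \<in> set labs" using S[OF Eu] ok unfolding labels_ok_def by force
        then have "label_ok E X l h u lu" using ok unfolding labels_ok_def by fastforce
        from label_ok_complete[OF this wu]
        obtain d1 P1 where d1: "lu = Some (d1, P1)" "d1 \<le> walk_length l (u # R)"
          using len WR by (metis Suc_le_mono eq_iff length_Cons less_imp_le list.sel(1))
        obtain d P where dP: "?r = Some (d, P)" "d \<le> d1 + l x"
          using r(3)[of u d1 P1] lab lab' lu d1(1) Eu by blast
        moreover have "length P \<le> length W" using r(1)[of d P] lab lab' dP(1) len by metis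
        ultimately show ?thesis using d1(2) WR by auto
      qed
    qed
  qed
  moreover have "fst ` set (relax_all E l labs) = S"
    using ok unfolding labels_ok_def relax_all_def by (simp add: image_image)
  ultimately show ?thesis unfolding labels_ok_def by (auto simp: relax_all_def)
qed

lemma fold_pick:
  fixes labs :: "('a \<times> 'a label) list"
  shows "case fold (pick T) labs cur of
      None \<Rightarrow> cur = None \<and> (\<forall>x d P. (x, Some (d, P)) \<in> set labs \<longrightarrow> x \<notin> T)
    | Some (d, P) \<Rightarrow> (cur = Some (d, P) \<or> (\<exists>x\<in>T. (x, Some (d, P)) \<in> set labs)) \<and>
        (\<forall>d' P'. cur = Some (d', P') \<longrightarrow> d < d' \<or> d = d' \<and> length P \<le> length P') \<and>
        (\<forall>x d' P'. (x, Some (d', P')) \<in> set labs \<longrightarrow> x \<in> T \<longrightarrow>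
           d < d' \<or> d = d' \<and> length P \<le> length P')"
proof (induction labs arbitrary: cur)
  case Nil
  then show ?case by (auto split: option.splits)
next
  case (Cons xl labs)
  obtain x lab where xl: "xl = (x, lab)" by force
  let ?m = "pick T xl cur"
  have m1: "?m = cur \<or> x \<in> T \<and> ?m = lab \<and> lab \<noteq> None"
    unfolding pick_def xl by (auto split: option.splits)
  have m2: "\<exists>d P. ?m = Some (d, P) \<and> (d < d' \<or> d = d' \<and> length P \<le> length P')"
    if "cur = Some (d', P')" for d' P'
    using that unfolding pick_def xl by (auto split: option.splits)
  have m3: "\<exists>d P. ?m = Some (d, P) \<and> (d < d' \<or> d = d' \<and> length P \<le> length P')"
    if "x \<in> T" "lab = Some (d', P')" for d' P'
    using that unfolding pick_def xl by (cases cur) auto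
  show ?case
  proof (cases "fold (pick T) labs ?m")
    case None
    then have "?m = None" "\<forall>x d P. (x, Some (d, P)) \<in> set labs \<longrightarrow> x \<notin> T" using Cons.IH[of ?m] by auto
    moreover have "cur = None" using m2 \<open>?m = None\<close> by (cases cur) auto
    ultimately show ?thesis using None m3 xl by auto
  next
    case (Some dP)
    obtain d P where dP: "dP = (d, P)" by force
    have IH: "?m = Some (d, P) \<or> (\<exists>x\<in>T. (x, Some (d, P)) \<in> set labs)"
      "\<And>d' P'. ?m = Some (d', P') \<Longrightarrow> d < d' \<or> d = d' \<and> length P \<le> length P'"
      "\<And>x d' P'. (x, Some (d', P')) \<in> set labs \<Longrightarrow> x \<in> T \<Longrightarrow>
           d < d' \<or> d = d' \<and> length P \<le> length P'"
      using Cons.IH[of ?m] Some dP by auto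
    have c1: "cur = Some (d, P) \<or> (\<exists>x\<in>T. (x, Some (d, P)) \<in> set (xl # labs))"
      using IH(1) m1 xl by auto
    have c2: "d < d' \<or> d = d' \<and> length P \<le> length P'" if "cur = Some (d', P')" for d' P'
      using m2[OF that] IH(2) by force
    have c3: "d < d' \<or> d = d' \<and> length P \<le> length P'"
      if "(y, Some (d', P')) = xl \<or> (y, Some (d', P')) \<in> set labs" "y \<in> T" for y d' P'
      using that m3[of d' P'] IH(2) IH(3)[of y d' P'] xl by force
    have "fold (pick T) (xl # labs) cur = Some (d, P)" using Some dP by simp
    then show ?thesis using c1 c2 c3 by (simp only: option.case prod.case set_simps insert_iff) blast
  qed
qed

text \<open>Every walk is dominated by one without repeated nodes, which has at most
  \<open>card S\<close> nodes and is therefore accounted for after \<open>h\<close> rounds.\<close>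

lemma pick_best_walk:
  assumes ok: "labels_ok E X l S h labs" and h: "card S \<le> Suc h"
    and pot: "potential E l \<pi>"
    and S: "\<And>x y. E x y \<Longrightarrow> y \<in> S" "X \<subseteq> S" "finite S"
  shows "case fold (pick T) labs None of None \<Rightarrow> \<forall>W. walk E X W \<longrightarrow> hd W \<notin> T
    | Some (d, P) \<Rightarrow> best_walk E X T l P \<and> length P \<le> Suc h"
proof -
  have lab: "\<exists>d P. (hd W, Some (d, P)) \<in> set labs \<and>
      (d < walk_length l W \<or> d = walk_length l W \<and> length P \<le> length W)" if w: "walk E X W" for W
  proof -
    obtain W' where W': "walk E X W'" "distinct W'" "hd W' = hd W"
      "walk_length l W' \<le> walk_length l W" "length W' \<le> length W"
      using walk_to_distinct[OF pot w] by blast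
    have "set W' \<subseteq> S" by (rule walk_nodes[OF _ S(2) W'(1)]) (rule S(1))
    then have "length W' \<le> Suc h"
      using distinct_card[OF W'(2)] card_mono[OF S(3)] h by (metis le_trans)
    moreover have "hd W' \<in> S" using \<open>set W' \<subseteq> S\<close> W'(1) by (cases W') auto
    then obtain lab where "(hd W', lab) \<in> set labs" using ok unfolding labels_ok_def by force
    moreover from this have "label_ok E X l h (hd W') lab" using ok unfolding labels_ok_def by fastforce
    ultimately obtain d P where "(hd W', Some (d, P)) \<in> set labs"
      "d < walk_length l W' \<or> d = walk_length l W' \<and> length P \<le> length W'"
      using label_ok_complete[OF _ W'(1)] by metis
    then show ?thesis using W'(3-5) by (intro exI[of _ d] exI[of _ P]) auto
  qed
  show ?thesis
  proof (cases "fold (pick T) labs None")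
    case None
    then show ?thesis using fold_pick[where T = T and labs = labs and cur = None] lab by fastforce
  next
    case (Some dP)
    obtain d P where dP: "dP = (d, P)" by force
    note pk = fold_pick[where T = T and labs = labs and cur = None, unfolded Some dP, simplified]
    obtain x where x: "x \<in> T" "(x, Some (d, P)) \<in> set labs" using pk by blast
    then have "label_ok E X l h x (Some (d, P))" using ok unfolding labels_ok_def by fastforce
    then have P: "walk E X P" "hd P = x" "d = walk_length l P" "length P \<le> Suc h"
      unfolding label_ok_def by auto
    have "walk_length l P < walk_length l W \<or> walk_length l P = walk_length l W \<and> length P \<le> length W"
      if W: "walk E X W" "hd W \<in> T" for W
      using lab[OF W(1)] pk W(2) P(3) by fastforce
    then show ?thesis using Some dP P x unfolding best_walk_def by auto
  qed
qed

section \<open>Weighted matroid intersection\<close>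

text \<open>Elements outside \<open>I\<close> are entered by exchanges in \<open>A\<close> and left
  by exchanges in \<open>B\<close>. On a walk from \<open>addable A I\<close> to
  \<open>addable B I\<close>, each removed element is therefore paired with its successor in
  \<open>A\<close> and with its predecessor in \<open>B\<close>.\<close>

definition exchange_arc :: "'a set set \<Rightarrow> 'a set set \<Rightarrow> 'a set \<Rightarrow> 'a \<Rightarrow> 'a \<Rightarrow> bool" where
  "exchange_arc A B I u v \<longleftrightarrow>
     (if u \<in> I then v \<notin> I \<and> insert v (I - {u}) \<in> A else v \<in> I \<and> insert u (I - {v}) \<in> B)"

definition addable :: "'a set set \<Rightarrow> 'a set \<Rightarrow> 'a set" where
  "addable A I = {v. v \<notin> I \<and> insert v I \<in> A}"

text \<open>Chosen so that the length of a walk without repetitions is the change in cost when it is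
  applied to \<open>I\<close>.\<close>

definition signed :: "('a \<Rightarrow> real) \<Rightarrow> 'a set \<Rightarrow> 'a \<Rightarrow> real" where
  "signed c I x = (if x \<in> I then - c x else c x)"

abbreviation sym_diff :: "'a set \<Rightarrow> 'a set \<Rightarrow> 'a set" where
  "sym_diff I P \<equiv> (I - P) \<union> (P - I)"

text \<open>Frank's weight splitting: a certificate that \<open>I\<close> is cheapest among the
  common independent sets of its size.\<close>

definition extreme :: "'a set set \<Rightarrow> 'a set set \<Rightarrow> ('a \<Rightarrow> real) \<Rightarrow> 'a set \<Rightarrow> bool" where
  "extreme A B c I \<longleftrightarrow> (\<exists>p. min_weight A p I \<and> min_weight B (\<lambda>x. c x - p x) I)"

lemma extreme_optimal:
  assumes "extreme A B c I" and "J \<in> A" "J \<in> B" "card J = card I"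
  shows "sum c I \<le> sum c J"
proof -
  obtain p where "min_weight A p I" "min_weight B (\<lambda>x. c x - p x) I"
    using assms(1) unfolding extreme_def by blast
  then have "sum p I \<le> sum p J" "(\<Sum>x\<in>I. c x - p x) \<le> (\<Sum>x\<in>J. c x - p x)"
    using assms by (auto simp: min_weight_def)
  then show ?thesis by (simp add: sum_subtractf)
qed

lemma list_split_two:
  assumes "a < b" "b < length P"
  shows "\<exists>Q Q' R. P = Q @ P ! a # Q' @ P ! b # R \<and> length Q' = b - a - 1"
proof -
  have 1: "P = take b P @ P ! b # drop (Suc b) P" using assms id_take_nth_drop by blast
  have "take b P = take a (take b P) @ take b P ! a # drop (Suc a) (take b P)"
    using assms by (intro id_take_nth_drop) simp
  then have "P = take a (take b P) @ P ! a # drop (Suc a) (take b P) @ P ! b # drop (Suc b) P"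
    using 1 assms by (metis append.assoc append_Cons nth_take)
  then show ?thesis using assms
    by (intro exI[of _ "take a (take b P)"] exI[of _ "drop (Suc a) (take b P)"] exI[of _ "drop (Suc b) P"])
      simp
qed

lemma walk_step: "walk E X P \<Longrightarrow> Suc j < length P \<Longrightarrow> E (P ! Suc j) (P ! j)"
proof (induction P arbitrary: j)
  case (Cons a P)
  then show ?case by (cases P; cases j) auto
qed simp

lemma walk_source: "walk E X P \<Longrightarrow> last P \<in> X"
proof (induction P)
  case (Cons a P)
  then show ?case by (cases P) auto
qed simp

text \<open>Optimality of \<open>I\<close> under exchanges in \<open>A\<close> is the potential
  inequality on the arcs leaving \<open>I\<close>, and that in \<open>B\<close> is the one on the
  arcs entering \<open>I\<close>. In particular the exchange graph has no negative cycle.\<close>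

lemma exchange_potential:
  assumes MA: "matroid S A" and MB: "matroid S B"
    and "min_weight A p I" "min_weight B (\<lambda>x. c x - p x) I"
  shows "potential (exchange_arc A B I) (signed c I) (\<lambda>x. if x \<in> I then - p x else c x - p x)"
  unfolding potential_def
proof (intro allI impI)
  fix u v assume arc: "exchange_arc A B I u v"
  show "(if v \<in> I then - p v else c v - p v) \<le> (if u \<in> I then - p u else c u - p u) + signed c I v"
  proof (cases "u \<in> I")
    case True
    then have "p u \<le> p v"
      using arc min_weight_swap[OF MA assms(3), of u v] unfolding exchange_arc_def by auto
    then show ?thesis using True arc unfolding exchange_arc_def signed_def by auto
  next
    case False
    then have "c v - p v \<le> c u - p u"
      using arc min_weight_swap[OF MB assms(4), of v u] unfolding exchange_arc_def by auto
    then show ?thesis using False arc unfolding exchange_arc_def signed_def by auto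
  qed
qed

lemma exchange_arc_carrier:
  assumes "matroid S A" "matroid S B" "I \<in> A" "exchange_arc A B I u v"
  shows "u \<in> S" "v \<in> S"
proof -
  have "I \<subseteq> S" using assms matroid_carrier by blast
  moreover have "u \<in> I \<longrightarrow> v \<in> S" "u \<notin> I \<longrightarrow> u \<in> S \<and> v \<in> I"
    using assms(4) matroid_carrier[OF assms(1)] matroid_carrier[OF assms(2)]
    unfolding exchange_arc_def by (metis insert_subset)+
  ultimately show "u \<in> S" "v \<in> S" by auto
qed

lemma addable_carrier: "matroid S A \<Longrightarrow> addable A I \<subseteq> S"
  unfolding addable_def using matroid_carrier by fastforce

text \<open>The new splitting is read off the distances; elements that cannot be reached keep their old
  potential, shifted far up.\<close>

lemma splitting_from_distances:
  assumes MA: "matroid S A" and MB: "matroid S B" and ext: "extreme A B c I"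
    and best: "best_walk (exchange_arc A B I) (addable A I) (addable B I) (signed c I) P"
    and dist: "shortest_distances (exchange_arc A B I) (addable A I) (signed c I) d"
  shows "\<exists>p. min_weight A p I \<and> min_weight B (\<lambda>x. c x - p x) I \<and>
    (\<forall>z\<in>addable A I. 0 \<le> p z) \<and>
    (\<forall>z\<in>addable B I. walk_length (signed c I) P \<le> c z - p z) \<and>
    (\<forall>z\<in>set P. p z = (if z \<in> I then - d z else c z - d z))"
proof -
  let ?E = "exchange_arc A B I" and ?X = "addable A I" and ?T = "addable B I" and ?l = "signed c I"
  have d_le: "d (hd W) \<le> walk_length ?l W"
    and d_attained: "\<exists>W'. walk ?E ?X W' \<and> hd W' = hd W \<and> walk_length ?l W' = d (hd W)"
    if "walk ?E ?X W" for W using dist that unfolding shortest_distances_def by blast+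
  obtain p0 where p0: "min_weight A p0 I" "min_weight B (\<lambda>x. c x - p0 x) I"
    using ext unfolding extreme_def by blast
  have IA: "I \<in> A" and IB: "I \<in> B" using p0 by (auto simp: min_weight_def)
  have fS: "finite S" using MA unfolding matroid_def by blast
  have IS: "I \<subseteq> S" using matroid_carrier[OF MA IA] .
  define \<pi> where "\<pi> x = (if x \<in> I then - p0 x else c x - p0 x)" for x
  have pot: "\<pi> v \<le> \<pi> u + ?l v" if "?E u v" for u v
    using exchange_potential[OF MA MB p0] that unfolding potential_def \<pi>_def by blast
  define reach where "reach x \<longleftrightarrow> (\<exists>W. walk ?E ?X W \<and> hd W = x)" for x
  define L where "L = walk_length ?l P"
  \<comment> \<open>The shift makes the old potential dominate \<open>d\<close> and \<open>L\<close>
    on all of \<open>S\<close>. Dominating \<open>d\<close> settles the arcs from unreachable to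
    reachable elements (none lead the other way), dominating \<open>L\<close> settles the
    unreachable sinks.\<close>
  define M where "M = Max (insert 0 ((\<lambda>x. max (d x - \<pi> x) (L - \<pi> x)) ` S))"
  have M: "d x \<le> \<pi> x + M" "L \<le> \<pi> x + M" if "x \<in> S" for x
  proof -
    have "max (d x - \<pi> x) (L - \<pi> x) \<le> M"
      unfolding M_def using fS that by (intro Max_ge) auto
    then show "d x \<le> \<pi> x + M" "L \<le> \<pi> x + M" by auto
  qed
  define e where "e x = (if reach x then d x else \<pi> x + M)" for x
  have e: "e v \<le> e u + ?l v" if arc: "?E u v" for u v
  proof (cases "reach u")
    case True
    then obtain W where W: "walk ?E ?X W" "hd W = u" "walk_length ?l W = d u"
      unfolding reach_def using d_attained by metis
    then have vW: "walk ?E ?X (v # W)" using walk_Cons arc by metis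
    then have "reach v" unfolding reach_def by (metis list.sel(1))
    moreover have "d v \<le> ?l v + d u" using d_le[OF vW] W(3) by simp
    ultimately show ?thesis using True unfolding e_def by simp
  next
    case False
    have "e v \<le> \<pi> v + M"
      unfolding e_def using M(1)[of v] exchange_arc_carrier(2)[OF MA MB IA arc] by auto
    then show ?thesis using pot[OF arc] False unfolding e_def by simp
  qed
  define p where "p x = (if x \<in> I then - e x else c x - e x)" for x
  have "min_weight A p I"
  proof (rule min_weightI[OF MA IA])
    fix u v assume uv: "u \<in> I" "v \<in> S - I" "insert v (I - {u}) \<in> A"
    then have "e v \<le> e u + ?l v" by (intro e) (simp add: exchange_arc_def)
    then show "p u \<le> p v" using uv unfolding p_def signed_def by simp
  qed
  moreover have "min_weight B (\<lambda>x. c x - p x) I"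
  proof (rule min_weightI[OF MB IB])
    fix u v assume uv: "u \<in> I" "v \<in> S - I" "insert v (I - {u}) \<in> B"
    then have "e u \<le> e v + ?l u" by (intro e) (simp add: exchange_arc_def)
    then show "c u - p u \<le> c v - p v" using uv unfolding p_def signed_def by simp
  qed
  moreover have "0 \<le> p z" if z: "z \<in> ?X" for z
  proof -
    have w: "walk ?E ?X [z]" using z by simp
    then have "reach z" unfolding reach_def by (metis list.sel(1))
    moreover have "d z \<le> ?l z" using d_le[OF w] by simp
    moreover have "z \<notin> I" using z unfolding addable_def by simp
    ultimately show ?thesis unfolding p_def e_def signed_def by simp
  qed
  moreover have "L \<le> c z - p z" if z: "z \<in> ?T" for z
  proof -
    have "L \<le> e z"
    proof (cases "reach z")
      case True
      then obtain W where W: "walk ?E ?X W" "hd W = z" "walk_length ?l W = d z"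
        unfolding reach_def using d_attained by metis
      have "L \<le> walk_length ?l W" using best W(1,2) z unfolding best_walk_def L_def by force
      then show ?thesis using True W(3) unfolding e_def by simp
    next
      case False
      then show ?thesis using M(2)[of z] addable_carrier[OF MB] z unfolding e_def by auto
    qed
    moreover have "z \<notin> I" using z unfolding addable_def by simp
    ultimately show ?thesis unfolding p_def by simp
  qed
  moreover have "p z = (if z \<in> I then - d z else c z - d z)" if z: "z \<in> set P" for z
  proof -
    obtain Q R where "P = Q @ z # R" using z by (meson split_list)
    then have "walk ?E ?X (z # R)" using best walk_suffix unfolding best_walk_def by metis
    then have "reach z" unfolding reach_def by (metis list.sel(1))
    then show ?thesis unfolding p_def e_def by simp
  qed
  ultimately show ?thesis unfolding L_def by blast
qed

text \<open>\<open>augment_min_weight\<close> is applied twice to the splitting read off the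
  distances: for \<open>A\<close> along the walk from its source, for \<open>B\<close> backwards
  from its sink. Consecutive nodes are tight since the walk realizes the distances; having fewest
  arcs excludes shortcuts, inner sources and inner sinks.\<close>

theorem augment_extreme:
  assumes MA: "matroid S A" and MB: "matroid S B" and ext: "extreme A B c I"
    and best: "best_walk (exchange_arc A B I) (addable A I) (addable B I) (signed c I) P"
  shows "extreme A B c (sym_diff I (set P))" "card (sym_diff I (set P)) = Suc (card I)"
proof -
  let ?E = "exchange_arc A B I" and ?X = "addable A I" and ?T = "addable B I" and ?l = "signed c I"
  obtain p0 where p0: "min_weight A p0 I" "min_weight B (\<lambda>x. c x - p0 x) I"
    using ext unfolding extreme_def by blast
  have IA: "I \<in> A" using p0 by (auto simp: min_weight_def)
  have fS: "finite S" using MA unfolding matroid_def by blast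
  note pot = exchange_potential[OF MA MB p0]
  have inS: "?E u v \<Longrightarrow> v \<in> S" for u v using exchange_arc_carrier(2)[OF MA MB IA] .
  have "\<exists>d. shortest_distances ?E ?X ?l d"
    by (rule distances_exist[OF pot _ addable_carrier[OF MA] fS]) (rule inS)
  then obtain d where d: "shortest_distances ?E ?X ?l d" ..
  obtain p where p: "min_weight A p I" "min_weight B (\<lambda>x. c x - p x) I"
    "\<And>z. z \<in> ?X \<Longrightarrow> 0 \<le> p z" "\<And>z. z \<in> ?T \<Longrightarrow> walk_length ?l P \<le> c z - p z"
    "\<And>z. z \<in> set P \<Longrightarrow> p z = (if z \<in> I then - d z else c z - d z)"
    using splitting_from_distances[OF MA MB ext best d] by blast
  have wP: "walk ?E ?X P" "hd P \<in> ?T" using best unfolding best_walk_def by auto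
  then have ne: "P \<noteq> []" by auto
  have dis: "distinct P" using best_walk_distinct[OF best d pot] .
  have step: "?E (P ! Suc j) (P ! j)" if "Suc j < length P" for j using walk_step[OF wP(1) that] .
  have src: "P ! (length P - 1) \<in> ?X" using walk_source[OF wP(1)] ne by (simp add: last_conv_nth)
  have snk: "P ! 0 \<in> ?T" using wP(2) ne by (simp add: hd_conv_nth)
  \<comment> \<open>The walk is listed from sink to source and alternates between the outside and
    the inside of \<open>I\<close>, starting outside.\<close>
  have parity: "P ! j \<in> I \<longleftrightarrow> odd j" if "j < length P" for j
    using that
  proof (induction j)
    case 0
    then show ?case using snk unfolding addable_def by simp
  next
    case (Suc j)
    then show ?case using step[of j] unfolding exchange_arc_def by (auto split: if_splits)
  qed
  have "even (length P - 1)" using parity[of "length P - 1"] src ne unfolding addable_def by auto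
  then obtain k where "length P - 1 = 2 * k" by (rule evenE)
  then have k: "length P = 2 * k + 1" using ne by (cases P) auto
  have dP: "d (P ! j) = walk_length ?l (drop j P)" if "j < length P" for j
    using best_walk_dist[OF best d id_take_nth_drop[OF that]] that by (simp add: Cons_nth_drop_Suc)
  have tight: "d (P ! j) = d (P ! Suc j) + ?l (P ! j)" if "Suc j < length P" for j
    using dP[of j] dP[of "Suc j"] that by (simp add: Cons_nth_drop_Suc[symmetric])
  have no_shortcut: False
    if ab: "a + 1 < b" "b < length P" "?E (P ! b) (P ! a)" "d (P ! a) = d (P ! b) + ?l (P ! a)" for a b
  proof -
    obtain Q Q' R where Q: "P = Q @ P ! a # Q' @ P ! b # R" "length Q' = b - a - 1"
      using list_split_two[of a b P] ab by auto
    then have "Q' \<noteq> []" using ab by auto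
    then show False using best_walk_no_shortcut[OF best d Q(1) _ ab(3,4)] by blast
  qed
  have no_source: False if "j + 1 < length P" "P ! j \<in> ?X" "d (P ! j) = ?l (P ! j)" for j
  proof -
    have "P = take j P @ P ! j # drop (Suc j) P" using that by (intro id_take_nth_drop) simp
    moreover have "drop (Suc j) P \<noteq> []" using that by simp
    ultimately show False using best_walk_no_inner_source[OF best d _ _ that(2,3)] by blast
  qed
  have no_sink: False if "j < length P" "0 < j" "P ! j \<in> ?T" "d (P ! j) = walk_length ?l P" for j
  proof -
    have "P = take j P @ P ! j # drop (Suc j) P" using that by (intro id_take_nth_drop) simp
    moreover have "take j P \<noteq> []" using that by auto
    ultimately show False using best_walk_no_inner_sink[OF best d _ _ that(3,4)] by blast
  qed
  have pin: "p (P ! j) = - d (P ! j)" if "j < length P" "odd j" for j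
    using p(5)[of "P ! j"] parity[of j] that by simp
  have pout: "p (P ! j) = c (P ! j) - d (P ! j)" "?l (P ! j) = c (P ! j)" if "j < length P" "even j" for j
    using p(5)[of "P ! j"] parity[of j] that by (simp_all add: signed_def)
  have lin: "?l (P ! j) = - c (P ! j)" if "j < length P" "odd j" for j
    using parity[of j] that by (simp add: signed_def)
  have eqP: "P ! i = P ! j \<longleftrightarrow> i = j" if "i < length P" "j < length P" for i j
    using nth_eq_iff_index_eq[OF dis that] .

  \<comment> \<open>Numbering for \<open>A\<close>: \<open>xA 0\<close> is the source, and
    \<open>yA i\<close> immediately precedes \<open>xA i\<close> on the walk.\<close>
  define xA where "xA i = P ! (2 * (k - i))" for i
  define yA where "yA i = P ! (2 * (k - i) + 1)" for i
  have A: "min_weight A p (I - yA ` {1..k} \<union> xA ` {0..k})"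
    "card (I - yA ` {1..k} \<union> xA ` {0..k}) = Suc (card I)"
  proof -
    have "drop (2 * k) P = [P ! (2 * k)]" using k Cons_nth_drop_Suc[of "2 * k" P] by simp
    then have x0: "xA 0 \<in> ?X" "p (xA 0) = 0"
      using src k pout[of "2 * k"] dP[of "2 * k"] by (simp_all add: xA_def)
    have start: False if "j \<in> {1..k}" "insert (xA j) I \<in> A" "p (xA j) = p (xA 0)" for j
      using no_source[of "2 * (k - j)"] that x0(2) pout[of "2 * (k - j)"] parity[of "2 * (k - j)"] k
      by (auto simp: xA_def addable_def)
    have short: False if ij: "i \<in> {1..k}" "j \<in> {1..k}" "i < j"
      "insert (xA j) (I - {yA i}) \<in> A" "p (xA j) = p (yA i)" for i j
    proof (rule no_shortcut[of "2 * (k - j)" "2 * (k - i) + 1"])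
      show "2 * (k - j) + 1 < 2 * (k - i) + 1" "2 * (k - i) + 1 < length P" using ij k by auto
      show "?E (P ! (2 * (k - i) + 1)) (P ! (2 * (k - j)))"
        using ij(4) parity[of "2 * (k - i) + 1"] parity[of "2 * (k - j)"] ij(1,2) k
        by (simp add: exchange_arc_def xA_def yA_def)
      show "d (P ! (2 * (k - j))) = d (P ! (2 * (k - i) + 1)) + ?l (P ! (2 * (k - j)))"
        using ij(5) pin[of "2 * (k - i) + 1"] pout[of "2 * (k - j)"] ij(1,2) k
        by (simp add: xA_def yA_def)
    qed
    have ex: "insert (xA i) (I - {yA i}) \<in> A" "p (xA i) = p (yA i)" if "i \<in> {1..k}" for i
      using step[of "2 * (k - i)"] tight[of "2 * (k - i)"] parity[of "2 * (k - i) + 1"]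
        pin[of "2 * (k - i) + 1"] pout[of "2 * (k - i)"] that k
      by (auto simp: exchange_arc_def xA_def yA_def)
    have inj: "inj_on xA {0..k}" "inj_on yA {1..k}"
      using k by (auto simp: inj_on_def xA_def yA_def eqP)
    have mem: "yA i \<in> I" if "i \<in> {1..k}" for i
      using parity[of "2 * (k - i) + 1"] that k by (auto simp: yA_def)
    have nmem: "xA i \<notin> I" if "i \<in> {0..k}" for i
      using parity[of "2 * (k - i)"] that k by (auto simp: xA_def)
    have x0min: "p (xA 0) \<le> p z" if "z \<notin> I" "insert z I \<in> A" for z
      using p(3)[of z] that x0(2) by (simp add: addable_def)
    have x0A: "insert (xA 0) I \<in> A" using x0(1) by (simp add: addable_def)
    show "min_weight A p (I - yA ` {1..k} \<union> xA ` {0..k})"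
      by (rule augment_min_weight(1)[OF MA p(1) inj _ _ x0A]) (fact mem nmem x0min ex short start)+
    show "card (I - yA ` {1..k} \<union> xA ` {0..k}) = Suc (card I)"
      by (rule augment_min_weight(2)[OF MA p(1) inj _ _ x0A]) (fact mem nmem x0min ex short start)+
  qed
  \<comment> \<open>Numbering for \<open>B\<close>: \<open>xB 0\<close> is the sink, and
    \<open>xB i\<close> immediately precedes \<open>yB i\<close> on the walk.\<close>
  define xB where "xB i = P ! (2 * i)" for i
  define yB where "yB i = P ! (2 * i - 1)" for i
  let ?q = "\<lambda>x. c x - p x"
  have B: "min_weight B ?q (I - yB ` {1..k} \<union> xB ` {0..k})"
  proof -
    have x0: "xB 0 \<in> ?T" "?q (xB 0) = walk_length ?l P"
      using snk k pout[of 0] dP[of 0] by (simp_all add: xB_def)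
    have start: False if "j \<in> {1..k}" "insert (xB j) I \<in> B" "?q (xB j) = ?q (xB 0)" for j
      using no_sink[of "2 * j"] that x0(2) pout[of "2 * j"] parity[of "2 * j"] k
      by (auto simp: xB_def addable_def)
    have short: False if ij: "i \<in> {1..k}" "j \<in> {1..k}" "i < j"
      "insert (xB j) (I - {yB i}) \<in> B" "?q (xB j) = ?q (yB i)" for i j
    proof (rule no_shortcut[of "2 * i - 1" "2 * j"])
      show "2 * i - 1 + 1 < 2 * j" "2 * j < length P" using ij k by auto
      have o: "odd (2 * i - 1)" "2 * i - 1 < length P" using ij(1) k by auto
      show "?E (P ! (2 * j)) (P ! (2 * i - 1))"
        using ij(4) parity[of "2 * i - 1"] parity[of "2 * j"] o ij(1,2) k
        by (simp add: exchange_arc_def xB_def yB_def)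
      show "d (P ! (2 * i - 1)) = d (P ! (2 * j)) + ?l (P ! (2 * i - 1))"
        using ij(5) pin[of "2 * i - 1"] lin[of "2 * i - 1"] pout[of "2 * j"] o ij(1,2) k
        by (simp add: xB_def yB_def)
    qed
    have ex: "insert (xB i) (I - {yB i}) \<in> B" "?q (xB i) = ?q (yB i)" if "i \<in> {1..k}" for i
    proof -
      have o: "odd (2 * i - 1)" "2 * i - 1 < length P" "Suc (2 * i - 1) = 2 * i" "2 * i < length P"
        using that k by auto
      show "insert (xB i) (I - {yB i}) \<in> B"
        using step[of "2 * i - 1"] parity[of "2 * i"] o
        by (simp add: exchange_arc_def xB_def yB_def)
      show "?q (xB i) = ?q (yB i)"
        using tight[of "2 * i - 1"] pin[of "2 * i - 1"] lin[of "2 * i - 1"] pout[of "2 * i"] o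
        by (simp add: xB_def yB_def)
    qed
    have inj: "inj_on xB {0..k}" "inj_on yB {1..k}"
      using k by (auto simp: inj_on_def xB_def yB_def eqP)
    have mem: "yB i \<in> I" if "i \<in> {1..k}" for i
      using parity[of "2 * i - 1"] that k by (auto simp: yB_def)
    have nmem: "xB i \<notin> I" if "i \<in> {0..k}" for i
      using parity[of "2 * i"] that k by (auto simp: xB_def)
    have x0min: "?q (xB 0) \<le> ?q z" if "z \<notin> I" "insert z I \<in> B" for z
      using p(4)[of z] that x0(2) by (simp add: addable_def)
    have x0B: "insert (xB 0) I \<in> B" using x0(1) by (simp add: addable_def)
    show ?thesis
      by (rule augment_min_weight(1)[OF MB p(2) inj _ _ x0B]) (fact mem nmem x0min ex short start)+
  qed
  have sets: "I - yA ` {1..k} \<union> xA ` {0..k} = sym_diff I (set P)"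
    "I - yB ` {1..k} \<union> xB ` {0..k} = sym_diff I (set P)"
  proof -
    have evens: "{z \<in> set P. z \<notin> I} = (\<lambda>i. P ! (2 * i)) ` {0..k}"
    proof (intro equalityI subsetI)
      fix z assume "z \<in> {z \<in> set P. z \<notin> I}"
      then obtain j where "j < length P" "z = P ! j" "even j" by (auto simp: in_set_conv_nth parity)
      then show "z \<in> (\<lambda>i. P ! (2 * i)) ` {0..k}" using k by (auto elim!: evenE)
    qed (use k in \<open>auto simp: parity\<close>)
    have odds: "{z \<in> set P. z \<in> I} = (\<lambda>i. P ! (2 * i - 1)) ` {1..k}"
    proof (intro equalityI subsetI)
      fix z assume "z \<in> {z \<in> set P. z \<in> I}"
      then obtain j where j: "j < length P" "z = P ! j" "odd j" by (auto simp: in_set_conv_nth parity)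
      then obtain i where "j = 2 * i + 1" by (auto elim!: oddE)
      then show "z \<in> (\<lambda>i. P ! (2 * i - 1)) ` {1..k}" using k j by (intro image_eqI[of _ _ "i + 1"]) auto
    qed (use k in \<open>auto simp: parity\<close>)
    have xB: "xB ` {0..k} = {z \<in> set P. z \<notin> I}" and yB: "yB ` {1..k} = {z \<in> set P. z \<in> I}"
      unfolding evens odds xB_def yB_def by auto
    have "xA ` {0..k} = xB ` {0..k}"
    proof -
      have "xA ` {0..k} = (\<lambda>i. xB (k - i)) ` {0..k}" by (simp add: xA_def xB_def)
      also have "\<dots> = xB ` ((\<lambda>i. k - i) ` {0..k})" by (simp add: image_image)
      also have "(\<lambda>i. k - i) ` {0..k} = {0..k}"
      proof (intro equalityI subsetI)
        fix i assume "i \<in> {0..k}"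
        then show "i \<in> (\<lambda>i. k - i) ` {0..k}" by (intro image_eqI[of _ _ "k - i"]) auto
      qed auto
      finally show ?thesis .
    qed
    moreover have "yA ` {1..k} = yB ` {1..k}"
    proof -
      have "yA ` {1..k} = (\<lambda>i. yB (k + 1 - i)) ` {1..k}"
        by (rule image_cong) (auto simp: yA_def yB_def Suc_diff_le)
      also have "\<dots> = yB ` ((\<lambda>i. k + 1 - i) ` {1..k})" by (simp add: image_image)
      also have "(\<lambda>i. k + 1 - i) ` {1..k} = {1..k}"
      proof (intro equalityI subsetI)
        fix i assume "i \<in> {1..k}"
        then show "i \<in> (\<lambda>i. k + 1 - i) ` {1..k}" by (intro image_eqI[of _ _ "k + 1 - i"]) auto
      qed auto
      finally show ?thesis .
    qed
    ultimately show "I - yA ` {1..k} \<union> xA ` {0..k} = sym_diff I (set P)"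
      "I - yB ` {1..k} \<union> xB ` {0..k} = sym_diff I (set P)" using xB yB by auto
  qed
  show "extreme A B c (sym_diff I (set P))"
    unfolding extreme_def using A(1) B unfolding sets by blast
  show "card (sym_diff I (set P)) = Suc (card I)" using A(2) unfolding sets .
qed

text \<open>Extend \<open>insert x K\<close> by elements of \<open>I\<close> to the size of
  \<open>I\<close>. Since \<open>x\<close> lies outside \<open>I\<close>, exactly one element
  \<open>y\<close> of \<open>I\<close> is left out, and it is not in \<open>K\<close>.\<close>

lemma matroid_exchange_outside:
  assumes M: "matroid S A" and I: "I \<in> A" and K: "K \<subseteq> I" "insert x K \<in> A"
    and x: "x \<notin> I" "insert x I \<notin> A"
  shows "\<exists>y\<in>I - K. insert x (I - {y}) \<in> A"
proof -
  have fI: "finite I" using matroid_finite[OF M I] .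
  have "K \<noteq> I" using K x by auto
  then have "card K < card I" using K fI psubset_card_mono by blast
  moreover have "card (insert x K) = Suc (card K)" using K x fI finite_subset by (metis card_insert_disjoint subsetD)
  ultimately obtain Z where Z: "insert x K \<subseteq> Z" "Z \<subseteq> insert x K \<union> I" "Z \<in> A" "card Z = card I"
    using matroid_extend[OF M K(2) I] by auto
  have "finite Z" using matroid_finite[OF M Z(3)] .
  have xZ: "x \<in> Z" using Z by auto
  have "Z - {x} \<subseteq> I" using Z K by auto
  moreover have "card (Z - {x}) < card I" using xZ \<open>finite Z\<close> Z(4) by (metis card_Diff1_less)
  ultimately obtain y where y: "y \<in> I" "y \<notin> Z" 
    using x by (metis DiffI less_irrefl subsetI subset_antisym empty_iff insert_iff)
  have "card (I - {y}) = card (Z - {x})" using y xZ fI \<open>finite Z\<close> Z(4) by simp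
  then have "Z - {x} = I - {y}"
    using \<open>Z - {x} \<subseteq> I\<close> y fI by (intro card_subset_eq) auto
  then have "insert x (I - {y}) = Z" using xZ by auto
  moreover have "y \<notin> K" using y Z by auto
  ultimately show ?thesis using y Z by auto
qed

text \<open>The reachable set \<open>R\<close> is a dual solution. It is closed under arcs, so
  \<open>I \<inter> R\<close> cannot be enlarged within \<open>R\<close> in \<open>B\<close>, nor
  \<open>I - R\<close> outside \<open>R\<close> in \<open>A\<close>; hence neither part of
  \<open>J\<close> is larger than the corresponding part of \<open>I\<close>.\<close>

theorem no_augmenting_walk_maximum:
  assumes MA: "matroid S A" and MB: "matroid S B" and I: "I \<in> A" "I \<in> B"
    and none: "\<And>W. walk (exchange_arc A B I) (addable A I) W \<Longrightarrow> hd W \<notin> addable B I"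
    and J: "J \<in> A" "J \<in> B"
  shows "card J \<le> card I"
proof (rule ccontr)
  let ?E = "exchange_arc A B I"
  define R where "R = {x. \<exists>W. walk ?E (addable A I) W \<and> hd W = x}"
  have closed: "v \<in> R" if uv: "u \<in> R" "?E u v" for u v
  proof -
    obtain W where "walk ?E (addable A I) W" "hd W = u" using uv(1) unfolding R_def by blast
    then have "walk ?E (addable A I) (v # W)" using walk_Cons uv(2) by metis
    then show ?thesis unfolding R_def by force
  qed
  have src: "addable A I \<subseteq> R"
  proof
    fix x assume "x \<in> addable A I"
    then have "walk ?E (addable A I) [x]" by simp
    then show "x \<in> R" unfolding R_def by (metis (mono_tags) list.sel(1) mem_Collect_eq)
  qed
  have snk: "addable B I \<inter> R = {}" unfolding R_def using none by auto
  have fin: "finite I" "finite J" using matroid_finite[OF MA] I J by auto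
  assume "\<not> card J \<le> card I"
  moreover have "card J = card (J \<inter> R) + card (J - R)" "card I = card (I \<inter> R) + card (I - R)"
    using fin by (auto simp: card_Int_Diff)
  ultimately consider "card (I \<inter> R) < card (J \<inter> R)" | "card (I - R) < card (J - R)" by linarith
  then show False
  proof cases
    case 1
    obtain x where x: "x \<in> J \<inter> R - I \<inter> R" "insert x (I \<inter> R) \<in> B"
      using matroid_augment[OF MB matroid_subset[OF MB I(2)] matroid_subset[OF MB J(2)] 1] by auto
    then have xI: "x \<notin> I" "x \<in> R" by auto
    then have "insert x I \<notin> B" using snk unfolding addable_def by auto
    then obtain y where "y \<in> I - I \<inter> R" "insert x (I - {y}) \<in> B"
      using matroid_exchange_outside[OF MB I(2) _ x(2) xI(1)] by auto
    then show False using closed[of x y] xI unfolding exchange_arc_def by auto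
  next
    case 2
    obtain x where x: "x \<in> (J - R) - (I - R)" "insert x (I - R) \<in> A"
      using matroid_augment[OF MA matroid_subset[OF MA I(1)] matroid_subset[OF MA J(1)] 2] by auto
    then have xI: "x \<notin> I" "x \<notin> R" by auto
    then have "insert x I \<notin> A" using src unfolding addable_def by auto
    then obtain y where "y \<in> I - (I - R)" "insert x (I - {y}) \<in> A"
      using matroid_exchange_outside[OF MA I(1) _ x(2) xI(1)] by auto
    then show False using closed[of y x] xI unfolding exchange_arc_def by auto
  qed
qed

text \<open>The list \<open>es\<close> doubles as a counter: folds are the only loops, and
  \<open>length es\<close> rounds cover all walks without repetitions. In \<open>intersect\<close>
  it counts the augmentations in the same way.\<close>

definition augment_once ::
    "'a set set \<Rightarrow> 'a set set \<Rightarrow> ('a \<Rightarrow> real) \<Rightarrow> 'a list \<Rightarrow> 'a list \<Rightarrow> 'a list" where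
  "augment_once A B c es I =
     (let labs = fold (\<lambda>_. relax_all (exchange_arc A B (set I)) (signed c (set I))) es
                   (initial_labels (addable A (set I)) (signed c (set I)) es)
      in case fold (pick (addable B (set I))) labs None of
           None \<Rightarrow> I
         | Some (d, P) \<Rightarrow> rev (filter (\<lambda>x. (x \<in> set I) \<noteq> (x \<in> set P)) es))"

definition intersect ::
    "'a set set \<Rightarrow> 'a set set \<Rightarrow> ('a \<Rightarrow> real) \<Rightarrow> 'a list \<Rightarrow> 'a list" where
  "intersect A B c es = fold (\<lambda>_. augment_once A B c es) es []"

lemma fold_relax_all_ok:
  assumes "labels_ok E X l S h labs" and "\<And>x y. E x y \<Longrightarrow> x \<in> S"
  shows "labels_ok E X l S (h + length es) (fold (\<lambda>_. relax_all E l) es labs)"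
  using assms
proof (induction es arbitrary: h labs)
  case (Cons e es)
  have "labels_ok E X l S (Suc h) (relax_all E l labs)"
    using relax_all_ok[OF Cons.prems(1)] Cons.prems(2) by blast
  then show ?case using Cons.IH[of "Suc h" "relax_all E l labs"] Cons.prems(2) by simp
qed simp

lemma augment_once:
  assumes MA: "matroid (set es) A" and MB: "matroid (set es) B" and ext: "extreme A B c (set I)"
  shows "extreme A B c (set (augment_once A B c es I))"
    and "card (set (augment_once A B c es I)) = Suc (card (set I)) \<or>
      set (augment_once A B c es I) = set I \<and> (\<forall>J\<in>A \<inter> B. card J \<le> card (set I))"
proof -
  let ?S = "set es" and ?I = "set I"
  let ?E = "exchange_arc A B ?I" and ?X = "addable A ?I" and ?T = "addable B ?I"
    and ?l = "signed c ?I"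
  obtain p0 where p0: "min_weight A p0 ?I" "min_weight B (\<lambda>x. c x - p0 x) ?I"
    using ext unfolding extreme_def by blast
  have I: "?I \<in> A" "?I \<in> B" using p0 by (auto simp: min_weight_def)
  note inS = exchange_arc_carrier[OF MA MB I(1)]
  define labs where "labs = fold (\<lambda>_. relax_all ?E ?l) es (initial_labels ?X ?l es)"
  have ok: "labels_ok ?E ?X ?l ?S (length es) labs"
  proof -
    have "labels_ok ?E ?X ?l ?S (0 + length es) labs"
      unfolding labs_def by (rule fold_relax_all_ok[OF initial_labels_ok]) (rule inS(1))
    then show ?thesis by simp
  qed
  have le: "card ?S \<le> Suc (length es)" using card_length[of es] by simp
  have pk: "case fold (pick ?T) labs None of None \<Rightarrow> \<forall>W. walk ?E ?X W \<longrightarrow> hd W \<notin> ?T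
    | Some (d, P) \<Rightarrow> best_walk ?E ?X ?T ?l P \<and> length P \<le> Suc (length es)"
    by (rule pick_best_walk[OF ok le exchange_potential[OF MA MB p0] _ addable_carrier[OF MA]])
      (auto intro: inS(2))
  have "extreme A B c (set (augment_once A B c es I)) \<and>
    (card (set (augment_once A B c es I)) = Suc (card (set I)) \<or>
      set (augment_once A B c es I) = set I \<and> (\<forall>J\<in>A \<inter> B. card J \<le> card (set I)))"
  proof (cases "fold (pick ?T) labs None")
    case None
    then have "augment_once A B c es I = I" unfolding augment_once_def labs_def by simp
    moreover have "\<forall>J\<in>A \<inter> B. card J \<le> card ?I"
    proof
      fix J assume "J \<in> A \<inter> B"
      then show "card J \<le> card ?I"
        using pk None by (intro no_augmenting_walk_maximum[OF MA MB I]) auto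
    qed
    ultimately show ?thesis using ext by simp
  next
    case (Some dP)
    obtain d P where dP: "dP = (d, P)" by force
    have best: "best_walk ?E ?X ?T ?l P" using pk Some dP le by simp
    have "set P \<subseteq> ?S" 
    proof (rule walk_nodes[OF _ addable_carrier[OF MA]])
      show "walk ?E ?X P" using best unfolding best_walk_def by blast
      show "v \<in> ?S" if "?E u v" for u v using inS(2) that .
    qed
    moreover have "?I \<subseteq> ?S" using matroid_carrier[OF MA I(1)] .
    moreover have "augment_once A B c es I = rev (filter (\<lambda>x. (x \<in> set I) \<noteq> (x \<in> set P)) es)"
      using Some dP unfolding augment_once_def labs_def by simp
    ultimately have "set (augment_once A B c es I) = sym_diff ?I (set P)" by auto
    then show ?thesis using augment_extreme[OF MA MB ext best] by simp
  qed
  then show "extreme A B c (set (augment_once A B c es I))"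
    and "card (set (augment_once A B c es I)) = Suc (card (set I)) \<or>
      set (augment_once A B c es I) = set I \<and> (\<forall>J\<in>A \<inter> B. card J \<le> card (set I))" by blast+
qed

theorem intersect_optimal:
  assumes MA: "matroid (set es) A" and MB: "matroid (set es) B"
  shows "set (intersect A B c es) \<in> A" "set (intersect A B c es) \<in> B"
    and "J \<in> A \<Longrightarrow> J \<in> B \<Longrightarrow> card J \<le> card (set (intersect A B c es))"
    and "J \<in> A \<Longrightarrow> J \<in> B \<Longrightarrow> card J = card (set (intersect A B c es)) \<Longrightarrow>
      sum c (set (intersect A B c es)) \<le> sum c J"
proof -
  let ?step = "\<lambda>_. augment_once A B c es"
  \<comment> \<open>Each iteration adds an element or finds the maximum size already reached. A set
    that has grown in all \<open>length es\<close> iterations is as large as any subset of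
    \<open>set es\<close>, so both alternatives end at a maximum.\<close>
  have inv: "extreme A B c (set (fold ?step fs I)) \<and>
      (card (set (fold ?step fs I)) = card (set I) + length fs \<or>
       (\<forall>J\<in>A \<inter> B. card J \<le> card (set (fold ?step fs I))))" if "extreme A B c (set I)" for fs I
    using that
  proof (induction fs arbitrary: I)
    case (Cons f fs)
    let ?I' = "augment_once A B c es I"
    have IH: "extreme A B c (set (fold ?step fs ?I')) \<and>
      (card (set (fold ?step fs ?I')) = card (set ?I') + length fs \<or>
       (\<forall>J\<in>A \<inter> B. card J \<le> card (set (fold ?step fs ?I'))))"
      using Cons.IH augment_once(1)[OF MA MB Cons.prems] by blast
    have max: "\<forall>J\<in>A \<inter> B. card J \<le> card (set (fold ?step fs ?I'))"
      if "\<forall>J\<in>A \<inter> B. card J \<le> card (set ?I')"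
    proof -
      have "card (set ?I') \<le> card (set (fold ?step fs ?I'))"
        using IH augment_once(1)[OF MA MB Cons.prems] by (auto simp: extreme_def min_weight_def)
      then show ?thesis using that by force
    qed
    show ?case using augment_once(2)[OF MA MB Cons.prems] IH max by auto
  qed simp
  have "{} \<in> A" "{} \<in> B" using MA MB unfolding matroid_def by auto
  then have ext0: "extreme A B c (set [])"
    unfolding extreme_def min_weight_def using MA MB matroid_finite by (fastforce simp: card_eq_0_iff)
  let ?R = "intersect A B c es"
  have R: "extreme A B c (set ?R)"
    "card (set ?R) = length es \<or> (\<forall>J\<in>A \<inter> B. card J \<le> card (set ?R))"
    using inv[OF ext0, of es] unfolding intersect_def by auto
  show "set ?R \<in> A" "set ?R \<in> B" using R(1) unfolding extreme_def min_weight_def by blast+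
  show "card J \<le> card (set ?R)" if "J \<in> A" "J \<in> B"
  proof -
    have "card J \<le> length es"
      using card_mono[OF _ matroid_carrier[OF MA that(1)]] card_length[of es] by simp
    then show ?thesis using R(2) that by auto
  qed
  show "sum c (set ?R) \<le> sum c J" if "J \<in> A" "J \<in> B" "card J = card (set ?R)"
    using extreme_optimal[OF R(1) that] .
qed

lemma length_augment_once: "length I \<le> length es \<Longrightarrow> length (augment_once A B c es I) \<le> length es"
  unfolding augment_once_def Let_def by (auto split: option.splits)

lemma length_intersect:
  fixes es :: "'a list"
  shows "length (intersect A B c es) \<le> length es"
proof -
  have "length (fold (\<lambda>_. augment_once A B c es) us I) \<le> length es" if "length I \<le> length es"
    for us :: "'a list" and I
    using that by (induction us arbitrary: I) (simp_all add: length_augment_once)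
  from this[of "[]" es] show ?thesis unfolding intersect_def by simp
qed

section \<open>The matching problem on a rooted tree\<close>

type_synonym node = "nat \<times> nat"
type_synonym elem = "node \<times> node \<times> real"

abbreviation lft :: "elem \<Rightarrow> node" where "lft e \<equiv> fst e"
abbreviation rgt :: "elem \<Rightarrow> node" where "rgt e \<equiv> fst (snd e)"
abbreviation cost :: "elem \<Rightarrow> real" where "cost e \<equiv> snd (snd e)"

definition terminals :: "('e \<Rightarrow> node) \<Rightarrow> 'e set \<Rightarrow> nat set" where
  "terminals f X = {v. (0, v) \<in> f ` X}"

text \<open>The given matroid on the terminals, free elements on all other nodes of this side, and
  elements at the same node made parallel.\<close>

definition side_indep :: "'e set \<Rightarrow> ('e \<Rightarrow> node) \<Rightarrow> nat set set \<Rightarrow> 'e set set" where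
  "side_indep G f I = {X. X \<subseteq> G \<and> inj_on f X \<and> terminals f X \<in> I}"

text \<open>If the larger set \<open>Y\<close> touches a node of nonzero kind that \<open>X\<close>
  misses, the element there can be added freely. Otherwise \<open>Y\<close> has more terminals than
  \<open>X\<close>, and the augmentation takes place in \<open>I\<close>.\<close>

lemma side_matroid:
  assumes G: "finite G" and M: "matroid V I"
  shows "matroid G (side_indep G f I)"
  unfolding matroid_def
proof (intro conjI ballI allI impI)
  show "{} \<in> side_indep G f I"
    using M unfolding side_indep_def terminals_def matroid_def by simp
  fix X assume X: "X \<in> side_indep G f I"
  show "Y \<in> side_indep G f I" if "Y \<subseteq> X" for Y
  proof -
    have "terminals f Y \<subseteq> terminals f X" using that unfolding terminals_def by auto
    then have "terminals f Y \<in> I" using X matroid_subset[OF M] unfolding side_indep_def by blast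
    moreover have "inj_on f Y" "Y \<subseteq> G"
      using X that inj_on_subset unfolding side_indep_def by auto
    ultimately show ?thesis unfolding side_indep_def by blast
  qed
  fix Y assume Y: "Y \<in> side_indep G f I" and less: "card X < card Y"
  have fin: "finite X" "finite Y" using X Y G finite_subset unfolding side_indep_def by blast+
  have inj: "inj_on f X" "inj_on f Y" and trm: "terminals f X \<in> I" "terminals f Y \<in> I"
    using X Y unfolding side_indep_def by auto
  show "\<exists>y\<in>Y - X. insert y X \<in> side_indep G f I"
  proof (cases "\<exists>y\<in>Y. fst (f y) \<noteq> 0 \<and> f y \<notin> f ` X")
    case True
    then obtain y where y: "y \<in> Y" "fst (f y) \<noteq> 0" "f y \<notin> f ` X" by blast
    have "(0, v) \<noteq> f y" for v using y(2) by (metis fst_conv)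
    then have "terminals f (insert y X) = terminals f X" unfolding terminals_def by auto
    moreover have "inj_on f (insert y X)" using inj(1) y(3) by auto
    moreover have "insert y X \<subseteq> G" using X Y y(1) unfolding side_indep_def by auto
    moreover have "y \<notin> X" using y(3) by auto
    ultimately show ?thesis using y trm unfolding side_indep_def by (intro bexI[of _ y]) auto
  next
    case False
    let ?rest = "\<lambda>X. {n \<in> f ` X. fst n \<noteq> 0}"
    have split: "f ` Z = Pair 0 ` terminals f Z \<union> ?rest Z" "Pair 0 ` terminals f Z \<inter> ?rest Z = {}" for Z
    proof -
      have "n \<in> Pair 0 ` terminals f Z" if "n \<in> f ` Z" "fst n = 0" for n
      proof -
        have "n = (0, snd n)" using that(2) by (cases n) simp
        then show ?thesis using that(1) unfolding terminals_def by (metis image_eqI mem_Collect_eq)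
      qed
      moreover have "Pair 0 ` terminals f Z \<subseteq> f ` Z" unfolding terminals_def by blast
      ultimately show "f ` Z = Pair 0 ` terminals f Z \<union> ?rest Z" by (intro equalityI subsetI) auto
      show "Pair 0 ` terminals f Z \<inter> ?rest Z = {}"
      proof (rule equals0I)
        fix n assume "n \<in> Pair 0 ` terminals f Z \<inter> ?rest Z"
        then have "n \<in> Pair 0 ` terminals f Z" "fst n \<noteq> 0" by simp_all
        then show False by (metis fst_conv imageE)
      qed
    qed
    have fint: "finite (terminals f Z)" if "finite Z" for Z
    proof (rule finite_subset)
      show "terminals f Z \<subseteq> (\<lambda>e. snd (f e)) ` Z"
        unfolding terminals_def by (auto simp: image_iff) (metis snd_conv)
    qed (use that in simp)
    have card: "card Z = card (terminals f Z) + card (?rest Z)" if "finite Z" "inj_on f Z" for Z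
    proof -
      have "card Z = card (f ` Z)" using card_image[OF that(2)] by simp
      also have "\<dots> = card (Pair (0::nat) ` terminals f Z) + card (?rest Z)"
        using split[of Z] fint[OF that(1)] that(1) card_Un_disjoint[of "Pair 0 ` terminals f Z" "?rest Z"]
        by simp
      also have "card (Pair (0::nat) ` terminals f Z) = card (terminals f Z)"
        by (rule card_image) (auto simp: inj_on_def)
      finally show ?thesis .
    qed
    have "?rest Y \<subseteq> ?rest X" using False by auto
    then have "card (?rest Y) \<le> card (?rest X)" using fin by (intro card_mono) auto
    then have "card (terminals f X) < card (terminals f Y)"
      using card[OF fin(1) inj(1)] card[OF fin(2) inj(2)] less by linarith
    then obtain v where v: "v \<in> terminals f Y - terminals f X" "insert v (terminals f X) \<in> I"
      using matroid_augment[OF M trm] by blast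
    then obtain y where y: "y \<in> Y" "f y = (0, v)" unfolding terminals_def by auto
    have ny: "f y \<notin> f ` X" using v(1) y(2) unfolding terminals_def by auto
    have "terminals f (insert y X) = insert v (terminals f X)" using y(2) unfolding terminals_def by auto
    moreover have "inj_on f (insert y X)" using inj(1) ny by auto
    moreover have "insert y X \<subseteq> G" using X Y y(1) unfolding side_indep_def by auto
    moreover have "y \<notin> X" using ny by auto
    ultimately show ?thesis using y v(2) unfolding side_indep_def by (intro bexI[of _ y]) auto
  qed
qed (use G in \<open>auto simp: side_indep_def\<close>)

definition swap_node :: "node \<Rightarrow> node" where
  "swap_node n = (if fst n = 1 then 2 else if fst n = 2 then 1 else fst n, snd n)"

text \<open>Reversal of all paths: the sides change places, and with them the kinds 1 and 2. Facts
  about the second matroid are obtained in this way from those about the first.\<close>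

definition mirror :: "elem \<Rightarrow> elem" where
  "mirror e = (swap_node (rgt e), swap_node (lft e), cost e)"

lemma swap_node_swap_node [simp]: "swap_node (swap_node n) = n"
  by (cases n) (auto simp: swap_node_def)

lemma mirror_mirror [simp]: "mirror (mirror e) = e"
  by (simp add: mirror_def)

lemma inj_swap_node: "inj_on swap_node X"
  by (rule inj_on_inverseI[of _ swap_node]) simp

lemma inj_mirror: "inj_on mirror X"
  by (rule inj_on_inverseI[of _ mirror]) simp

lemma mirror_lft: "lft (mirror e) = swap_node (rgt e)" and mirror_rgt: "rgt (mirror e) = swap_node (lft e)"
  by (simp_all add: mirror_def)

lemma sum_UN_le:
  fixes f :: "'a \<Rightarrow> real"
  assumes "finite C" "\<And>i. i \<in> C \<Longrightarrow> finite (S i)" "\<And>i x. i \<in> C \<Longrightarrow> x \<in> S i \<Longrightarrow> 0 \<le> f x"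
  shows "sum f (\<Union>i\<in>C. S i) \<le> (\<Sum>i\<in>C. sum f (S i))"
  using assms
proof (induction C)
  case (insert c C)
  let ?U = "\<Union>i\<in>C. S i"
  have fin: "finite (S c)" "finite ?U" using insert.prems insert.hyps by auto
  have "sum f (S c \<union> ?U) = sum f (S c) + sum f ?U - sum f (S c \<inter> ?U)" using sum_Un[OF fin] .
  moreover have "0 \<le> sum f (S c \<inter> ?U)" using insert.prems(2) by (intro sum_nonneg) auto
  moreover have "sum f ?U \<le> (\<Sum>i\<in>C. sum f (S i))" using insert.IH insert.prems by blast
  ultimately show ?case using insert.hyps by simp
qed simp

text \<open>\<open>pos\<close> is any rank that grows away from the root; it makes climbing
  well-founded. The value of \<open>par r\<close> is left open.\<close>

locale rooted_tree =
  fixes V :: "nat set" and r :: nat and par pos :: "nat \<Rightarrow> nat" and w :: "nat set \<Rightarrow> real"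
  assumes finite_V: "finite V" and root: "r \<in> V"
    and par: "\<And>v. v \<in> V \<Longrightarrow> v \<noteq> r \<Longrightarrow> par v \<in> V"
    and pos: "\<And>v. v \<in> V \<Longrightarrow> v \<noteq> r \<Longrightarrow> pos (par v) < pos v"
    and nonneg: "\<And>v. v \<in> V \<Longrightarrow> v \<noteq> r \<Longrightarrow> 0 \<le> w {v, par v}"
begin

definition edges :: "nat set set" where "edges = (\<lambda>v. {v, par v}) ` (V - {r})"

text \<open>A tree edge is charged to its lower end, so that sets of cut edges become sets of
  vertices.\<close>

definition \<omega> :: "nat \<Rightarrow> real" where "\<omega> v = (if v = r then 0 else w {v, par v})"

definition cross_cost :: "nat \<Rightarrow> nat \<Rightarrow> real" where
  "cross_cost u v = (if u = v then \<omega> u else \<omega> u + \<omega> v)"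

lemma cross_cost_sum: "cross_cost u v = sum \<omega> {u, v}"
  by (simp add: cross_cost_def)

lemma \<omega>_nonneg: "v \<in> V \<Longrightarrow> 0 \<le> \<omega> v"
  using nonneg by (simp add: \<omega>_def)

text \<open>A path leads from a terminal of the first matroid (left node of kind 0) up the tree through
  nodes of kind 1, crosses over at a cut, and runs down through nodes of kind 2 to a terminal of the
  second matroid (right node of kind 0). Vertices without a path are matched to themselves.\<close>

inductive_set ground :: "elem set" where
  enter: "e = ((0, v), (1, v), 0) \<Longrightarrow> v \<in> V \<Longrightarrow> e \<in> ground"
| idle_up: "e = ((1, v), (1, v), 0) \<Longrightarrow> v \<in> V \<Longrightarrow> e \<in> ground"
| up: "e = ((1, v), (1, par v), 0) \<Longrightarrow> v \<in> V \<Longrightarrow> v \<noteq> r \<Longrightarrow> e \<in> ground"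
| cross: "e = ((1, u), (2, v), cross_cost u v) \<Longrightarrow> u \<in> V \<Longrightarrow> v \<in> V \<Longrightarrow> e \<in> ground"
| idle_down: "e = ((2, v), (2, v), 0) \<Longrightarrow> v \<in> V \<Longrightarrow> e \<in> ground"
| down: "e = ((2, par v), (2, v), 0) \<Longrightarrow> v \<in> V \<Longrightarrow> v \<noteq> r \<Longrightarrow> e \<in> ground"
| leave: "e = ((2, v), (0, v), 0) \<Longrightarrow> v \<in> V \<Longrightarrow> e \<in> ground"

lemma cross_cost_commute: "cross_cost u v = cross_cost v u"
  by (simp add: cross_cost_def)

lemma mirror_ground: "e \<in> ground \<Longrightarrow> mirror e \<in> ground"
  by (erule ground.cases)
    (auto simp: mirror_def swap_node_def cross_cost_commute intro: ground.intros)

lemma cost_nonneg: "e \<in> ground \<Longrightarrow> 0 \<le> cost e"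
  by (erule ground.cases) (auto simp: cross_cost_def \<omega>_nonneg)

text \<open>\<open>F\<close> holds the lower ends of the cut edges; the reflexive transitive closure
  leads to the ancestors within the same component.\<close>

definition climb :: "nat set \<Rightarrow> (nat \<times> nat) set" where
  "climb F = {(v, par v) | v. v \<in> V \<and> v \<noteq> r \<and> v \<notin> F}"

lemma climb_in: "(v, x) \<in> (climb F)\<^sup>* \<Longrightarrow> v \<in> V \<Longrightarrow> x \<in> V"
  by (induction rule: rtrancl_induct) (auto simp: climb_def par)

lemma climb_pos: "(v, x) \<in> (climb F)\<^sup>* \<Longrightarrow> pos x \<le> pos v"
proof (induction rule: rtrancl_induct)
  case (step y z)
  then show ?case using pos by (force simp: climb_def)
qed simp

lemma climb_linear:
  assumes "(b, x) \<in> (climb F)\<^sup>*" "(b, y) \<in> (climb F)\<^sup>*"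
  shows "(x, y) \<in> (climb F)\<^sup>* \<or> (y, x) \<in> (climb F)\<^sup>*"
proof -
  have "single_valued (climb F)" by (auto simp: single_valued_def climb_def)
  then show ?thesis using single_valued_confluent assms by metis
qed

lemma climb_stuck:
  assumes "(t, x) \<in> (climb F)\<^sup>*" "t \<in> insert r F"
  shows "x = t"
  using assms(1)
proof (cases rule: converse_rtranclE)
  case (step y)
  then show ?thesis using assms(2) by (simp add: climb_def)
qed simp

lemma top_exists: "v \<in> V \<Longrightarrow> \<exists>t. (v, t) \<in> (climb F)\<^sup>* \<and> t \<in> insert r F"
proof (induction "pos v" arbitrary: v rule: less_induct)
  case less
  show ?case
  proof (cases "v \<in> insert r F")
    case False
    then obtain t where "(par v, t) \<in> (climb F)\<^sup>*" "t \<in> insert r F"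
      using less.hyps[of "par v"] less.prems pos par by auto
    moreover have "(v, par v) \<in> climb F" using False less.prems by (auto simp: climb_def)
    ultimately show ?thesis by (meson converse_rtrancl_into_rtrancl)
  qed blast
qed

definition top_of :: "nat set \<Rightarrow> nat \<Rightarrow> nat" where
  "top_of F v = (SOME t. (v, t) \<in> (climb F)\<^sup>* \<and> t \<in> insert r F)"

lemma top_of: assumes "v \<in> V" shows "(v, top_of F v) \<in> (climb F)\<^sup>*" "top_of F v \<in> insert r F"
  using someI_ex[OF top_exists[OF assms, of F]] unfolding top_of_def by auto

lemma top_unique:
  assumes "v \<in> V" "(v, t) \<in> (climb F)\<^sup>*" "t \<in> insert r F"
  shows "top_of F v = t"
  using climb_linear[OF assms(2) top_of(1)[OF assms(1)]]
proof
  assume "(t, top_of F v) \<in> (climb F)\<^sup>*"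
  then show ?thesis using climb_stuck assms(3) by simp
next
  assume "(top_of F v, t) \<in> (climb F)\<^sup>*"
  from climb_stuck[OF this top_of(2)[OF assms(1)]] show ?thesis by simp
qed

lemma top_self: "v \<in> V \<Longrightarrow> v \<in> insert r F \<Longrightarrow> top_of F v = v"
  by (rule top_unique) auto

lemma top_par: "v \<in> V \<Longrightarrow> v \<notin> insert r F \<Longrightarrow> top_of F v = top_of F (par v)"
proof (rule top_unique)
  assume v: "v \<in> V" "v \<notin> insert r F"
  then have "(v, par v) \<in> climb F" by (auto simp: climb_def)
  moreover have "par v \<in> V" using v par by auto
  ultimately show "(v, top_of F (par v)) \<in> (climb F)\<^sup>*" "top_of F (par v) \<in> insert r F"
    using top_of[of "par v" F] by (meson converse_rtrancl_into_rtrancl)+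
qed

lemma top_in: "v \<in> V \<Longrightarrow> top_of F v \<in> V"
  using climb_in[OF top_of(1)] by simp

section \<open>From matchings to cuts\<close>

definition cut_of :: "elem set \<Rightarrow> nat set" where
  "cut_of X = (\<Union>e\<in>{e \<in> X. fst (lft e) = 1 \<and> fst (rgt e) = 2}. {snd (lft e), snd (rgt e)})"

lemma cut_ofI:
  "e \<in> X \<Longrightarrow> fst (lft e) = 1 \<Longrightarrow> fst (rgt e) = 2 \<Longrightarrow> snd (lft e) \<in> cut_of X \<and> snd (rgt e) \<in> cut_of X"
  unfolding cut_of_def by blast

text \<open>The matching has no choice along a climb. At a node entered by the path, the idle
  element would use the right node \<open>(1, y)\<close> a second time, and crossing over would put
  \<open>y\<close> into the cut; so the left node \<open>(1, y)\<close> is matched upwards. Two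
  climbs that meet share the element into the meeting node, and followed back down they
  coincide.\<close>

lemma paths_disjoint:
  assumes X: "X \<subseteq> ground" "inj_on lft X" "inj_on rgt X" and all: "\<And>v. v \<in> V \<Longrightarrow> (1, v) \<in> lft ` X"
    and b: "b \<in> terminals lft X" "b' \<in> terminals lft X"
    and x: "(b, x) \<in> (climb (cut_of X))\<^sup>*" "(b', x) \<in> (climb (cut_of X))\<^sup>*"
  shows "b = b'"
proof -
  let ?R = "climb (cut_of X)"
  have enter: "((0, b), (1, b), 0) \<in> X \<and> b \<in> V" if b: "b \<in> terminals lft X" for b
  proof -
    obtain e where e: "e \<in> X" "lft e = (0, b)" using b unfolding terminals_def by auto
    then have "e \<in> ground" using X by blast
    then show ?thesis using e by (cases rule: ground.cases) auto
  qed
  have climb: "((1, y), (1, z), 0) \<in> X"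
    if "b \<in> terminals lft X" "(b, y) \<in> ?R\<^sup>*" "(y, z) \<in> ?R" for b y z
    using that(2,3)
  proof (induction arbitrary: z rule: rtrancl_induct)
    case base
    have y: "b \<in> V" "b \<noteq> r" "b \<notin> cut_of X" "z = par b" using base by (auto simp: climb_def)
    obtain e where e: "e \<in> X" "lft e = (1, b)" using all[OF y(1)] by auto
    have "rgt e \<noteq> (1, b)"
    proof
      assume "rgt e = (1, b)"
      then have "e = ((0, b), (1, b), 0)"
        using inj_onD[OF X(3) _ e(1), of "((0, b), (1, b), 0)"] enter[OF that(1)] by simp
      then show False using e by simp
    qed
    note ne = this
    have ne2: "fst (rgt e) \<noteq> 2" using y(3) e cut_ofI[OF e(1)] by auto
    have "e \<in> ground" using e X by blast
    then show ?case using e y(4) ne ne2 by (cases rule: ground.cases) auto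
  next
    case (step x y)
    have y: "y \<in> V" "y \<noteq> r" "y \<notin> cut_of X" "z = par y" using step.prems by (auto simp: climb_def)
    have x: "((1, x), (1, y), 0) \<in> X" using step.IH[OF step.hyps(2)] .
    have "x \<noteq> y" using step.hyps(2) pos by (force simp: climb_def)
    obtain e where e: "e \<in> X" "lft e = (1, y)" using all[OF y(1)] by auto
    have "rgt e \<noteq> (1, y)"
    proof
      assume "rgt e = (1, y)"
      then have "e = ((1, x), (1, y), 0)"
        using inj_onD[OF X(3) _ e(1), of "((1, x), (1, y), 0)"] x by simp
      then show False using e \<open>x \<noteq> y\<close> by simp
    qed
    note ne = this
    have ne2: "fst (rgt e) \<noteq> 2" using y(3) e cut_ofI[OF e(1)] by auto
    have "e \<in> ground" using e X by blast
    then show ?case using e y(4) ne ne2 by (cases rule: ground.cases) auto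
  qed
  show ?thesis using x b
  proof (induction arbitrary: b' rule: rtrancl_induct)
    case base
    from base(1) show ?case
    proof (cases rule: rtranclE)
      case (step y)
      then have "((1, y), (1, b), 0) \<in> X" using climb[OF base(3)] by blast
      then show ?thesis using inj_onD[OF X(3)] enter[OF base(2)] by fastforce
    qed simp
  next
    case (step y z)
    have yz: "((1, y), (1, z), 0) \<in> X" using climb[OF step.prems(2) step.hyps] .
    from step.prems(1) show ?case
    proof (cases rule: rtranclE)
      case base
      then show ?thesis using inj_onD[OF X(3) _ yz] enter[OF step.prems(3)] by fastforce
    next
      case (step y')
      then have "((1, y'), (1, z), 0) \<in> X" using climb[OF \<open>b' \<in> terminals lft X\<close>] by blast
      then have "y' = y" using inj_onD[OF X(3) _ _ yz] by fastforce
      then show ?thesis using step.IH step step.prems by blast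
    qed
  qed
qed

lemma mirror_side:
  assumes "X \<in> side_indep ground f I" "\<And>e. g (mirror e) = swap_node (f e)"
  shows "mirror ` X \<in> side_indep ground g I" "terminals g (mirror ` X) = terminals f X"
proof -
  have sw: "swap_node n = (0, v) \<longleftrightarrow> n = (0, v)" for n v
    by (cases n) (auto simp: swap_node_def)
  have "(0, v) \<in> g ` mirror ` X \<longleftrightarrow> (0, v) \<in> f ` X" for v
    using sw[of "f _" v] by (auto simp: image_image assms(2) image_iff) metis+
  then show trm: "terminals g (mirror ` X) = terminals f X" unfolding terminals_def by blast
  have "inj_on f X" "X \<subseteq> ground" "terminals f X \<in> I" using assms(1) unfolding side_indep_def by auto
  moreover have "inj_on g (mirror ` X)"
  proof (rule inj_onI)
    fix a b assume ab: "a \<in> mirror ` X" "b \<in> mirror ` X" "g a = g b"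
    then obtain a' b' where a': "a = mirror a'" "b = mirror b'" "a' \<in> X" "b' \<in> X" by blast
    then have "f a' = f b'" using ab(3) by (metis assms(2) swap_node_swap_node)
    then show "a = b" using a' \<open>inj_on f X\<close> by (auto dest: inj_onD)
  qed
  ultimately show "mirror ` X \<in> side_indep ground g I"
    using mirror_ground trm unfolding side_indep_def by auto
qed

lemma cut_of_mirror: "cut_of (mirror ` X) = cut_of X"
proof -
  have "cut_of X \<subseteq> cut_of (mirror ` X)" for X
  proof
    fix x assume "x \<in> cut_of X"
    then obtain e where e: "e \<in> X" "fst (lft e) = 1" "fst (rgt e) = 2" "x = snd (lft e) \<or> x = snd (rgt e)"
      unfolding cut_of_def by auto
    have m: "fst (lft (mirror e)) = 1" "fst (rgt (mirror e)) = 2"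
      "snd (lft (mirror e)) = snd (rgt e)" "snd (rgt (mirror e)) = snd (lft e)"
      using e by (simp_all add: mirror_def swap_node_def)
    have "mirror e \<in> mirror ` X" using e(1) by blast
    from cut_ofI[OF this m(1,2)] show "x \<in> cut_of (mirror ` X)" using e(4) m by metis
  qed
  from this[of X] this[of "mirror ` X"] show ?thesis by (simp add: image_image)
qed

lemma finite_ground: "finite ground"
proof (rule finite_subset)
  let ?N = "{0, 1, 2 :: nat} \<times> V" and ?C = "insert 0 ((\<lambda>(u, v). cross_cost u v) ` (V \<times> V))"
  show "ground \<subseteq> ?N \<times> ?N \<times> ?C"
    by (rule subsetI, erule ground.cases) (auto simp: par)
  show "finite (?N \<times> ?N \<times> ?C)" using finite_V by simp
qed

lemma matching_nodes:
  assumes M: "matroid V I" and X: "X \<in> side_indep ground lft I"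
  shows "lft ` X \<subseteq> Pair 0 ` terminals lft X \<union> (Pair 1 ` V \<union> Pair 2 ` V)"
    and "finite (Pair 0 ` terminals lft X \<union> (Pair 1 ` V \<union> Pair 2 ` V) :: node set)"
    and "card (Pair 0 ` terminals lft X \<union> (Pair 1 ` V \<union> Pair 2 ` V) :: node set) =
      card (terminals lft X) + 2 * card V"
proof -
  let ?T = "terminals lft X"
  let ?N = "Pair 0 ` ?T \<union> (Pair 1 ` V \<union> Pair 2 ` V) :: node set"
  have T: "?T \<in> I" and sub: "X \<subseteq> ground" using X unfolding side_indep_def by auto
  have fT: "finite ?T" using matroid_finite[OF M T] .
  show "lft ` X \<subseteq> ?N"
  proof
    fix n assume "n \<in> lft ` X"
    then obtain e where e: "e \<in> X" "n = lft e" by blast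
    then have "e \<in> ground" using sub by blast
    then show "n \<in> ?N"
      using e by (cases rule: ground.cases) (auto simp: terminals_def par image_iff, force)
  qed
  show "finite ?N" using fT finite_V by simp
  have "card (Pair 1 ` V \<union> Pair 2 ` V :: node set) = card V + card V"
    using finite_V by (subst card_Un_disjoint) (auto simp: card_image inj_on_def)
  moreover have "card ?N = card ?T + card (Pair 1 ` V \<union> Pair 2 ` V :: node set)"
    using fT finite_V by (subst card_Un_disjoint) (auto simp: card_image inj_on_def)
  ultimately show "card ?N = card ?T + 2 * card V" by simp
qed

lemma matching_card_le:
  assumes M: "matroid V I" and X: "X \<in> side_indep ground lft I"
  shows "card X \<le> 2 * card V + matroid_rank I"
proof -
  have inj: "inj_on lft X" and T: "terminals lft X \<in> I" using X unfolding side_indep_def by auto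
  show ?thesis
    using card_mono[OF matching_nodes(2)[OF M X] matching_nodes(1)[OF M X]] card_image[OF inj]
      matching_nodes(3)[OF M X] matroid_rank_ge[OF M T] by simp
qed

text \<open>The upper bound on the number of left nodes is attained, so none of them is missing; in
  particular the independent set of terminals has full rank.\<close>

lemma full_matching:
  assumes M: "matroid V I" and k: "matroid_rank I = k"
    and X: "X \<in> side_indep ground lft I" "card X = 2 * card V + k"
  shows "terminals lft X \<in> bases I" "\<And>v. v \<in> V \<Longrightarrow> (1, v) \<in> lft ` X"
proof -
  let ?T = "terminals lft X"
  let ?N = "Pair 0 ` ?T \<union> (Pair 1 ` V \<union> Pair 2 ` V) :: node set"
  have T: "?T \<in> I" and inj: "inj_on lft X" using X unfolding side_indep_def by auto
  note nodes = matching_nodes[OF M X(1)]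
  have le: "card ?T \<le> k" using matroid_rank_ge[OF M T] k by simp
  have "card (lft ` X) = 2 * card V + k" using card_image[OF inj] X(2) by simp
  then have eq: "lft ` X = ?N" "card ?T = k"
    using card_seteq[OF nodes(2,1)] card_mono[OF nodes(2,1)] nodes(3) le by auto
  show "?T \<in> bases I" using bases_iff[OF M] T eq(2) k by simp
  show "(1, v) \<in> lft ` X" if "v \<in> V" for v using that unfolding eq(1) by auto
qed

text \<open>Distinct terminals have distinct tops because their climbs are disjoint; the second side
  follows by \<open>mirror\<close>. The costs dominate the cuts since every crossing pays for the
  edges above both of its ends, while a cut shared by several crossings counts only once in
  \<open>cut_of X\<close>.\<close>

theorem matching_separates:
  assumes M: "matroid V I1" "matroid V I2" and k: "matroid_rank I1 = k" "matroid_rank I2 = k"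
    and X: "X \<in> side_indep ground lft I1" "X \<in> side_indep ground rgt I2" "card X = 2 * card V + k"
  shows "terminals lft X \<in> bases I1" "terminals rgt X \<in> bases I2"
    and "inj_on (top_of (cut_of X)) (terminals lft X)" "inj_on (top_of (cut_of X)) (terminals rgt X)"
    and "sum \<omega> (cut_of X) \<le> sum cost X" "cut_of X \<subseteq> V"
proof -
  have inj_top: "inj_on (top_of (cut_of X)) (terminals lft X)"
    if "X \<in> side_indep ground lft I" "inj_on rgt X" "matroid V I" "matroid_rank I = k"
      "card X = 2 * card V + k" for X I
  proof (rule inj_onI)
    fix b b' assume b: "b \<in> terminals lft X" "b' \<in> terminals lft X"
      "top_of (cut_of X) b = top_of (cut_of X) b'"
    have X: "X \<subseteq> ground" "inj_on lft X" "terminals lft X \<subseteq> V"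
      using that(1,3) matroid_carrier unfolding side_indep_def by blast+
    show "b = b'"
      using paths_disjoint[OF X(1,2) that(2) full_matching(2)[OF that(3,4,1,5)] b(1,2)]
        top_of(1)[of b "cut_of X"] top_of(1)[of b' "cut_of X"] b X(3) by (metis subsetD)
  qed
  have inj: "inj_on lft X" "inj_on rgt X" and sub: "X \<subseteq> ground" using X unfolding side_indep_def by auto
  note mir = mirror_side[OF X(2), of lft, OF mirror_lft]
  have mc: "card (mirror ` X) = 2 * card V + k" using card_image[OF inj_mirror[of X]] X(3) by simp
  have minj: "inj_on rgt (mirror ` X)"
    using mirror_side(1)[OF X(1), of rgt, OF mirror_rgt] unfolding side_indep_def by blast
  show "terminals lft X \<in> bases I1" using full_matching(1)[OF M(1) k(1) X(1,3)] .
  show "terminals rgt X \<in> bases I2" using full_matching(1)[OF M(2) k(2) mir(1) mc] unfolding mir(2) .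
  show "inj_on (top_of (cut_of X)) (terminals lft X)" using inj_top[OF X(1) inj(2) M(1) k(1) X(3)] .
  show "inj_on (top_of (cut_of X)) (terminals rgt X)"
    using inj_top[OF mir(1) minj M(2) k(2) mc] unfolding mir(2) cut_of_mirror .
  let ?C = "{e \<in> X. fst (lft e) = 1 \<and> fst (rgt e) = 2}"
  have C: "snd (lft e) \<in> V \<and> snd (rgt e) \<in> V \<and> cost e = sum \<omega> {snd (lft e), snd (rgt e)}" if "e \<in> ?C" for e
  proof -
    have "e \<in> ground" using that sub by blast
    then show ?thesis using that by (cases rule: ground.cases) (auto simp: cross_cost_sum)
  qed
  have fX: "finite X" using finite_subset[OF sub finite_ground] .
  show "cut_of X \<subseteq> V" using C unfolding cut_of_def by blast
  have "sum \<omega> (cut_of X) \<le> (\<Sum>e\<in>?C. sum \<omega> {snd (lft e), snd (rgt e)})"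
    unfolding cut_of_def using fX C \<omega>_nonneg by (intro sum_UN_le) auto
  also have "\<dots> = sum cost ?C" using C by (intro sum.cong) auto
  also have "\<dots> \<le> sum cost X" using fX cost_nonneg sub by (intro sum_mono2) auto
  finally show "sum \<omega> (cut_of X) \<le> sum cost X" .
qed

text \<open>Double counting over parts and edges: an edge has exactly one end in two of the parts or
  in none, hence the factor 2. Lower ends index the edges injectively because \<open>pos\<close>
  decreases strictly towards the root.\<close>

lemma cut_sum:
  assumes Q: "partition_on V Q"
  shows "(\<Sum>X\<in>Q. cut_weight edges w X) =
    2 * sum \<omega> {v \<in> V - {r}. \<forall>X\<in>Q. v \<in> X \<longrightarrow> par v \<notin> X}"
proof -
  have fQ: "finite Q" using Q finite_V finite_elements by blast
  have inj: "inj_on (\<lambda>v. {v, par v}) (V - {r})"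
  proof (rule inj_onI)
    fix u v assume "u \<in> V - {r}" "v \<in> V - {r}" "{u, par u} = {v, par v}"
    then show "u = v" using pos[of u] pos[of v] by (auto simp: doubleton_eq_iff)
  qed
  have fE: "finite edges" unfolding edges_def using finite_V by simp
  let ?D = "{v \<in> V - {r}. \<forall>X\<in>Q. v \<in> X \<longrightarrow> par v \<notin> X}"
  have count: "card {X \<in> Q. card ({v, par v} \<inter> X) = 1} = (if v \<in> ?D then 2 else 0)"
    if v: "v \<in> V - {r}" for v
  proof -
    have ne: "v \<noteq> par v" using pos[of v] v by auto
    have one: "card ({v, par v} \<inter> X) = 1 \<longleftrightarrow> (v \<in> X) \<noteq> (par v \<in> X)" for X
      using ne by (cases "v \<in> X"; cases "par v \<in> X") (auto simp: Int_insert_left)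
    obtain Xv where Xv: "Xv \<in> Q" "v \<in> Xv" using Q v unfolding partition_on_def by blast
    obtain Xp where Xp: "Xp \<in> Q" "par v \<in> Xp" using Q v par[of v] unfolding partition_on_def by blast
    have uv: "X = Xv" if "X \<in> Q" "v \<in> X" for X
      using that Xv Q unfolding partition_on_def disjoint_def by blast
    have up: "X = Xp" if "X \<in> Q" "par v \<in> X" for X
      using that Xp Q unfolding partition_on_def disjoint_def by blast
    show ?thesis
    proof (cases "Xv = Xp")
      case True
      then have "{X \<in> Q. card ({v, par v} \<inter> X) = 1} = {}" using uv up Xv Xp unfolding one by blast
      moreover have "v \<notin> ?D" using True Xv Xp by blast
      ultimately show ?thesis by (metis card.empty)
    next
      case False
      then have "{X \<in> Q. card ({v, par v} \<inter> X) = 1} = {Xv, Xp}" using uv up Xv Xp unfolding one by blast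
      moreover have "v \<in> ?D" using False v uv up by blast
      ultimately show ?thesis using False by (metis card_2_iff)
    qed
  qed
  have "(\<Sum>X\<in>Q. cut_weight edges w X) = (\<Sum>X\<in>Q. \<Sum>e\<in>{e \<in> edges. card (e \<inter> X) = 1}. w e)"
    unfolding cut_weight_def by simp
  also have "\<dots> = (\<Sum>e\<in>edges. \<Sum>X\<in>{X \<in> Q. card (e \<inter> X) = 1}. w e)"
    using sum.swap_restrict[OF fQ fE, of "\<lambda>X e. w e" "\<lambda>X e. card (e \<inter> X) = 1"] by simp
  also have "\<dots> = (\<Sum>v\<in>V - {r}. \<Sum>X\<in>{X \<in> Q. card ({v, par v} \<inter> X) = 1}. w {v, par v})"
    unfolding edges_def using sum.reindex[OF inj] by simp
  also have "\<dots> = (\<Sum>v\<in>V - {r}. if v \<in> ?D then 2 * \<omega> v else 0)"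
  proof (rule sum.cong[OF refl])
    fix v assume v: "v \<in> V - {r}"
    then have "\<omega> v = w {v, par v}" by (simp add: \<omega>_def)
    then show "(\<Sum>X\<in>{X \<in> Q. card ({v, par v} \<inter> X) = 1}. w {v, par v}) = (if v \<in> ?D then 2 * \<omega> v else 0)"
    proof (cases "v \<in> ?D")
      case True
      then show ?thesis using \<open>\<omega> v = w {v, par v}\<close> unfolding sum_constant count[OF v] if_P[OF True] by simp
    next
      case False
      then show ?thesis unfolding sum_constant count[OF v] if_not_P[OF False] by simp
    qed
  qed
  also have "\<dots> = (\<Sum>v\<in>{v \<in> V - {r}. v \<in> ?D}. 2 * \<omega> v)"
    using finite_V by (intro sum.inter_filter[symmetric]) simp
  also have "{v \<in> V - {r}. v \<in> ?D} = ?D" by blast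
  finally show ?thesis by (simp add: sum_distrib_left)
qed

end

section \<open>From cuts to feasible partitions\<close>

lemma card_fibre: "bij_betw h B L \<Longrightarrow> l \<in> L \<Longrightarrow> card {b \<in> B. h b = l} = 1"
proof -
  assume h: "bij_betw h B L" "l \<in> L"
  then obtain b where "b \<in> B" "h b = l" unfolding bij_betw_def by blast
  then have "{b \<in> B. h b = l} = {b}" using h unfolding bij_betw_def inj_on_def by blast
  then show ?thesis by simp
qed

text \<open>Fixing the common elements lets the two path systems share a cut where their tops agree,
  so that it is paid only once.\<close>

lemma bij_fixing_common:
  assumes "finite S" "finite T" "card S = card T"
  obtains \<sigma> where "bij_betw \<sigma> S T" "\<And>x. x \<in> S \<inter> T \<Longrightarrow> \<sigma> x = x"
proof -
  have "card (S - T) = card (T - S)"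
    using assms card_Diff_subset_Int[of S T] card_Diff_subset_Int[of T S] by (metis Int_commute finite_Int)
  then obtain \<tau> where \<tau>: "bij_betw \<tau> (S - T) (T - S)"
    using assms finite_same_card_bij[of "S - T" "T - S"] by auto
  define \<sigma> where "\<sigma> x = (if x \<in> T then x else \<tau> x)" for x
  have "bij_betw \<sigma> (S \<inter> T) (S \<inter> T)" unfolding bij_betw_def inj_on_def \<sigma>_def by auto
  moreover have "bij_betw \<sigma> (S - T) (T - S)"
    using \<tau> bij_betw_cong[of "S - T" \<sigma> \<tau> "T - S"] by (simp add: \<sigma>_def)
  ultimately have "bij_betw \<sigma> (S \<inter> T \<union> (S - T)) (S \<inter> T \<union> (T - S))"
    by (intro bij_betw_combine) auto
  moreover have "S \<inter> T \<union> (S - T) = S" "S \<inter> T \<union> (T - S) = T" by auto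
  ultimately show thesis using that[of \<sigma>] by (simp add: \<sigma>_def)
qed

context rooted_tree begin

text \<open>\<open>g\<close> sends the top of every component to the top of a component with a
  terminal from \<open>B1\<close>. Injectivity on the tops of \<open>B2\<close> leaves one element
  of each basis in every class, and merging components can only remove edges from the cut.\<close>

theorem labelled_partition:
  assumes M: "matroid V I1" "matroid V I2" and k: "matroid_rank I1 = k" "matroid_rank I2 = k"
    and B: "B1 \<in> bases I1" "B2 \<in> bases I2" and F: "F \<subseteq> V"
    and inj: "inj_on (top_of F) B1" "inj_on (top_of F) B2"
    and g: "\<And>t. t \<in> top_of F ` B1 \<Longrightarrow> g t = t" "inj_on g (top_of F ` B2)"
      "\<And>v. v \<in> V \<Longrightarrow> g (top_of F v) \<in> top_of F ` B1"
    and Q: "Q = (\<lambda>l. {v \<in> V. g (top_of F v) = l}) ` top_of F ` B1"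
  shows "dmmc_feasible V k I1 I2 Q" "(\<Sum>X\<in>Q. cut_weight edges w X) \<le> 2 * sum \<omega> F"
proof -
  let ?L = "top_of F ` B1" and ?h = "\<lambda>v. g (top_of F v)"
  let ?P = "\<lambda>l. {v \<in> V. ?h v = l}"
  have BV: "B1 \<subseteq> V" "B2 \<subseteq> V" and cB: "card B1 = k" "card B2 = k"
    using B bases_iff[OF M(1)] bases_iff[OF M(2)] matroid_carrier[OF M(1)] matroid_carrier[OF M(2)] k
    by auto
  have fin: "finite B1" "finite B2" using BV finite_V finite_subset by auto
  have cL: "card ?L = k" using card_image[OF inj(1)] cB by simp
  have L: "l \<in> V" "?h l = l" if l: "l \<in> ?L" for l
  proof -
    obtain b where b: "b \<in> B1" "l = top_of F b" using l by blast
    then show "l \<in> V" using top_in BV by blast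
    then have "top_of F l = l" using top_of(2)[of b F] b BV by (intro top_self) auto
    then show "?h l = l" using g(1)[OF l] by simp
  qed
  have bij1: "bij_betw ?h B1 ?L"
    using inj(1) g(1) unfolding bij_betw_def by (auto simp: inj_on_def)
  have bij2: "bij_betw ?h B2 ?L"
  proof -
    have inj2: "inj_on ?h B2" using comp_inj_on[OF inj(2) g(2)] by (simp add: comp_def)
    moreover have "?h ` B2 \<subseteq> ?L" using g(3) BV by auto
    then have "?h ` B2 = ?L" using card_image[OF inj2] cL cB fin by (intro card_seteq) auto
    ultimately show ?thesis unfolding bij_betw_def by blast
  qed
  have part: "partition_on V Q"
  proof (rule partition_onI)
    show "\<Union> Q = V" unfolding Q using g(3) by auto
    show "disjnt p q" if "p \<in> Q" "q \<in> Q" "p \<noteq> q" for p q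
      using that unfolding Q disjnt_def by auto
    show "{} \<notin> Q" using L unfolding Q by blast
  qed
  moreover have "card Q = k"
  proof -
    have "inj_on ?P ?L"
    proof (rule inj_onI)
      fix l l' assume l: "l \<in> ?L" "l' \<in> ?L" "?P l = ?P l'"
      have "l \<in> ?P l" using L[OF l(1)] by simp
      then have "?h l = l'" unfolding l(3) by simp
      then show "l = l'" using L(2)[OF l(1)] by simp
    qed
    from card_image[OF this] show ?thesis unfolding Q using cL by simp
  qed
  moreover have "card (B1 \<inter> X) = 1 \<and> card (B2 \<inter> X) = 1" if XQ: "X \<in> Q" for X
  proof -
    obtain l where l: "l \<in> ?L" "X = ?P l" using XQ unfolding Q by blast
    have "B1 \<inter> X = {b \<in> B1. ?h b = l}" "B2 \<inter> X = {b \<in> B2. ?h b = l}" using l BV by auto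
    then show ?thesis using card_fibre[OF bij1 l(1)] card_fibre[OF bij2 l(1)] by simp
  qed
  ultimately show "dmmc_feasible V k I1 I2 Q" unfolding dmmc_feasible_def using B by blast
  have "{v \<in> V - {r}. \<forall>X\<in>Q. v \<in> X \<longrightarrow> par v \<notin> X} \<subseteq> F"
  proof
    fix v assume v: "v \<in> {v \<in> V - {r}. \<forall>X\<in>Q. v \<in> X \<longrightarrow> par v \<notin> X}"
    show "v \<in> F"
    proof (rule ccontr)
      assume "v \<notin> F"
      then have "top_of F v = top_of F (par v)" using v by (intro top_par) auto
      then have mem: "v \<in> ?P (?h v)" "par v \<in> ?P (?h v)" using v par[of v] by auto
      have inQ: "?P (?h v) \<in> Q" 
        unfolding Q by (rule image_eqI[OF refl g(3)]) (use v in simp)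
      have sep: "\<forall>X\<in>Q. v \<in> X \<longrightarrow> par v \<notin> X" using v by simp
      from mp[OF bspec[OF sep inQ] mem(1)] mem(2) show False by (rule notE)
    qed
  qed
  then have "sum \<omega> {v \<in> V - {r}. \<forall>X\<in>Q. v \<in> X \<longrightarrow> par v \<notin> X} \<le> sum \<omega> F"
    using F finite_V \<omega>_nonneg finite_subset by (intro sum_mono2) auto
  then show "(\<Sum>X\<in>Q. cut_weight edges w X) \<le> 2 * sum \<omega> F" unfolding cut_sum[OF part] by simp
qed

section \<open>From feasible partitions to matchings\<close>

definition active :: "nat set \<Rightarrow> nat set \<Rightarrow> nat set" where
  "active F B = {x. \<exists>b\<in>B. (b, x) \<in> (climb F)\<^sup>*}"

text \<open>The upward paths of \<open>B\<close>, with idle elements off the paths. The left nodes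
  of the tops stay unmatched; crossings are attached there.\<close>

definition half :: "nat set \<Rightarrow> nat set \<Rightarrow> elem set" where
  "half F B = (\<lambda>b. ((0, b), (1, b), 0)) ` B \<union> (\<lambda>x. ((1, x), (1, x), 0)) ` (V - active F B) \<union>
     (\<lambda>x. ((1, x), (1, par x), 0)) ` (active F B - insert r F)"

text \<open>Right nodes are distinct because distinct terminals climb in disjoint chains: a vertex
  entered from below on a path is no terminal, and two vertices of the paths with the same parent
  lie on one chain, where \<open>pos\<close> forces them to be equal.\<close>

lemma half:
  assumes B: "B \<subseteq> V"
    and disjoint: "\<forall>b\<in>B. \<forall>b'\<in>B. \<forall>x. (b, x) \<in> (climb F)\<^sup>* \<longrightarrow> (b', x) \<in> (climb F)\<^sup>* \<longrightarrow> b = b'"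
  shows "half F B \<subseteq> ground" "inj_on lft (half F B)" "inj_on rgt (half F B)"
    and "lft ` half F B = Pair 0 ` B \<union> Pair 1 ` (V - top_of F ` B)" "rgt ` half F B \<subseteq> Pair 1 ` V"
    and "inj_on (top_of F) B" "card (half F B) = card V" "\<forall>e\<in>half F B. cost e = 0"
proof -
  have uniq: "b = b'" if "b \<in> B" "b' \<in> B" "(b, x) \<in> (climb F)\<^sup>*" "(b', x) \<in> (climb F)\<^sup>*" for b b' x
    using disjoint that by blast
  have act_V: "active F B \<subseteq> V" using climb_in B unfolding active_def by blast
  have B_act: "b \<in> active F B" if "b \<in> B" for b using that unfolding active_def by blast
  have step: "(x, par x) \<in> climb F" if "x \<in> active F B - insert r F" for x
    using that act_V unfolding climb_def by blast
  have par_act: "par x \<in> active F B" if "x \<in> active F B - insert r F" for x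
    using step[OF that] that unfolding active_def by (blast intro: rtrancl_into_rtrancl)
  have par_B: "par x \<notin> B" if x: "x \<in> active F B - insert r F" for x
  proof
    assume pB: "par x \<in> B"
    obtain b where b: "b \<in> B" "(b, x) \<in> (climb F)\<^sup>*" using x unfolding active_def by blast
    then have "(b, par x) \<in> (climb F)\<^sup>*" using step[OF x] by (rule_tac rtrancl_into_rtrancl)
    then have "b = par x" using uniq[OF b(1) pB] by blast
    then have "pos x \<le> pos (par x)" using climb_pos[OF b(2)] by simp
    then show False using pos[of x] x act_V by auto
  qed
  have par_inj: "x = x'" if x: "x \<in> active F B - insert r F" "x' \<in> active F B - insert r F" "par x = par x'" for x x'
  proof -
    have no: "\<not> (y, y') \<in> (climb F)\<^sup>+" if "y' \<in> active F B - insert r F" "par y = par y'" for y y'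
    proof
      assume "(y, y') \<in> (climb F)\<^sup>+"
      then obtain z where "(y, z) \<in> climb F" "(z, y') \<in> (climb F)\<^sup>*" by (meson tranclD)
      then have "pos y' \<le> pos (par y')" using climb_pos that(2) by (auto simp: climb_def)
      then show False using pos[of y'] that(1) act_V by auto
    qed
    obtain b where b: "b \<in> B" "(b, x) \<in> (climb F)\<^sup>*" using x(1) unfolding active_def by blast
    obtain b' where b': "b' \<in> B" "(b', x') \<in> (climb F)\<^sup>*" using x(2) unfolding active_def by blast
    have "b = b'"
      using uniq[OF b(1) b'(1) rtrancl_into_rtrancl[OF b(2) step[OF x(1)]]]
        rtrancl_into_rtrancl[OF b'(2) step[OF x(2)]] x(3) by simp
    then have "(x, x') \<in> (climb F)\<^sup>* \<or> (x', x) \<in> (climb F)\<^sup>*" using climb_linear b(2) b'(2) by blast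
    then show ?thesis using no[of x' x] no[of x x'] x by (metis rtranclD)
  qed
  have tops: "active F B \<inter> insert r F = top_of F ` B"
  proof (intro equalityI subsetI)
    fix x assume x: "x \<in> active F B \<inter> insert r F"
    then obtain b where "b \<in> B" "(b, x) \<in> (climb F)\<^sup>*" unfolding active_def by blast
    then show "x \<in> top_of F ` B" using top_unique[of b x F] x B by blast
  next
    fix x assume "x \<in> top_of F ` B"
    then show "x \<in> active F B \<inter> insert r F" using top_of B unfolding active_def by blast
  qed
  show "half F B \<subseteq> ground" using B act_V unfolding half_def by (auto intro: ground.intros)
  show inj: "inj_on lft (half F B)" unfolding half_def by (auto simp: inj_on_def)
  show "inj_on rgt (half F B)"
  proof (rule inj_onI)
    have cases: "(\<exists>b\<in>B. e = ((0, b), (1, b), 0)) \<or> (\<exists>x. x \<notin> active F B \<and> e = ((1, x), (1, x), 0)) \<or>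
        (\<exists>x\<in>active F B - insert r F. e = ((1, x), (1, par x), 0))" if "e \<in> half F B" for e
      using that unfolding half_def by blast
    fix e e' assume e: "e \<in> half F B" "e' \<in> half F B" "rgt e = rgt e'"
    show "e = e'"
      using cases[OF e(1)] cases[OF e(2)] e(3)
      by (elim disjE bexE exE conjE; simp only: fst_conv snd_conv prod.inject)
        (use B_act par_act par_B par_inj in metis)+
  qed
  show lft: "lft ` half F B = Pair 0 ` B \<union> Pair 1 ` (V - top_of F ` B)"
    unfolding half_def image_Un image_image tops[symmetric] using act_V by auto
  show "rgt ` half F B \<subseteq> Pair 1 ` V"
    unfolding half_def image_Un image_image using act_V B par_act by auto
  show topinj: "inj_on (top_of F) B"
  proof (rule inj_onI)
    fix b b' assume b: "b \<in> B" "b' \<in> B" "top_of F b = top_of F b'"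
    have "(b, top_of F b) \<in> (climb F)\<^sup>*" using top_of(1) b(1) B by blast
    moreover have "(b', top_of F b) \<in> (climb F)\<^sup>*" unfolding b(3) using top_of(1) b(2) B by blast
    ultimately show "b = b'" using uniq b(1,2) by blast
  qed
  show "\<forall>e\<in>half F B. cost e = 0" unfolding half_def by auto
  have fB: "finite B" using B finite_V finite_subset by blast
  have tV: "top_of F ` B \<subseteq> V" using top_in B by auto
  \<comment> \<open>The terminals contribute \<open>card B\<close> left nodes, and their tops take
    as many away.\<close>
  have "card (half F B) = card (lft ` half F B)" using card_image[OF inj] by simp
  also have "\<dots> = card (Pair (0::nat) ` B) + card (Pair (1::nat) ` (V - top_of F ` B))"
    unfolding lft using fB finite_V by (intro card_Un_disjoint) auto
  also have "\<dots> = card B + (card V - card B)"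
    using card_Diff_subset[OF _ tV] fB card_image[OF topinj] by (simp add: card_image inj_on_def)
  also have "\<dots> = card V" using card_mono[OF finite_V B] by simp
  finally show "card (half F B) = card V" .
qed

text \<open>Climbs avoid the edges between parts, so each stays within its part, where either basis
  has a single element; hence the climbs of a basis are disjoint. The upward half for
  \<open>B1\<close> and the mirrored half for \<open>B2\<close> are joined by crossings between
  their tops.\<close>

theorem matching_of_partition:
  assumes M: "matroid V I1" "matroid V I2" and k: "matroid_rank I1 = k" "matroid_rank I2 = k"
    and Q: "dmmc_feasible V k I1 I2 Q"
  shows "\<exists>J. J \<in> side_indep ground lft I1 \<and> J \<in> side_indep ground rgt I2 \<and>
    card J = 2 * card V + k \<and> 2 * sum cost J \<le> (\<Sum>X\<in>Q. cut_weight edges w X)"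
proof -
  obtain B1 B2 where B: "B1 \<in> bases I1" "B2 \<in> bases I2"
    and one: "\<And>X. X \<in> Q \<Longrightarrow> card (B1 \<inter> X) = 1" "\<And>X. X \<in> Q \<Longrightarrow> card (B2 \<inter> X) = 1"
    and part: "partition_on V Q"
    using Q unfolding dmmc_feasible_def by blast
  define F where "F = {v \<in> V - {r}. \<forall>X\<in>Q. v \<in> X \<longrightarrow> par v \<notin> X}"
  have BI: "B1 \<in> I1" "B2 \<in> I2" and cB: "card B1 = k" "card B2 = k"
    using B bases_iff[OF M(1)] bases_iff[OF M(2)] k by auto
  have BV: "B1 \<subseteq> V" "B2 \<subseteq> V" using BI matroid_carrier[OF M(1)] matroid_carrier[OF M(2)] by auto
  have same: "x \<in> X" if "(b, x) \<in> (climb F)\<^sup>*" "X \<in> Q" "b \<in> X" for b x X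
    using that
  proof (induction rule: rtrancl_induct)
    case (step y z)
    then have "y \<in> X" "y \<in> V - {r}" "y \<notin> F" "z = par y" by (auto simp: climb_def)
    then obtain Y where "Y \<in> Q" "y \<in> Y" "par y \<in> Y" unfolding F_def by blast
    moreover from this have "Y = X"
      using part \<open>X \<in> Q\<close> \<open>y \<in> X\<close> unfolding partition_on_def disjoint_def by blast
    ultimately show ?case using \<open>z = par y\<close> by simp
  qed simp
  have uniq: "b = b'" if b: "b \<in> B" "b' \<in> B" "(b, x) \<in> (climb F)\<^sup>*" "(b', x) \<in> (climb F)\<^sup>*"
    and BX: "B \<subseteq> V" "\<forall>X\<in>Q. card (B \<inter> X) = 1" for B b b' x
  proof -
    obtain X where X: "X \<in> Q" "b \<in> X" using b(1) BX(1) part unfolding partition_on_def by blast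
    obtain Y where Y: "Y \<in> Q" "b' \<in> Y" using b(2) BX(1) part unfolding partition_on_def by blast
    have "x \<in> X" "x \<in> Y" using same[OF b(3) X] same[OF b(4) Y] by auto
    then have "Y = X" using part X Y unfolding partition_on_def disjoint_def by blast
    moreover obtain z where "B \<inter> X = {z}" using BX(2) X(1) card_1_singletonE by metis
    ultimately show ?thesis using b(1,2) X(2) Y(2) by (metis IntI singletonD)
  qed
  have uniq1: "\<forall>b\<in>B1. \<forall>b'\<in>B1. \<forall>x. (b, x) \<in> (climb F)\<^sup>* \<longrightarrow> (b', x) \<in> (climb F)\<^sup>* \<longrightarrow> b = b'"
    using uniq BV(1) one(1) by blast
  have uniq2: "\<forall>b\<in>B2. \<forall>b'\<in>B2. \<forall>x. (b, x) \<in> (climb F)\<^sup>* \<longrightarrow> (b', x) \<in> (climb F)\<^sup>* \<longrightarrow> b = b'"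
    using uniq BV(2) one(2) by blast
  define S1 S2 where "S1 = top_of F ` B1" and "S2 = top_of F ` B2"
  define H1 H2 where "H1 = half F B1" and "H2 = mirror ` half F B2"
  note h1 = half[OF BV(1) uniq1, folded H1_def S1_def] and h2 = half[OF BV(2) uniq2, folded S2_def]
  have m2: "H2 \<subseteq> ground" "inj_on lft H2" "inj_on rgt H2"
    "rgt ` H2 = Pair 0 ` B2 \<union> Pair 2 ` (V - S2)" "lft ` H2 \<subseteq> Pair 2 ` V"
    "card H2 = card V" "\<And>e. e \<in> H2 \<Longrightarrow> cost e = 0"
  proof -
    have sw: "swap_node (0, v) = (0, v)" "swap_node (1, v) = (2, v)" for v by (auto simp: swap_node_def)
    show "H2 \<subseteq> ground" using h2(1) mirror_ground unfolding H2_def by blast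
    show "inj_on lft H2"
      using h2(3) unfolding H2_def
      by (auto simp: inj_on_def mirror_lft dest: inj_onD[OF inj_swap_node[of UNIV]])
    show "inj_on rgt H2"
      using h2(2) unfolding H2_def
      by (auto simp: inj_on_def mirror_rgt dest: inj_onD[OF inj_swap_node[of UNIV]])
    have "rgt ` H2 = swap_node ` lft ` half F B2" unfolding H2_def image_image mirror_rgt ..
    then show "rgt ` H2 = Pair 0 ` B2 \<union> Pair 2 ` (V - S2)"
      unfolding h2(4) image_Un image_image sw .
    have "lft ` H2 = swap_node ` rgt ` half F B2" unfolding H2_def image_image mirror_lft ..
    also have "\<dots> \<subseteq> swap_node ` Pair 1 ` V" using h2(5) by (rule image_mono)
    finally show "lft ` H2 \<subseteq> Pair 2 ` V" unfolding image_image sw .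
    show "card H2 = card V" unfolding H2_def using card_image[OF inj_mirror] h2(7) by metis
    show "cost e = 0" if "e \<in> H2" for e using that h2(8) unfolding H2_def mirror_def by auto
  qed
  have fin: "finite B1" "finite B2" using BV finite_V finite_subset by auto
  have S: "finite S1" "finite S2" "card S1 = k" "card S2 = k" "S1 \<subseteq> V" "S2 \<subseteq> V"
    unfolding S1_def S2_def
    using fin card_image[OF h1(6)] card_image[OF h2(6)] cB top_in BV by auto
  have S_top: "S1 \<subseteq> insert r F" "S2 \<subseteq> insert r F" unfolding S1_def S2_def using top_of(2) BV by blast+
  obtain \<sigma> where \<sigma>: "bij_betw \<sigma> S1 S2" "\<And>x. x \<in> S1 \<inter> S2 \<Longrightarrow> \<sigma> x = x"
    using bij_fixing_common[OF S(1,2)] S(3,4) by metis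
  define C where "C = (\<lambda>u. ((1::nat, u), (2::nat, \<sigma> u), cross_cost u (\<sigma> u))) ` S1"
  have c: "C \<subseteq> ground" "inj_on lft C" "inj_on rgt C" "lft ` C = Pair 1 ` S1" "rgt ` C = Pair 2 ` S2" "card C = k"
  proof -
    have \<sigma>S: "\<sigma> ` S1 = S2" "inj_on \<sigma> S1" using \<sigma>(1) unfolding bij_betw_def by auto
    show "C \<subseteq> ground"
    proof
      fix e assume "e \<in> C"
      then obtain u where "u \<in> S1" "e = ((1, u), (2, \<sigma> u), cross_cost u (\<sigma> u))" unfolding C_def by blast
      then show "e \<in> ground" using S(5,6) \<sigma>S(1) by (intro ground.cross) auto
    qed
    show "inj_on lft C" "inj_on rgt C" unfolding C_def inj_on_def
      using inj_onD[OF \<sigma>S(2)] by auto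
    show "lft ` C = Pair 1 ` S1" unfolding C_def image_image by simp
    show "rgt ` C = Pair 2 ` S2" unfolding C_def image_image \<sigma>S(1)[symmetric] by simp
    show "card C = k" unfolding C_def using S(3) by (subst card_image) (auto simp: inj_on_def)
  qed
  define J where "J = H1 \<union> (C \<union> H2)"
  have kinds1: "fst (rgt e) = 1" if "e \<in> H1" for e using h1(5) that by fastforce
  have kindsC: "fst (lft e) = 1" "fst (rgt e) = 2" if "e \<in> C" for e using that unfolding C_def by auto
  have kinds2: "fst (lft e) = 2" if "e \<in> H2" for e using m2(5) that by fastforce
  have kinds2r: "fst (rgt e) \<noteq> 1" if "e \<in> H2" for e
  proof -
    have "rgt e \<in> Pair 0 ` B2 \<union> Pair 2 ` (V - S2)" using m2(4) that by blast
    then show ?thesis by auto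
  qed
  have disj: "H1 \<inter> (C \<union> H2) = {}" "C \<inter> H2 = {}"
    using kinds1 kindsC kinds2 kinds2r by fastforce+
  have "inj_on lft J"
  proof -
    have "lft ` C \<inter> lft ` H2 = {}" "lft ` H1 \<inter> (lft ` C \<union> lft ` H2) = {}"
      using m2(5) unfolding c(4) h1(4) by auto
    then show ?thesis using h1(2) c(2) m2(2) unfolding J_def inj_on_Un image_Un by blast
  qed
  moreover have "inj_on rgt J"
  proof -
    have "rgt ` C \<inter> rgt ` H2 = {}" "rgt ` H1 \<inter> (rgt ` C \<union> rgt ` H2) = {}"
      using h1(5) unfolding c(5) m2(4) by auto
    then show ?thesis using h1(3) c(3) m2(3) unfolding J_def inj_on_Un image_Un by blast
  qed
  moreover have "terminals lft J = B1"
    using m2(5) unfolding terminals_def J_def image_Un c(4) h1(4) by auto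
  moreover have "terminals rgt J = B2"
    using h1(5) unfolding terminals_def J_def image_Un c(5) m2(4) by auto
  moreover have "J \<subseteq> ground" using h1(1) c(1) m2(1) unfolding J_def by blast
  ultimately have JI: "J \<in> side_indep ground lft I1" "J \<in> side_indep ground rgt I2"
    using BI unfolding side_indep_def by auto
  have finJ: "finite H1" "finite C" "finite H2"
    using finite_subset[OF _ finite_ground] h1(1) c(1) m2(1) by auto
  have "card J = card V + (k + card V)"
    unfolding J_def using finJ disj h1(7) c(6) m2(6) by (simp add: card_Un_disjoint)
  then have cJ: "card J = 2 * card V + k" by simp
  have "sum cost J = sum cost H1 + (sum cost C + sum cost H2)"
    unfolding J_def using finJ disj by (simp add: sum.union_disjoint)
  also have "\<dots> = sum cost C" using h1(8) m2(7) by simp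
  also have "\<dots> = (\<Sum>u\<in>S1. sum \<omega> {u, \<sigma> u})"
    unfolding C_def by (subst sum.reindex) (auto simp: inj_on_def cross_cost_sum simp del: sum.insert)
  also have "\<dots> = sum \<omega> (\<Union>u\<in>S1. {u, \<sigma> u})"
  proof (rule sum.UNION_disjoint[symmetric])
    \<comment> \<open>If \<open>u = \<sigma> v\<close>, then \<open>u\<close> is a common top, so
      \<open>\<sigma> u = u = \<sigma> v\<close> and \<open>u = v\<close>. Thus no cut is paid for
      by two crossings.\<close>
    show "\<forall>u\<in>S1. \<forall>v\<in>S1. u \<noteq> v \<longrightarrow> {u, \<sigma> u} \<inter> {v, \<sigma> v} = {}"
    proof (intro ballI impI)
      fix u v assume uv: "u \<in> S1" "v \<in> S1" "u \<noteq> v"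
      have inj: "\<sigma> u \<noteq> \<sigma> v" using \<sigma>(1) uv unfolding bij_betw_def inj_on_def by blast
      have "\<sigma> u \<in> S2" "\<sigma> v \<in> S2" using \<sigma>(1) uv unfolding bij_betw_def by auto
      then have "u \<noteq> \<sigma> v" "v \<noteq> \<sigma> u" using \<sigma>(2) uv inj by auto
      then show "{u, \<sigma> u} \<inter> {v, \<sigma> v} = {}" using uv inj by auto
    qed
  qed (use S in auto)
  also have "\<dots> \<le> sum \<omega> (insert r F)"
  proof (rule sum_mono2)
    show "finite (insert r F)" unfolding F_def using finite_V by simp
    show "(\<Union>u\<in>S1. {u, \<sigma> u}) \<subseteq> insert r F" using S_top \<sigma>(1) unfolding bij_betw_def by blast
    show "0 \<le> \<omega> b" if "b \<in> insert r F - (\<Union>u\<in>S1. {u, \<sigma> u})" for b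
      using that \<omega>_nonneg root unfolding F_def by blast
  qed
  also have "\<dots> = sum \<omega> F" unfolding F_def using finite_V by (simp add: \<omega>_def)
  finally have "2 * sum cost J \<le> (\<Sum>X\<in>Q. cut_weight edges w X)"
    unfolding cut_sum[OF part] F_def by simp
  then show ?thesis using JI cJ by blast
qed

end

section \<open>Rooting the tree\<close>

type_synonym entry = "nat \<times> nat \<times> real"

text \<open>An entry consists of a vertex, its parent and the weight of the edge between them. New
  entries go to the front, so the entry of the parent always stands further back.\<close>

definition grow_edge :: "entry \<Rightarrow> entry list \<Rightarrow> entry list" where
  "grow_edge e ts = (case e of (u, v, x) \<Rightarrow>
     if u \<in> fst ` set ts then (if v \<in> fst ` set ts then ts else (v, u, x) # ts)
     else if v \<in> fst ` set ts then (u, v, x) # ts else ts)"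

definition grow_tree :: "nat list \<Rightarrow> entry list \<Rightarrow> entry list" where
  "grow_tree vs es = fold (\<lambda>_ ts. fold grow_edge es ts) vs [(hd vs, hd vs, 0)]"

text \<open>Covers all orders of attaching edges, so that the order in which the program meets them
  does not enter the proofs.\<close>

inductive grown :: "nat set set \<Rightarrow> (nat set \<Rightarrow> real) \<Rightarrow> nat \<Rightarrow> entry list \<Rightarrow> bool" for E w r where
  "grown E w r [(r, r, 0)]"
| "grown E w r ts \<Longrightarrow> p \<in> fst ` set ts \<Longrightarrow> v \<notin> fst ` set ts \<Longrightarrow> {v, p} \<in> E \<Longrightarrow>
    grown E w r ((v, p, w {v, p}) # ts)"

lemma grown_edge:
  assumes "grown E w r ts" and "{u, v} \<in> E"
  shows "grown E w r (grow_edge (u, v, w {u, v}) ts)"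
  using assms grown.intros(2)[of E w r ts u v] grown.intros(2)[of E w r ts v u]
  by (auto simp: grow_edge_def insert_commute)

lemma grown_fold:
  assumes "grown E w r ts" and "\<forall>e\<in>set es. \<exists>u v. e = (u, v, w {u, v}) \<and> {u, v} \<in> E"
  shows "grown E w r (fold grow_edge es ts)"
  using assms
proof (induction es arbitrary: ts)
  case (Cons e es)
  then show ?case using grown_edge[of E w r ts] by force
qed simp

lemma grown_distinct: "grown E w r ts \<Longrightarrow> distinct (map fst ts)"
  by (induction rule: grown.induct) auto

lemma grown_root: "grown E w r ts \<Longrightarrow> (r, r, 0) \<in> set ts"
  by (induction rule: grown.induct) auto

lemma grown_entry:
  "grown E w r ts \<Longrightarrow> (v, p, x) \<in> set ts \<Longrightarrow>
    p \<in> fst ` set ts \<and> (v = r \<longrightarrow> p = r \<and> x = 0) \<and> (v \<noteq> r \<longrightarrow> {v, p} \<in> E \<and> x = w {v, p})"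
proof (induction rule: grown.induct)
  case (2 ts p' v')
  have "r \<in> fst ` set ts" using imageI[OF grown_root[OF 2(1)], of fst] by simp
  then have "v' \<noteq> r" using 2(3) by blast
  from 2(6) consider "v = v'" "p = p'" "x = w {v', p'}" | "(v, p, x) \<in> set ts" by auto
  then show ?case
  proof cases
    case 1
    then show ?thesis using \<open>v' \<noteq> r\<close> 2(2,4) by simp
  next
    case 2
    then show ?thesis using "2.IH" by simp
  qed
qed simp

text \<open>The new vertex is ranked just above its parent; being fresh, it is neither a vertex nor
  a parent in an earlier entry.\<close>

lemma grown_order:
  "grown E w r ts \<Longrightarrow> \<exists>pos :: nat \<Rightarrow> nat. \<forall>(v, p, x)\<in>set ts. v \<noteq> r \<longrightarrow> pos p < pos v"
proof (induction rule: grown.induct)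
  case (2 ts p v)
  then obtain pos :: "nat \<Rightarrow> nat" where pos: "\<forall>(v, p, x)\<in>set ts. v \<noteq> r \<longrightarrow> pos p < pos v" by blast
  have "\<forall>(v', p', x)\<in>set ((v, p, w {v, p}) # ts). v' \<noteq> r \<longrightarrow>
      (pos(v := Suc (pos p))) p' < (pos(v := Suc (pos p))) v'"
  proof (clarify, goal_cases)
    case (1 v' p' x)
    show ?case
    proof (cases "(v', p', x) \<in> set ts")
      case True
      then have "v' \<noteq> v" "p' \<noteq> v"
        using 2(3) grown_entry[OF 2(1) True] by (metis fst_conv image_eqI)+
      then show ?thesis using pos True 1(2) by auto
    next
      case False
      then have "v' = v" "p' = p" using 1 by auto
      moreover have "p \<noteq> v" using 2(2,3) by blast
      ultimately show ?thesis by simp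
    qed
  qed
  then show ?case by blast
qed simp

definition tree_edges :: "nat \<Rightarrow> entry list \<Rightarrow> nat set set" where
  "tree_edges r ts = {{v, p} | v p x. (v, p, x) \<in> set ts \<and> v \<noteq> r}"

text \<open>Serves to find a cycle: an edge of \<open>E\<close> outside the grown tree would close
  the simple path between its ends.\<close>

lemma grown_path:
  "grown E w r ts \<Longrightarrow> a \<in> fst ` set ts \<Longrightarrow> b \<in> fst ` set ts \<Longrightarrow>
    \<exists>c. c \<noteq> [] \<and> distinct c \<and> hd c = a \<and> last c = b \<and> set c \<subseteq> fst ` set ts \<and>
      successively (\<lambda>x y. {x, y} \<in> tree_edges r ts) c"
proof (induction arbitrary: a b rule: grown.induct)
  case 1
  then show ?case by (intro exI[of _ "[r]"]) auto
next
  case (2 ts p v)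
  let ?ts = "(v, p, w {v, p}) # ts"
  have "v \<noteq> r" using 2(3) grown_root[OF 2(1)] by force
  have sub: "tree_edges r ts \<subseteq> tree_edges r ?ts" unfolding tree_edges_def by auto
  have new: "{v, p} \<in> tree_edges r ?ts" unfolding tree_edges_def using \<open>v \<noteq> r\<close> by auto
  have old: "\<exists>c. c \<noteq> [] \<and> distinct c \<and> hd c = a \<and> last c = b \<and> set c \<subseteq> fst ` set ts \<and>
      successively (\<lambda>x y. {x, y} \<in> tree_edges r ?ts) c" if ab: "a \<in> fst ` set ts" "b \<in> fst ` set ts" for a b
  proof -
    obtain c where c: "c \<noteq> [] \<and> distinct c \<and> hd c = a \<and> last c = b \<and> set c \<subseteq> fst ` set ts"
      "successively (\<lambda>x y. {x, y} \<in> tree_edges r ts) c" using "2.IH"[OF ab] by blast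
    have "successively (\<lambda>x y. {x, y} \<in> tree_edges r ?ts) c"
      using sub by (intro successively_mono[OF c(2)]) blast
    then show ?thesis using c(1) by blast
  qed
  have fs: "fst ` set ?ts = insert v (fst ` set ts)" by simp
  from "2.prems" consider (new_new) "a = v" "b = v" | (new_old) "a = v" "b \<in> fst ` set ts"
    | (old_new) "a \<in> fst ` set ts" "b = v" | (old_old) "a \<in> fst ` set ts" "b \<in> fst ` set ts"
    unfolding fs by blast
  then show ?case
  proof cases
    case new_new
    then show ?thesis by (intro exI[of _ "[v]"]) auto
  next
    case new_old
    obtain c where c: "c \<noteq> []" "distinct c" "hd c = p" "last c = b" "set c \<subseteq> fst ` set ts"
      "successively (\<lambda>x y. {x, y} \<in> tree_edges r ?ts) c" using old[OF 2(2) new_old(2)] by blast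
    have "v \<notin> set c" using c(5) 2(3) by blast
    then show ?thesis using c new_old(1) new unfolding fs
      by (intro exI[of _ "v # c"]) (auto simp: successively_Cons)
  next
    case old_new
    obtain c where c: "c \<noteq> []" "distinct c" "hd c = a" "last c = p" "set c \<subseteq> fst ` set ts"
      "successively (\<lambda>x y. {x, y} \<in> tree_edges r ?ts) c" using old[OF old_new(1) 2(2)] by blast
    have "v \<notin> set c" using c(5) 2(3) by blast
    then show ?thesis using c old_new(2) new unfolding fs
      by (intro exI[of _ "c @ [v]"]) (auto simp: successively_append_iff insert_commute)
  next
    case old_old
    then show ?thesis using old[OF old_old] unfolding fs by blast
  qed
qed

lemma grown_edges:
  assumes G: "grown E w r ts" and T: "tree V E" and full: "fst ` set ts = V"
  shows "tree_edges r ts = E"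
proof (intro equalityI subsetI)
  fix e assume "e \<in> tree_edges r ts"
  then show "e \<in> E" using grown_entry[OF G] unfolding tree_edges_def by blast
next
  fix e assume e: "e \<in> E"
  have sub: "tree_edges r ts \<subseteq> E" using grown_entry[OF G] unfolding tree_edges_def by blast
  have "e \<subseteq> V" "card e = 2" using T e unfolding tree_def simple_graph_def by auto
  then obtain a b where ab: "e = {a, b}" "a \<noteq> b" "a \<in> V" "b \<in> V" by (auto simp: card_2_iff)
  show "e \<in> tree_edges r ts"
  proof (rule ccontr)
    assume no: "e \<notin> tree_edges r ts"
    obtain c where c: "c \<noteq> []" "distinct c" "hd c = a" "last c = b"
      "successively (\<lambda>x y. {x, y} \<in> tree_edges r ts) c"
      using grown_path[OF G, of a b] ab full by blast
    \<comment> \<open>A path of one or two nodes is impossible: the ends differ, and the edge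
      between them is not in the grown tree.\<close>
    have "length c \<ge> 3"
    proof (rule ccontr)
      assume "\<not> length c \<ge> 3"
      then consider z where "c = [z]" | y z where "c = [y, z]" using c(1)
        by (cases c; cases "tl c"; cases "tl (tl c)") auto
      then show False using c ab no by cases auto
    qed
    moreover have "{last c, hd c} \<in> E" using c ab e by (simp add: insert_commute)
    moreover have "\<forall>i. Suc i < length c \<longrightarrow> {c ! i, c ! Suc i} \<in> E"
      using c(5) sub by (auto simp: successively_conv_nth)
    ultimately have "graph_cycle E c" using c(2) unfolding graph_cycle_def by blast
    then show False using T unfolding tree_def by blast
  qed
qed

section \<open>The growth reaches all vertices\<close>

lemma length_grow_edge: "length ts \<le> length (grow_edge e ts)"
  by (auto simp: grow_edge_def split: prod.split)

lemma length_grow_fold: "length ts \<le> length (fold grow_edge es ts)"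
proof (induction es arbitrary: ts)
  case (Cons e es)
  then show ?case using length_grow_edge[of ts e] by (metis fold_simps(2) le_trans)
qed simp

lemma length_grow_rounds: "length ts \<le> length (fold (\<lambda>_ ts. fold grow_edge es ts) xs ts)"
proof (induction xs arbitrary: ts)
  case (Cons x xs)
  have "length ts \<le> length (fold grow_edge es ts)" by (rule length_grow_fold)
  also have "\<dots> \<le> length (fold (\<lambda>_ ts. fold grow_edge es ts) xs (fold grow_edge es ts))" by (rule Cons)
  finally show ?case by simp
qed simp

text \<open>If the edges before the given one change nothing, its turn comes with exactly one end
  visited, and it is attached.\<close>

lemma grow_fold_progress:
  assumes "(u, v, x) \<in> set es" and "(u \<in> fst ` set ts) \<noteq> (v \<in> fst ` set ts)"
  shows "length ts < length (fold grow_edge es ts)"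
  using assms(1)
proof (induction es)
  case (Cons e es)
  show ?case
  proof (cases "grow_edge e ts = ts")
    case True
    moreover have "grow_edge (u, v, x) ts \<noteq> ts"
      using assms(2) by (cases "u \<in> fst ` set ts") (simp_all add: grow_edge_def)
    ultimately have "e \<noteq> (u, v, x)" by metis
    then show ?thesis using Cons True by auto
  next
    case False
    then have "length ts < length (grow_edge e ts)"
      by (auto simp: grow_edge_def split: prod.splits if_splits)
    then show ?thesis using length_grow_fold[of "grow_edge e ts" es] by simp
  qed
qed simp

lemma crossing_edge:
  assumes "graph_connected V E" and "U \<subseteq> V" "U \<noteq> {}" "U \<noteq> V"
  obtains x y where "{x, y} \<in> E" "x \<in> U" "y \<notin> U"
proof -
  obtain a z where az: "a \<in> U" "z \<in> V" "z \<notin> U" using assms by blast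
  have "(a, z) \<in> {(x, y). {x, y} \<in> E}\<^sup>*" using assms(1,2) az unfolding graph_connected_def by blast
  then have "z \<in> U \<or> (\<exists>x y. {x, y} \<in> E \<and> x \<in> U \<and> y \<notin> U)"
    using az(1) by (induction rule: rtrancl_induct) auto
  then show thesis using that az by blast
qed

text \<open>Until all vertices are reached, connectedness provides an edge with exactly one end
  visited. Every pass thus adds a vertex, and as many passes as vertices suffice.\<close>

theorem grow_tree:
  assumes T: "tree V E" and vs: "distinct vs" "set vs = V"
    and es: "set (map (\<lambda>(u, v). {u, v}) es) = E"
    and es': "es' = map (\<lambda>(u, v). (u, v, w {u, v})) es"
  shows "grown E w (hd vs) (grow_tree vs es')" "fst ` set (grow_tree vs es') = V"
proof -
  let ?r = "hd vs"
  have "V \<noteq> {}" using T unfolding tree_def graph_connected_def by blast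
  then have r: "?r \<in> V" using vs by (cases vs) auto
  have fV: "finite V" using vs by auto
  have EV: "e \<subseteq> V" if "e \<in> E" for e using T that unfolding tree_def simple_graph_def by blast
  have edges: "\<forall>e\<in>set es'. \<exists>u v. e = (u, v, w {u, v}) \<and> {u, v} \<in> E"
    using es unfolding es' by force
  have sub: "fst ` set ts \<subseteq> V" if "grown E w ?r ts" for ts
    using that by (induction rule: grown.induct) (use r EV in auto)
  have inv: "grown E w ?r (fold (\<lambda>_ ts. fold grow_edge es' ts) xs ts) \<and>
      (length ts + length xs \<le> length (fold (\<lambda>_ ts. fold grow_edge es' ts) xs ts) \<or>
       fst ` set (fold (\<lambda>_ ts. fold grow_edge es' ts) xs ts) = V)" if "grown E w ?r ts" for xs ts
    using that
  proof (induction xs arbitrary: ts)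
    case (Cons z xs)
    let ?ts = "fold grow_edge es' ts"
    have g: "grown E w ?r ?ts" using grown_fold[OF Cons.prems edges] .
    have full: "fst ` set (fold (\<lambda>_ ts. fold grow_edge es' ts) xs ?ts) = V" if f: "fst ` set ts = V"
    proof -
      have len: "length ts' = card (fst ` set ts')" if "grown E w ?r ts'" for ts'
        using distinct_card[OF grown_distinct[OF that]] by simp
      have "card V \<le> card (fst ` set (fold (\<lambda>_ ts. fold grow_edge es' ts) xs ?ts))"
      proof -
        have "length ts \<le> length ?ts" by (rule length_grow_fold)
        also have "\<dots> \<le> length (fold (\<lambda>_ ts. fold grow_edge es' ts) xs ?ts)" by (rule length_grow_rounds)
        finally show ?thesis
          using len[OF Cons.prems] len[OF conjunct1[OF Cons.IH[OF g]]] f by simp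
      qed
      then show ?thesis using sub[OF conjunct1[OF Cons.IH[OF g]]] fV card_seteq by blast
    qed
    show ?case
    proof (cases "fst ` set ts = V")
      case True
      then show ?thesis using full Cons.IH[OF g] by simp
    next
      case False
      have "fst ` set ts \<noteq> {}" using grown_root[OF Cons.prems] by auto
      then obtain x y where xy: "{x, y} \<in> E" "x \<in> fst ` set ts" "y \<notin> fst ` set ts"
        using crossing_edge[of V E "fst ` set ts"] T sub[OF Cons.prems] False unfolding tree_def by metis
      then obtain u v where uv: "(u, v) \<in> set es" "{u, v} = {x, y}" using es by auto
      from imageI[OF uv(1), of "\<lambda>(u, v). (u, v, w {u, v})"]
      have "(u, v, w {u, v}) \<in> set es'" unfolding es' by simp
      moreover have "(u \<in> fst ` set ts) \<noteq> (v \<in> fst ` set ts)" using uv(2) xy by (auto simp: doubleton_eq_iff)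
      ultimately have "length ts < length ?ts" by (rule grow_fold_progress)
      then show ?thesis using Cons.IH[OF g] by auto
    qed
  qed simp
  have g0: "grown E w ?r [(?r, ?r, 0)]" by (rule grown.intros)
  note fin = inv[OF g0, of vs, folded grow_tree_def]
  then show g: "grown E w ?r (grow_tree vs es')" by blast
  have "length (grow_tree vs es') \<le> card V"
    using distinct_card[OF grown_distinct[OF g]] card_mono[OF fV sub[OF g]] by simp
  moreover have "length vs = card V" using distinct_card[OF vs(1)] vs(2) by simp
  ultimately show "fst ` set (grow_tree vs es') = V" using fin by auto
qed

text \<open>The entry of the root names the root itself as its parent, so that its upward and downward
  elements coincide with the idle ones.\<close>

definition ground_list :: "entry list \<Rightarrow> elem list" where
  "ground_list ts = fold (\<lambda>vt es.
     fold (\<lambda>ut es. ((1, fst vt), (2, fst ut),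
         if fst vt = fst ut then snd (snd vt) else snd (snd vt) + snd (snd ut)) # es) ts
       (((0, fst vt), (1, fst vt), 0) # ((1, fst vt), (1, fst vt), 0) #
        ((1, fst vt), (1, fst (snd vt)), 0) # ((2, fst vt), (2, fst vt), 0) #
        ((2, fst (snd vt)), (2, fst vt), 0) # ((2, fst vt), (0, fst vt), 0) # es)) ts []"

lemma fold_Cons_map: "fold (\<lambda>x acc. f x # acc) xs acc = rev (map f xs) @ acc"
  by (induction xs arbitrary: acc) auto

lemma fold_append: "fold (\<lambda>x acc. f x @ acc) xs acc = concat (rev (map f xs)) @ acc"
  by (induction xs arbitrary: acc) auto

lemma ground_list_concat:
  "ground_list ts = concat (rev (map (\<lambda>vt. rev (map (\<lambda>ut. ((1, fst vt), (2, fst ut),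
         if fst vt = fst ut then snd (snd vt) else snd (snd vt) + snd (snd ut))) ts) @
       [((0, fst vt), (1, fst vt), 0), ((1, fst vt), (1, fst vt), 0),
        ((1, fst vt), (1, fst (snd vt)), 0), ((2, fst vt), (2, fst vt), 0),
        ((2, fst (snd vt)), (2, fst vt), 0), ((2, fst vt), (0, fst vt), 0)]) ts))"
proof -
  have "ground_list ts = fold (\<lambda>vt acc. (rev (map (\<lambda>ut. ((1, fst vt), (2, fst ut),
         if fst vt = fst ut then snd (snd vt) else snd (snd vt) + snd (snd ut))) ts) @
       [((0, fst vt), (1, fst vt), 0), ((1, fst vt), (1, fst vt), 0),
        ((1, fst vt), (1, fst (snd vt)), 0), ((2, fst vt), (2, fst vt), 0),
        ((2, fst (snd vt)), (2, fst vt), 0), ((2, fst vt), (0, fst vt), 0)]) @ acc) ts []"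
    unfolding ground_list_def fold_Cons_map by simp
  then show ?thesis unfolding fold_append by simp
qed

lemma set_ground_list:
  "set (ground_list ts) = (\<Union>vt\<in>set ts. (\<lambda>ut. ((1, fst vt), (2, fst ut),
         if fst vt = fst ut then snd (snd vt) else snd (snd vt) + snd (snd ut))) ` set ts \<union>
       {((0, fst vt), (1, fst vt), 0), ((1, fst vt), (1, fst vt), 0),
        ((1, fst vt), (1, fst (snd vt)), 0), ((2, fst vt), (2, fst vt), 0),
        ((2, fst (snd vt)), (2, fst vt), 0), ((2, fst vt), (0, fst vt), 0)})"
  unfolding ground_list_concat by simp

text \<open>One crossing to every vertex and six further elements per vertex; this quadratic size
  determines the bound \<open>N\<close>.\<close>

lemma length_ground_list: "length (ground_list ts) = length ts * (length ts + 6)"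
  unfolding ground_list_concat
  by (simp add: length_concat rev_map[symmetric] comp_def sum_list_triv add_mult_distrib2 flip: rev_map)

text \<open>Parents are read from the entries and ranks from the order of growth; by
  \<open>grown_edges\<close> no edge of the given tree is lost.\<close>

lemma grown_rooted_tree:
  assumes G: "grown E w r ts" and T: "tree V E" and full: "fst ` set ts = V"
    and nonneg: "\<forall>e\<in>E. 0 \<le> w e"
  obtains par pos where "rooted_tree V r par pos w" "rooted_tree.edges V r par = E"
    "\<And>v p x. (v, p, x) \<in> set ts \<Longrightarrow> p = (if v = r then r else par v)"
    "set (ground_list ts) = rooted_tree.ground V r par w"
proof -
  obtain pos :: "nat \<Rightarrow> nat" where pos: "\<forall>(v, p, x)\<in>set ts. v \<noteq> r \<longrightarrow> pos p < pos v"
    using grown_order[OF G] by blast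
  define par where "par v = fst (the (map_of ts v))" for v
  have entry: "(v, p, x) \<in> set ts \<Longrightarrow> par v = p" for v p x
    unfolding par_def using map_of_is_SomeI[OF grown_distinct[OF G]] by force
  have ex: "\<exists>x. (v, par v, x) \<in> set ts" if "v \<in> V" for v
    using that entry full by (metis (no_types, lifting) imageE prod.collapse)
  have "rooted_tree V r par pos w"
  proof
    show "finite V" using full by auto
    show "r \<in> V" using grown_root[OF G] full by force
    fix v assume v: "v \<in> V" "v \<noteq> r"
    then obtain x where x: "(v, par v, x) \<in> set ts" using ex by blast
    show "par v \<in> V" "0 \<le> w {v, par v}" using grown_entry[OF G x] full v nonneg by auto
    show "pos (par v) < pos v" using pos x v by auto
  qed
  then interpret R: rooted_tree V r par pos w .
  have "R.edges = tree_edges r ts"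
  proof (intro equalityI subsetI)
    fix e assume "e \<in> R.edges"
    then obtain v where "v \<in> V - {r}" "e = {v, par v}" unfolding R.edges_def by blast
    then show "e \<in> tree_edges r ts" using ex[of v] unfolding tree_edges_def by blast
  next
    fix e assume "e \<in> tree_edges r ts"
    then obtain v p x where e: "(v, p, x) \<in> set ts" "v \<noteq> r" "e = {v, p}" unfolding tree_edges_def by blast
    then have "v \<in> V" using full by force
    then show "e \<in> R.edges" using e entry unfolding R.edges_def by blast
  qed
  then have edges: "R.edges = E" using grown_edges[OF G T full] by simp
  have pr: "p = par v" "x = R.\<omega> v" "v \<in> V" "v = r \<longrightarrow> p = r" if t: "(v, p, x) \<in> set ts" for v p x
    using grown_entry[OF G t] entry[OF t] full t unfolding R.\<omega>_def by force+
  have ground: "set (ground_list ts) = R.ground"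
  proof (intro equalityI subsetI)
    fix e assume "e \<in> set (ground_list ts)"
    then obtain vt where vt0: "vt \<in> set ts" and e0: "e \<in> (\<lambda>ut. ((1, fst vt), (2, fst ut),
         if fst vt = fst ut then snd (snd vt) else snd (snd vt) + snd (snd ut))) ` set ts \<union>
       {((0, fst vt), (1, fst vt), 0), ((1, fst vt), (1, fst vt), 0),
        ((1, fst vt), (1, fst (snd vt)), 0), ((2, fst vt), (2, fst vt), 0),
        ((2, fst (snd vt)), (2, fst vt), 0), ((2, fst vt), (0, fst vt), 0)}"
      unfolding set_ground_list by (rule UN_E)
    obtain v p x where v: "vt = (v, p, x)" by (rule prod_cases3)
    note vt = vt0[unfolded v]
    from e0 show "e \<in> R.ground"
    proof
      assume "e \<in> (\<lambda>ut. ((1, fst vt), (2, fst ut),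
         if fst vt = fst ut then snd (snd vt) else snd (snd vt) + snd (snd ut))) ` set ts"
      then obtain ut where e: "e = ((1, fst vt), (2, fst ut),
         if fst vt = fst ut then snd (snd vt) else snd (snd vt) + snd (snd ut))" and ut0: "ut \<in> set ts"
        by (rule imageE)
      obtain u q y where u: "ut = (u, q, y)" by (rule prod_cases3)
      note ut = ut0[unfolded u]
      show ?thesis using pr[OF vt] pr[OF ut] unfolding e u v
        by (intro R.ground.cross[of _ v u]) (simp_all add: R.cross_cost_def)
    next
      assume "e \<in> {((0, fst vt), (1, fst vt), 0), ((1, fst vt), (1, fst vt), 0),
        ((1, fst vt), (1, fst (snd vt)), 0), ((2, fst vt), (2, fst vt), 0),
        ((2, fst (snd vt)), (2, fst vt), 0), ((2, fst vt), (0, fst vt), 0)}"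
      then show ?thesis using pr[OF vt] unfolding v
        by (cases "v = r") (auto intro: R.ground.intros)
    qed
  next
    have mem: "e \<in> set (ground_list ts)" if v: "v \<in> V" and
      e: "e \<in> {((0, v), (1, v), 0), ((1, v), (1, v), 0), ((1, v), (1, par v), 0), ((2, v), (2, v), 0),
        ((2, par v), (2, v), 0), ((2, v), (0, v), 0)}" for e v
    proof -
      obtain x where x: "(v, par v, x) \<in> set ts" using ex[OF v] by blast
      show ?thesis unfolding set_ground_list by (rule UN_I[OF x], rule UnI2) (use e in simp)
    qed
    have memc: "((1, u), (2, v), R.cross_cost u v) \<in> set (ground_list ts)" if uv: "u \<in> V" "v \<in> V" for u v
    proof -
      obtain x y where t: "(u, par u, x) \<in> set ts" "(v, par v, y) \<in> set ts" using ex uv by blast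
      have "R.cross_cost u v = (if u = v then x else x + y)"
        using pr(2)[OF t(1)] pr(2)[OF t(2)] unfolding R.cross_cost_def by simp
      then show ?thesis unfolding set_ground_list
        by (intro UN_I[OF t(1)] UnI1 image_eqI[OF _ t(2)]) simp
    qed
    fix e assume "e \<in> R.ground"
    then show "e \<in> set (ground_list ts)" by (cases rule: R.ground.cases) (simp_all only: mem memc insert_iff simp_thms)
  qed
  show thesis
    by (rule that[OF \<open>rooted_tree V r par pos w\<close> edges _ ground]) (use pr(1,4) in auto)
qed

section \<open>The programs\<close>

text \<open>Refinement of folds: \<open>enc\<close> encodes the entries and \<open>h\<close> the
  state. \<open>Inv\<close> carries facts that keep the folds inside the body within
  \<open>N\<close>.\<close>

lemma bounded_fold_list:
  assumes "length xs \<le> n" and "Inv a"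
    and "\<And>x s. x \<in> set xs \<Longrightarrow> Inv s \<Longrightarrow> f (enc x) (h s) = Some (h (g x s)) \<and> Inv (g x s)"
  shows "bounded_fold n f (val_list (map enc xs)) (h a) = Some (h (fold g xs a))"
  using assms
proof (induction xs arbitrary: n a)
  case (Cons x xs)
  then obtain m where n: "n = Suc m" by (cases n) auto
  have "f (enc x) (h a) = Some (h (g x a))" "Inv (g x a)" using Cons.prems(2,3) by auto
  then show ?case using Cons.IH[of m "g x a"] Cons.prems(1,3) n by simp
qed simp

lemma den_fold_inv:
  assumes "den N orc p \<rho> = Some (val_list (map enc xs))" and "length xs \<le> N"
    and "den N orc q \<rho> = Some (h a)" and "Inv a"
    and "\<And>x s. x \<in> set xs \<Longrightarrow> Inv s \<Longrightarrow>
      den N orc b (enc x # h s # \<rho>) = Some (h (g x s)) \<and> Inv (g x s)"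
  shows "den N orc (PFold b p q) \<rho> = Some (h (fold g xs a))"
  using bounded_fold_list[of xs N Inv a "\<lambda>x a. den N orc b (x # a # \<rho>)" enc h g] assms by simp

lemma den_fold:
  assumes "den N orc p \<rho> = Some (val_list (map enc xs))" and "length xs \<le> N"
    and "den N orc q \<rho> = Some (h a)"
    and "\<And>x s. x \<in> set xs \<Longrightarrow> den N orc b (enc x # h s # \<rho>) = Some (h (g x s))"
  shows "den N orc (PFold b p q) \<rho> = Some (h (fold g xs a))"
  by (rule den_fold_inv[where Inv = "\<lambda>_. True"]) (use assms in auto)

lemma val_bool_eq_VNil [simp]: "val_bool b = VNil \<longleftrightarrow> \<not> b"
  by (simp add: val_bool_def)

abbreviation pNot :: "prog \<Rightarrow> prog" where "pNot p \<equiv> PIf p PNil POne"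
abbreviation pAnd :: "prog \<Rightarrow> prog \<Rightarrow> prog" where "pAnd p q \<equiv> PIf p q PNil"
abbreviation pOr :: "prog \<Rightarrow> prog \<Rightarrow> prog" where "pOr p q \<equiv> PIf p POne q"
abbreviation pEq :: "prog \<Rightarrow> prog \<Rightarrow> prog" where "pEq p q \<equiv> pAnd (PLeq p q) (PLeq q p)"

lemma fold_or: "fold (\<lambda>x s. s \<or> P x) xs b \<longleftrightarrow> b \<or> (\<exists>x\<in>set xs. P x)"
  by (induction xs arbitrary: b) auto

lemma fold_and: "fold (\<lambda>x s. s \<and> P x) xs b \<longleftrightarrow> b \<and> (\<forall>x\<in>set xs. P x)"
  by (induction xs arbitrary: b) auto

lemma fold_filter: "fold (\<lambda>x acc. if P x then x # acc else acc) xs acc = rev (filter P xs) @ acc"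
  by (induction xs arbitrary: acc) auto

section \<open>Encodings and elementary programs\<close>

abbreviation enc_nats :: "nat list \<Rightarrow> val" where "enc_nats xs \<equiv> val_list (map val_nat xs)"

definition enc_node :: "node \<Rightarrow> val" where "enc_node n = VCons (val_nat (fst n)) (val_nat (snd n))"

definition enc_elem :: "elem \<Rightarrow> val" where
  "enc_elem e = VCons (enc_node (lft e)) (VCons (enc_node (rgt e)) (VNum (cost e)))"

abbreviation enc_elems :: "elem list \<Rightarrow> val" where "enc_elems xs \<equiv> val_list (map enc_elem xs)"

text \<open>The missing label is \<open>VNil\<close>, which counts as false, so a label can be
  tested directly.\<close>

fun enc_label :: "elem label \<Rightarrow> val" where
  "enc_label None = VNil"
| "enc_label (Some (d, P)) = VCons (VNum d) (enc_elems P)"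

definition enc_labelled :: "elem \<times> elem label \<Rightarrow> val" where
  "enc_labelled xl = VCons (enc_elem (fst xl)) (enc_label (snd xl))"

lemma enc_projections [simp]:
  "val_fst (enc_node n) = Some (val_nat (fst n))" "val_snd (enc_node n) = Some (val_nat (snd n))"
  "val_fst (enc_elem e) = Some (enc_node (lft e))"
  "val_snd (enc_elem e) = Some (VCons (enc_node (rgt e)) (VNum (cost e)))"
  "val_fst (enc_labelled xl) = Some (enc_elem (fst xl))"
  "val_snd (enc_labelled xl) = Some (enc_label (snd xl))"
  by (simp_all add: enc_node_def enc_elem_def enc_labelled_def)

lemma val_num2_nat [simp]:
  "val_num2 f (val_nat a) (val_nat b) = Some (f (real a) (real b))"
  "val_num2 f (val_nat a) (VNum y) = Some (f (real a) y)"
  "val_num2 f (VNum x) (val_nat b) = Some (f x (real b))"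
  by (simp_all add: val_nat_def)

text \<open>In the body of a fold, variable 0 is the entry and 1 the state; the variables of the
  environment are shifted by two. Here \<open>PVar 2\<close> is the number sought.\<close>

definition p_mem_nat :: prog where
  "p_mem_nat = PFold (pOr (PVar 1) (pEq (PVar 0) (PVar 2))) (PVar 1) PNil"

lemma den_mem_nat [simp]:
  assumes "length xs \<le> N"
  shows "den N orc p_mem_nat [val_nat v, enc_nats xs] = Some (val_bool (v \<in> set xs))"
proof -
  have "den N orc p_mem_nat [val_nat v, enc_nats xs] =
      Some (val_bool (fold (\<lambda>x s. s \<or> x = v) xs False))"
    unfolding p_mem_nat_def
    by (rule den_fold) (use assms in \<open>auto simp: val_bool_def\<close>)
  then show ?thesis by (auto simp: fold_or)
qed

definition p_eq_node :: prog where
  "p_eq_node = pAnd (pEq (PFst (PVar 0)) (PFst (PVar 1))) (pEq (PSnd (PVar 0)) (PSnd (PVar 1)))"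

lemma den_eq_node [simp]: "den N orc p_eq_node [enc_node a, enc_node b] = Some (val_bool (a = b))"
  unfolding p_eq_node_def by (auto simp: val_bool_def prod_eq_iff)

definition p_eq_elem :: prog where
  "p_eq_elem = pAnd (PApp p_eq_node [PFst (PVar 0), PFst (PVar 1)])
     (pAnd (PApp p_eq_node [PFst (PSnd (PVar 0)), PFst (PSnd (PVar 1))])
       (pEq (PSnd (PSnd (PVar 0))) (PSnd (PSnd (PVar 1)))))"

lemma den_eq_elem [simp]: "den N orc p_eq_elem [enc_elem a, enc_elem b] = Some (val_bool (a = b))"
  unfolding p_eq_elem_def by (auto simp: val_bool_def prod_eq_iff)

definition p_mem_elem :: prog where
  "p_mem_elem = PFold (pOr (PVar 1) (PApp p_eq_elem [PVar 0, PVar 2])) (PVar 1) PNil"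

lemma den_mem_elem [simp]:
  assumes "length xs \<le> N"
  shows "den N orc p_mem_elem [enc_elem v, enc_elems xs] = Some (val_bool (v \<in> set xs))"
proof -
  have "den N orc p_mem_elem [enc_elem v, enc_elems xs] =
      Some (val_bool (fold (\<lambda>x s. s \<or> x = v) xs False))"
    unfolding p_mem_elem_def
    by (rule den_fold[where enc = enc_elem]) (use assms in \<open>simp_all add: val_bool_def\<close>)
  then show ?thesis by (simp add: fold_or)
qed

definition p_remove :: prog where
  "p_remove = PFold (PIf (PApp p_eq_elem [PVar 0, PVar 2]) (PVar 1) (PCons (PVar 0) (PVar 1))) (PVar 1) PNil"

lemma den_remove [simp]:
  assumes "length xs \<le> N"
  shows "den N orc p_remove [enc_elem v, enc_elems xs] = Some (enc_elems (rev (filter (\<lambda>x. x \<noteq> v) xs)))"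
proof -
  have "den N orc p_remove [enc_elem v, enc_elems xs] =
      Some (enc_elems (fold (\<lambda>x acc. if x \<noteq> v then x # acc else acc) xs []))"
    unfolding p_remove_def
    by (rule den_fold[where enc = enc_elem and h = enc_elems]) (use assms in \<open>simp_all add: val_bool_def\<close>)
  then show ?thesis by (simp add: fold_filter)
qed

definition side :: "bool \<Rightarrow> elem \<Rightarrow> node" where "side b = (if b then lft else rgt)"

definition p_side :: "bool \<Rightarrow> prog \<Rightarrow> prog" where
  "p_side b p = (if b then PFst p else PFst (PSnd p))"

lemma den_side [simp]:
  "den N orc p \<rho> = Some (enc_elem e) \<Longrightarrow> den N orc (p_side b p) \<rho> = Some (enc_node (side b e))"
  by (simp add: p_side_def side_def)

text \<open>Repetitions are removed, so that the tops computed from it later form a list without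
  repetitions.\<close>

definition terminal_list :: "bool \<Rightarrow> elem list \<Rightarrow> nat list" where
  "terminal_list b xs =
     fold (\<lambda>e acc. if fst (side b e) = 0 then List.insert (snd (side b e)) acc else acc) xs []"

definition p_terminals :: "bool \<Rightarrow> prog" where
  "p_terminals b = PFold (PIf (pEq (PFst (p_side b (PVar 0))) PZero)
     (PIf (PApp p_mem_nat [PSnd (p_side b (PVar 0)), PVar 1]) (PVar 1)
       (PCons (PSnd (p_side b (PVar 0))) (PVar 1))) (PVar 1)) (PVar 0) PNil"

lemma terminal_list:
  "distinct (terminal_list b xs)" "set (terminal_list b xs) = terminals (side b) (set xs)"
proof -
  let ?f = "\<lambda>e acc. if fst (side b e) = 0 then List.insert (snd (side b e)) acc else acc"
  have "distinct (fold ?f xs acc) \<and> set (fold ?f xs acc) = set acc \<union> terminals (side b) (set xs)"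
    if "distinct acc" for acc
    using that
  proof (induction xs arbitrary: acc)
    case (Cons e xs)
    have "terminals (side b) (set (e # xs)) =
        (if fst (side b e) = 0 then {snd (side b e)} else {}) \<union> terminals (side b) (set xs)"
      by (cases "side b e") (auto simp: terminals_def)
    then show ?case using Cons by auto
  qed (simp add: terminals_def)
  from this[of "[]"] show "distinct (terminal_list b xs)"
    "set (terminal_list b xs) = terminals (side b) (set xs)"
    unfolding terminal_list_def by auto
qed

lemma den_terminals [simp]:
  assumes "length xs \<le> N"
  shows "den N orc (p_terminals b) [enc_elems xs] = Some (enc_nats (terminal_list b xs))"
  unfolding terminal_list_def p_terminals_def
proof (rule den_fold_inv[where h = enc_nats and Inv = "\<lambda>acc. distinct acc \<and> set acc \<subseteq> (\<lambda>e. snd (side b e)) ` set xs"])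
  fix x s assume x: "x \<in> set xs" and s: "distinct s \<and> set s \<subseteq> (\<lambda>e. snd (side b e)) ` set xs"
  have "length s \<le> N"
    using s distinct_card[of s] card_mono[of "(\<lambda>e. snd (side b e)) ` set xs" "set s"]
      card_image_le[of "set xs" "\<lambda>e. snd (side b e)"] card_length[of xs] assms by simp
  then show "den N orc (PIf (pEq (PFst (p_side b (PVar 0))) PZero)
     (PIf (PApp p_mem_nat [PSnd (p_side b (PVar 0)), PVar 1]) (PVar 1)
       (PCons (PSnd (p_side b (PVar 0))) (PVar 1))) (PVar 1)) [enc_elem x, enc_nats s, enc_elems xs] =
      Some (enc_nats (if fst (side b x) = 0 then List.insert (snd (side b x)) s else s)) \<and>
    distinct (if fst (side b x) = 0 then List.insert (snd (side b x)) s else s) \<and>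
    set (if fst (side b x) = 0 then List.insert (snd (side b x)) s else s) \<subseteq> (\<lambda>e. snd (side b e)) ` set xs"
    using x s by (simp add: val_bool_def List.insert_def)
qed (use assms in auto)

definition p_indep :: "bool \<Rightarrow> nat \<Rightarrow> prog" where
  "p_indep b j = pAnd
     (PFold (pAnd (PVar 1) (PFold (pAnd (PVar 1)
         (pOr (pNot (PApp p_eq_node [p_side b (PVar 0), p_side b (PVar 2)]))
           (PApp p_eq_elem [PVar 0, PVar 2]))) (PVar 2) POne)) (PVar 0) POne)
     (PQuery j (PApp (p_terminals b) [PVar 0]))"

lemma den_indep:
  assumes "length xs \<le> N"
  shows "den N orc (p_indep b j) [enc_elems xs] =
    Some (val_bool (inj_on (side b) (set xs) \<and> orc j (terminals (side b) (set xs))))"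
proof -
  let ?inner = "PFold (pAnd (PVar 1) (pOr (pNot (PApp p_eq_node [p_side b (PVar 0), p_side b (PVar 2)]))
           (PApp p_eq_elem [PVar 0, PVar 2]))) (PVar 2) POne"
  have inner: "den N orc ?inner [enc_elem x, val_bool s, enc_elems xs] =
      Some (val_bool (\<forall>y\<in>set xs. side b y = side b x \<longrightarrow> y = x))" for x s
  proof -
    have "den N orc ?inner [enc_elem x, val_bool s, enc_elems xs] =
      Some (val_bool (fold (\<lambda>y s. s \<and> (side b y = side b x \<longrightarrow> y = x)) xs True))"
      by (rule den_fold[where enc = enc_elem]) (use assms in \<open>simp_all add: val_bool_def\<close>)
    then show ?thesis by (simp add: fold_and)
  qed
  have "den N orc (PFold (pAnd (PVar 1) ?inner) (PVar 0) POne) [enc_elems xs] =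
      Some (val_bool (fold (\<lambda>x s. s \<and> (\<forall>y\<in>set xs. side b y = side b x \<longrightarrow> y = x)) xs True))"
  proof (rule den_fold)
    fix x s assume "x \<in> set xs"
    show "den N orc (pAnd (PVar 1) ?inner) [enc_elem x, val_bool s, enc_elems xs] =
      Some (val_bool (s \<and> (\<forall>y\<in>set xs. side b y = side b x \<longrightarrow> y = x)))"
      unfolding den.simps(11) inner by (simp add: val_bool_def)
  qed (use assms in \<open>auto simp: val_bool_def\<close>)
  also have "fold (\<lambda>x s. s \<and> (\<forall>y\<in>set xs. side b y = side b x \<longrightarrow> y = x)) xs True \<longleftrightarrow>
      inj_on (side b) (set xs)"
    by (auto simp: fold_and inj_on_def)
  finally show ?thesis unfolding p_indep_def den.simps(11)
    using assms by (auto simp: terminal_list val_bool_def)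
qed

section \<open>Programs for matroid intersection\<close>

definition p_arc :: prog where
  "p_arc = PIf (PApp p_mem_elem [PVar 1, PVar 0])
     (pAnd (pNot (PApp p_mem_elem [PVar 2, PVar 0]))
       (PApp (p_indep True (Suc 0)) [PCons (PVar 2) (PApp p_remove [PVar 1, PVar 0])]))
     (pAnd (PApp p_mem_elem [PVar 2, PVar 0])
       (PApp (p_indep False 2) [PCons (PVar 1) (PApp p_remove [PVar 2, PVar 0])]))"

definition p_addable :: "bool \<Rightarrow> nat \<Rightarrow> prog" where
  "p_addable b j = pAnd (pNot (PApp p_mem_elem [PVar 1, PVar 0]))
     (PApp (p_indep b j) [PCons (PVar 1) (PVar 0)])"

definition p_signed :: prog where
  "p_signed = PIf (PApp p_mem_elem [PVar 1, PVar 0]) (PSub PZero (PSnd (PSnd (PVar 1)))) (PSnd (PSnd (PVar 1)))"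

definition p_initial :: prog where
  "p_initial = PFold (PCons (PCons (PVar 0) (PIf (PApp (p_addable True (Suc 0)) [PVar 2, PVar 0])
       (PCons (PApp p_signed [PVar 2, PVar 0]) (PCons (PVar 0) PNil)) PNil)) (PVar 1)) (PVar 1) PNil"

text \<open>The arguments are the set \<open>I\<close>, the head, the labelled tail and the current
  label of the head. Below \<open>PLet\<close>, which holds the new length, they are shifted by
  one.\<close>

definition p_relax :: prog where
  "p_relax = PIf (PSnd (PVar 2))
     (PIf (PApp p_arc [PVar 0, PFst (PVar 2), PVar 1])
       (PLet (PAdd (PFst (PSnd (PVar 2))) (PApp p_signed [PVar 0, PVar 1]))
         (PIf (pOr (pNot (PVar 4)) (pNot (PLeq (PFst (PVar 4)) (PVar 0))))
           (PCons (PVar 0) (PCons (PVar 2) (PSnd (PSnd (PVar 3))))) (PVar 4)))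
       (PVar 3)) (PVar 3)"

definition p_relax_all :: prog where
  "p_relax_all = PFold (PCons (PCons (PFst (PVar 0))
       (PFold (PApp p_relax [PVar 4, PFst (PVar 2), PVar 0, PVar 1]) (PVar 3) (PSnd (PVar 0)))) (PVar 1))
     (PVar 1) PNil"

definition p_length :: prog where
  "p_length = PFold (PAdd (PVar 1) POne) (PVar 0) PZero"

definition p_pick :: prog where
  "p_pick = PFold (PIf (PSnd (PVar 0))
     (PIf (PApp (p_addable False 2) [PVar 2, PFst (PVar 0)])
       (PIf (pOr (pNot (PVar 1)) (pOr (pNot (PLeq (PFst (PVar 1)) (PFst (PSnd (PVar 0)))))
           (pAnd (PLeq (PFst (PSnd (PVar 0))) (PFst (PVar 1)))
             (pNot (PLeq (PApp p_length [PSnd (PVar 1)]) (PApp p_length [PSnd (PSnd (PVar 0))]))))))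
         (PSnd (PVar 0)) (PVar 1)) (PVar 1)) (PVar 1)) (PVar 1) PNil"

text \<open>In the last fold the environment consists of the entry, the state, the best label, all
  labels, \<open>es\<close> and \<open>I\<close>, in this order.\<close>

definition p_augment :: prog where
  "p_augment = PLet (PFold (PApp p_relax_all [PVar 3, PVar 1]) (PVar 0) (PApp p_initial [PVar 1, PVar 0]))
     (PLet (PApp p_pick [PVar 2, PVar 0])
       (PIf (PVar 0)
         (PFold (PIf (PIf (PApp p_mem_elem [PVar 0, PVar 5]) (pNot (PApp p_mem_elem [PVar 0, PSnd (PVar 2)]))
               (PApp p_mem_elem [PVar 0, PSnd (PVar 2)]))
             (PCons (PVar 0) (PVar 1)) (PVar 1)) (PVar 2) PNil)
         (PVar 3)))"

definition p_intersect :: prog where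
  "p_intersect = PFold (PApp p_augment [PVar 2, PVar 1]) (PVar 0) PNil"

lemma den_length [simp]:
  assumes "length xs \<le> N"
  shows "den N orc p_length [val_list (map enc xs)] = Some (VNum (real (length xs)))"
proof -
  have "den N orc p_length [val_list (map enc xs)] = Some (VNum (fold (\<lambda>x s. s + 1) xs 0))"
    unfolding p_length_def by (rule den_fold) (use assms in auto)
  moreover have "fold (\<lambda>x s. s + 1) xs a = a + real (length xs)" for a
    by (induction xs arbitrary: a) auto
  ultimately show ?thesis by simp
qed

text \<open>The bound leaves room for a set with one more element and for the walk in a label after
  \<open>length es\<close> rounds.\<close>

context
  fixes N :: nat and I1 I2 :: "nat set set" and es :: "elem list"
  assumes N: "Suc (Suc (length es)) \<le> N"
begin

abbreviation (input) oracles where "oracles \<equiv> independence_oracles I1 I2"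
abbreviation (input) left_indep where "left_indep \<equiv> side_indep (set es) lft I1"
abbreviation (input) right_indep where "right_indep \<equiv> side_indep (set es) rgt I2"

lemma den_indep_left [simp]:
  "length xs \<le> N \<Longrightarrow> set xs \<subseteq> set es \<Longrightarrow>
    den N oracles (p_indep True (Suc 0)) [enc_elems xs] = Some (val_bool (set xs \<in> left_indep))"
  using den_indep[of xs N oracles True "Suc 0"] by (simp add: side_def side_indep_def independence_oracles_def)

lemma den_indep_right [simp]:
  "length xs \<le> N \<Longrightarrow> set xs \<subseteq> set es \<Longrightarrow>
    den N oracles (p_indep False 2) [enc_elems xs] = Some (val_bool (set xs \<in> right_indep))"
  using den_indep[of xs N oracles False 2] by (simp add: side_def side_indep_def independence_oracles_def)

context
  fixes I :: "elem list"
  assumes I: "set I \<subseteq> set es" "length I \<le> length es"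
begin

lemma lenI [simp]: "length I \<le> N" "Suc (length I) \<le> N"
  using I N by auto

lemma den_arc:
  assumes "u \<in> set es" "v \<in> set es"
  shows "den N oracles p_arc [enc_elems I, enc_elem u, enc_elem v] =
    Some (val_bool (exchange_arc left_indep right_indep (set I) u v))"
proof -
  have bound: "length (v # rev (filter (\<lambda>x. x \<noteq> u) I)) \<le> N" for u v
    using lenI(2) order.trans[OF length_filter_le[of "\<lambda>x. x \<noteq> u" I]] by (simp add: Suc_le_eq)
      (metis le_less_trans length_filter_le)
  have s: "set (v # rev (filter (\<lambda>x. x \<noteq> u) I)) = insert v (set I - {u})" for u v by auto
  have "den N oracles (p_indep True (Suc 0)) [enc_elems (v # rev (filter (\<lambda>x. x \<noteq> u) I))] =
      Some (val_bool (insert v (set I - {u}) \<in> left_indep))"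
    unfolding s[symmetric] by (rule den_indep_left[OF bound]) (use assms I in auto)
  moreover have "den N oracles (p_indep False 2) [enc_elems (u # rev (filter (\<lambda>x. x \<noteq> v) I))] =
      Some (val_bool (insert u (set I - {v}) \<in> right_indep))"
    unfolding s[symmetric] by (rule den_indep_right[OF bound]) (use assms I in auto)
  ultimately show ?thesis unfolding p_arc_def exchange_arc_def by (simp add: val_bool_def)
qed

lemma den_addable_left:
  assumes "x \<in> set es"
  shows "den N oracles (p_addable True (Suc 0)) [enc_elems I, enc_elem x] = Some (val_bool (x \<in> addable left_indep (set I)))"
proof -
  have "den N oracles (p_indep True (Suc 0)) [enc_elems (x # I)] = Some (val_bool (set (x # I) \<in> left_indep))"
    by (rule den_indep_left) (use assms I lenI in auto)
  then show ?thesis unfolding p_addable_def addable_def by (simp add: val_bool_def)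
qed

lemma den_addable_right:
  assumes "x \<in> set es"
  shows "den N oracles (p_addable False 2) [enc_elems I, enc_elem x] = Some (val_bool (x \<in> addable right_indep (set I)))"
proof -
  have "den N oracles (p_indep False 2) [enc_elems (x # I)] = Some (val_bool (set (x # I) \<in> right_indep))"
    by (rule den_indep_right) (use assms I lenI in auto)
  then show ?thesis unfolding p_addable_def addable_def by (simp add: val_bool_def)
qed

lemma den_signed: "den N oracles p_signed [enc_elems I, enc_elem x] = Some (VNum (signed cost (set I) x))"
  unfolding p_signed_def signed_def by simp

abbreviation (input) exch_arc where "exch_arc \<equiv> exchange_arc left_indep right_indep (set I)"
abbreviation (input) exch_cost where "exch_cost \<equiv> signed cost (set I)"

lemma den_initial:
  "den N oracles p_initial [enc_elems I, enc_elems es] =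
    Some (val_list (map enc_labelled (initial_labels (addable left_indep (set I)) exch_cost es)))"
proof -
  have "den N oracles p_initial [enc_elems I, enc_elems es] =
    Some (val_list (map enc_labelled
      (fold (\<lambda>x acc. (x, if x \<in> addable left_indep (set I) then Some (exch_cost x, [x]) else None) # acc) es [])))"
    unfolding p_initial_def
    by (rule den_fold[where enc = enc_elem and h = "\<lambda>acc. val_list (map enc_labelled acc)"])
      (use N in \<open>simp_all add: den_addable_left den_signed enc_labelled_def\<close>)
  then show ?thesis by (simp add: fold_Cons_map initial_labels_def)
qed

lemma den_relax:
  assumes "fst ul \<in> set es" "x \<in> set es"
  shows "den N oracles p_relax [enc_elems I, enc_elem x, enc_labelled ul, enc_label cur] =
    Some (enc_label (relax exch_arc exch_cost x ul cur))"
proof -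
  obtain u lu where ul: "ul = (u, lu)" by (rule prod.exhaust)
  have exch_arc: "den N oracles p_arc [enc_elems I, enc_elem u, enc_elem x] = Some (val_bool (exch_arc u x))"
    using den_arc assms ul by simp
  show ?thesis
  proof (cases lu)
    case None
    then show ?thesis unfolding p_relax_def relax_def ul by simp
  next
    case (Some dP)
    obtain d P where dP: "dP = (d, P)" by (rule prod.exhaust)
    show ?thesis
    proof (cases cur)
      case None
      then show ?thesis unfolding p_relax_def relax_def ul Some dP
        by (simp add: exch_arc den_signed)
    next
      case c: (Some dP')
      obtain d' P' where "dP' = (d', P')" by (rule prod.exhaust)
      then show ?thesis unfolding p_relax_def relax_def ul Some dP c
        by (simp add: exch_arc den_signed)
    qed
  qed
qed

lemma den_relax_all:
  assumes "fst ` set labs \<subseteq> set es" "length labs \<le> N"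
  shows "den N oracles p_relax_all [enc_elems I, val_list (map enc_labelled labs)] =
    Some (val_list (map enc_labelled (relax_all exch_arc exch_cost labs)))"
proof -
  have inner: "den N oracles (PFold (PApp p_relax [PVar 4, PFst (PVar 2), PVar 0, PVar 1]) (PVar 3) (PSnd (PVar 0)))
      [enc_labelled xl, acc, enc_elems I, val_list (map enc_labelled labs)] =
    Some (enc_label (fold (relax exch_arc exch_cost (fst xl)) labs (snd xl)))" if "xl \<in> set labs" for xl acc
  proof (rule den_fold)
    fix ul s assume "ul \<in> set labs"
    then have "den N oracles p_relax [enc_elems I, enc_elem (fst xl), enc_labelled ul, enc_label s] =
        Some (enc_label (relax exch_arc exch_cost (fst xl) ul s))"
      using that assms by (intro den_relax) auto
    then show "den N oracles (PApp p_relax [PVar 4, PFst (PVar 2), PVar 0, PVar 1])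
        [enc_labelled ul, enc_label s, enc_labelled xl, acc, enc_elems I, val_list (map enc_labelled labs)] =
      Some (enc_label (relax exch_arc exch_cost (fst xl) ul s))"
      by simp
  qed (use assms in simp_all)
  have "den N oracles p_relax_all [enc_elems I, val_list (map enc_labelled labs)] =
    Some (val_list (map enc_labelled
      (fold (\<lambda>xl acc. (fst xl, fold (relax exch_arc exch_cost (fst xl)) labs (snd xl)) # acc) labs [])))"
    unfolding p_relax_all_def
  proof (rule den_fold[where h = "\<lambda>acc. val_list (map enc_labelled acc)"])
    fix xl acc assume xl: "xl \<in> set labs"
    show "den N oracles (PCons (PCons (PFst (PVar 0))
       (PFold (PApp p_relax [PVar 4, PFst (PVar 2), PVar 0, PVar 1]) (PVar 3) (PSnd (PVar 0)))) (PVar 1))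
       [enc_labelled xl, val_list (map enc_labelled acc), enc_elems I, val_list (map enc_labelled labs)] =
      Some (val_list (map enc_labelled ((fst xl, fold (relax exch_arc exch_cost (fst xl)) labs (snd xl)) # acc)))"
      unfolding den.simps(5) inner[OF xl] by (simp add: enc_labelled_def)
  qed (use assms in auto)
  then show ?thesis by (simp add: fold_Cons_map relax_all_def)
qed

lemma relax_all_fst: "fst ` set (relax_all E l labs) = fst ` set labs" "length (relax_all E l labs) = length labs"
  unfolding relax_all_def by (simp_all add: image_image)

lemma den_pick:
  assumes "fst ` set labs \<subseteq> set es" "length labs \<le> N"
    and short: "\<forall>xl\<in>set labs. \<forall>d P. snd xl = Some (d, P) \<longrightarrow> length P \<le> N"
  shows "den N oracles p_pick [enc_elems I, val_list (map enc_labelled labs)] =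
    Some (enc_label (fold (pick (addable right_indep (set I))) labs None))"
  unfolding p_pick_def
proof (rule den_fold_inv[where h = enc_label and Inv = "\<lambda>cur. \<forall>d P. cur = Some (d, P) \<longrightarrow> length P \<le> N"])
  fix xl and cur :: "elem label"
  assume xl: "xl \<in> set labs" and cur: "\<forall>d P. cur = Some (d, P) \<longrightarrow> length P \<le> N"
  obtain x lab where l: "xl = (x, lab)" by (rule prod.exhaust)
  have x: "den N oracles (p_addable False 2) [enc_elems I, enc_elem x] = Some (val_bool (x \<in> addable right_indep (set I)))"
    using assms xl l by (intro den_addable_right) auto
  have "den N oracles (PIf (PSnd (PVar 0))
     (PIf (PApp (p_addable False 2) [PVar 2, PFst (PVar 0)])
       (PIf (pOr (pNot (PVar 1)) (pOr (pNot (PLeq (PFst (PVar 1)) (PFst (PSnd (PVar 0)))))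
           (pAnd (PLeq (PFst (PSnd (PVar 0))) (PFst (PVar 1)))
             (pNot (PLeq (PApp p_length [PSnd (PVar 1)]) (PApp p_length [PSnd (PSnd (PVar 0))]))))))
         (PSnd (PVar 0)) (PVar 1)) (PVar 1)) (PVar 1))
     [enc_labelled xl, enc_label cur, enc_elems I, val_list (map enc_labelled labs)] =
    Some (enc_label (pick (addable right_indep (set I)) xl cur))"
  proof (cases lab)
    case None
    then show ?thesis unfolding pick_def l by simp
  next
    case (Some dP)
    obtain d P where dP: "dP = (d, P)" by (rule prod.exhaust)
    have P: "length P \<le> N" using short xl l Some dP by auto
    show ?thesis
    proof (cases cur)
      case None
      then show ?thesis unfolding pick_def l Some dP by (simp add: x)
    next
      case c: (Some dP')
      obtain d' P' where dP': "dP' = (d', P')" by (rule prod.exhaust)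
      have P': "length P' \<le> N" using cur c dP' by auto
      show ?thesis unfolding pick_def l Some dP c dP' by (simp add: x P P')
    qed
  qed
  moreover have "\<forall>d P. pick (addable right_indep (set I)) xl cur = Some (d, P) \<longrightarrow> length P \<le> N"
    using short xl cur l by (auto simp: pick_def split: option.splits if_splits)
  ultimately show "den N oracles (PIf (PSnd (PVar 0))
     (PIf (PApp (p_addable False 2) [PVar 2, PFst (PVar 0)])
       (PIf (pOr (pNot (PVar 1)) (pOr (pNot (PLeq (PFst (PVar 1)) (PFst (PSnd (PVar 0)))))
           (pAnd (PLeq (PFst (PSnd (PVar 0))) (PFst (PVar 1)))
             (pNot (PLeq (PApp p_length [PSnd (PVar 1)]) (PApp p_length [PSnd (PSnd (PVar 0))]))))))
         (PSnd (PVar 0)) (PVar 1)) (PVar 1)) (PVar 1))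
     [enc_labelled xl, enc_label cur, enc_elems I, val_list (map enc_labelled labs)] =
    Some (enc_label (pick (addable right_indep (set I)) xl cur)) \<and>
    (\<forall>d P. pick (addable right_indep (set I)) xl cur = Some (d, P) \<longrightarrow> length P \<le> N)" by blast
qed (use assms in auto)

text \<open>The walks in labels are themselves folded over, so their lengths have to stay within
  \<open>N\<close>; a round lengthens them by at most one node.\<close>

lemma relax_all_short:
  assumes "\<forall>xl\<in>set labs. \<forall>d P. snd xl = Some (d, P) \<longrightarrow> length P \<le> n"
  shows "\<forall>xl\<in>set (relax_all E l labs). \<forall>d P. snd xl = Some (d, P) \<longrightarrow> length P \<le> Suc n"
proof -
  have "length P \<le> Suc n"
    if "fold (relax E l x) ls cur = Some (d, P)" "set ls \<subseteq> set labs"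
      "\<forall>d P. cur = Some (d, P) \<longrightarrow> length P \<le> Suc n" for x ls cur d P
    using that
  proof (induction ls arbitrary: cur)
    case (Cons ul ls)
    have "\<forall>d P. relax E l x ul cur = Some (d, P) \<longrightarrow> length P \<le> Suc n"
      using Cons.prems(2,3) assms by (auto simp: relax_def split: option.splits)
    then show ?case using Cons.IH[of "relax E l x ul cur"] Cons.prems(1,2) by simp
  qed simp
  then have "length P \<le> Suc n" if "xl \<in> set labs" "fold (relax E l (fst xl)) labs (snd xl) = Some (d, P)" for xl d P
    using that assms by (meson le_SucI order_refl)
  then show ?thesis unfolding relax_all_def by auto
qed

lemma fold_relax_all_short:
  assumes "\<forall>xl\<in>set labs. \<forall>d P. snd xl = Some (d, P) \<longrightarrow> length P \<le> n"
  shows "\<forall>xl\<in>set (fold (\<lambda>_. relax_all E l) fs labs). \<forall>d P. snd xl = Some (d, P) \<longrightarrow> length P \<le> n + length fs"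
  using assms
proof (induction fs arbitrary: labs n)
  case (Cons f fs)
  then show ?case using Cons.IH[OF relax_all_short[OF Cons.prems]] by simp
qed simp

lemma fold_relax_all_fst:
  "fst ` set (fold (\<lambda>_. relax_all E l) fs labs) = fst ` set labs"
  "length (fold (\<lambda>_. relax_all E l) fs labs) = length labs"
  by (induction fs arbitrary: labs) (simp_all add: relax_all_fst)

lemma den_augment:
  "den N oracles p_augment [enc_elems es, enc_elems I] = Some (enc_elems (augment_once left_indep right_indep cost es I))"
proof -
  let ?enc = "\<lambda>labs. val_list (map enc_labelled labs)"
  define labs where "labs = fold (\<lambda>_. relax_all exch_arc exch_cost) es (initial_labels (addable left_indep (set I)) exch_cost es)"
  have init: "fst ` set (initial_labels (addable left_indep (set I)) exch_cost es) = set es"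
    "length (initial_labels (addable left_indep (set I)) exch_cost es) = length es"
    "\<forall>xl\<in>set (initial_labels (addable left_indep (set I)) exch_cost es). \<forall>d P. snd xl = Some (d, P) \<longrightarrow> length P \<le> 1"
    unfolding initial_labels_def by (simp_all add: image_image)
  have lenes: "length es \<le> N" using N by simp
  have labs: "fst ` set labs \<subseteq> set es" "length labs \<le> N"
    "\<forall>xl\<in>set labs. \<forall>d P. snd xl = Some (d, P) \<longrightarrow> length P \<le> N"
    using fold_relax_all_fst[of exch_arc exch_cost es] fold_relax_all_short[OF init(3), of exch_arc exch_cost es] init lenes N
    unfolding labs_def by (simp, simp, fastforce)
  have "den N oracles (PFold (PApp p_relax_all [PVar 3, PVar 1]) (PVar 0) (PApp p_initial [PVar 1, PVar 0]))
      [enc_elems es, enc_elems I] = Some (?enc labs)"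
    unfolding labs_def
  proof (rule den_fold_inv[where enc = enc_elem and h = ?enc and
        Inv = "\<lambda>labs. fst ` set labs \<subseteq> set es \<and> length labs \<le> N"])
    fix x and s :: "(elem \<times> elem label) list"
    assume s: "fst ` set s \<subseteq> set es \<and> length s \<le> N"
    then have "den N oracles p_relax_all [enc_elems I, ?enc s] = Some (?enc (relax_all exch_arc exch_cost s))"
      by (intro den_relax_all) auto
    then show "den N oracles (PApp p_relax_all [PVar 3, PVar 1])
        [enc_elem x, ?enc s, enc_elems es, enc_elems I] = Some (?enc (relax_all exch_arc exch_cost s)) \<and>
      (fst ` set (relax_all exch_arc exch_cost s) \<subseteq> set es \<and> length (relax_all exch_arc exch_cost s) \<le> N)"
      using s by (simp add: relax_all_fst)
  qed (use init lenes in \<open>simp_all add: den_initial\<close>)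
  note first = this
  define best where "best = fold (pick (addable right_indep (set I))) labs None"
  have second: "den N oracles p_pick [enc_elems I, ?enc labs] = Some (enc_label best)"
    unfolding best_def by (rule den_pick[OF labs])
  have once: "augment_once left_indep right_indep cost es I = (case best of None \<Rightarrow> I
      | Some (d, P) \<Rightarrow> rev (filter (\<lambda>x. (x \<in> set I) \<noteq> (x \<in> set P)) es))"
    unfolding augment_once_def Let_def best_def labs_def by (rule refl)
  have "den N oracles p_augment [enc_elems es, enc_elems I] =
      den N oracles (PIf (PVar 0)
         (PFold (PIf (PIf (PApp p_mem_elem [PVar 0, PVar 5]) (pNot (PApp p_mem_elem [PVar 0, PSnd (PVar 2)]))
               (PApp p_mem_elem [PVar 0, PSnd (PVar 2)]))
             (PCons (PVar 0) (PVar 1)) (PVar 1)) (PVar 2) PNil)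
         (PVar 3)) [enc_label best, ?enc labs, enc_elems es, enc_elems I]"
    unfolding p_augment_def den.simps(12) first using second by simp
  also have "\<dots> = Some (enc_elems (augment_once left_indep right_indep cost es I))"
  proof (cases best)
    case None
    then have "augment_once left_indep right_indep cost es I = I"
      unfolding once by simp
    then show ?thesis using None by simp
  next
    case (Some dP)
    obtain d P where dP: "dP = (d, P)" by (rule prod.exhaust)
    have "\<exists>x. (x, Some (d, P)) \<in> set labs"
      using fold_pick[where T = "addable right_indep (set I)" and labs = labs and cur = None]
      unfolding best_def[symmetric] Some dP option.case prod.case by blast
    then obtain x where "(x, Some (d, P)) \<in> set labs" by (rule exE)
    from bspec[OF labs(3) this] have P: "length P \<le> N" by simp
    have aug: "augment_once left_indep right_indep cost es I = rev (filter (\<lambda>x. (x \<in> set I) \<noteq> (x \<in> set P)) es)"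
      unfolding once Some dP by simp
    have "den N oracles (PFold (PIf (PIf (PApp p_mem_elem [PVar 0, PVar 5]) (pNot (PApp p_mem_elem [PVar 0, PSnd (PVar 2)]))
               (PApp p_mem_elem [PVar 0, PSnd (PVar 2)]))
             (PCons (PVar 0) (PVar 1)) (PVar 1)) (PVar 2) PNil)
        [enc_label best, ?enc labs, enc_elems es, enc_elems I] =
      Some (enc_elems (fold (\<lambda>x acc. if (x \<in> set I) \<noteq> (x \<in> set P) then x # acc else acc) es []))"
      by (rule den_fold[where enc = enc_elem and h = enc_elems])
        (use lenes P in \<open>simp_all add: Some dP val_bool_def\<close>)
    then show ?thesis unfolding aug Some dP by (simp add: fold_filter)
  qed
  finally show ?thesis .
qed

end

lemma set_augment_once: "set I \<subseteq> set es \<Longrightarrow> set (augment_once A B c es I) \<subseteq> set es"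
  unfolding augment_once_def Let_def by (auto split: option.splits)

lemma den_intersect: "den N oracles p_intersect [enc_elems es] = Some (enc_elems (intersect left_indep right_indep cost es))"
  unfolding p_intersect_def intersect_def
proof (rule den_fold_inv[where enc = enc_elem and h = enc_elems and
      Inv = "\<lambda>I. set I \<subseteq> set es \<and> length I \<le> length es"])
  fix x I assume I: "set I \<subseteq> set es \<and> length I \<le> length es"
  then have "den N oracles p_augment [enc_elems es, enc_elems I] = Some (enc_elems (augment_once left_indep right_indep cost es I))"
    by (intro den_augment) auto
  then show "den N oracles (PApp p_augment [PVar 2, PVar 1]) [enc_elem x, enc_elems I, enc_elems es] =
      Some (enc_elems (augment_once left_indep right_indep cost es I)) \<and>
    (set (augment_once left_indep right_indep cost es I) \<subseteq> set es \<and> length (augment_once left_indep right_indep cost es I) \<le> length es)"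
    using I set_augment_once length_augment_once by auto
qed (use N in simp_all)

end

section \<open>Programs that root the tree and list the ground set\<close>

definition enc_edge :: "entry \<Rightarrow> val" where
  "enc_edge e = val_list [val_nat (fst e), val_nat (fst (snd e)), VNum (snd (snd e))]"

definition enc_entry :: "entry \<Rightarrow> val" where
  "enc_entry t = VCons (val_nat (fst t)) (VCons (val_nat (fst (snd t))) (VNum (snd (snd t))))"

abbreviation enc_entries :: "entry list \<Rightarrow> val" where "enc_entries ts \<equiv> val_list (map enc_entry ts)"
abbreviation enc_edges :: "entry list \<Rightarrow> val" where "enc_edges ts \<equiv> val_list (map enc_edge ts)"
abbreviation enc_pairs :: "(nat \<times> nat) list \<Rightarrow> val" where "enc_pairs xs \<equiv> val_list (map enc_node xs)"

lemma enc_entry_projections [simp]: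
  "val_fst (enc_entry t) = Some (val_nat (fst t))"
  "val_snd (enc_entry t) = Some (VCons (val_nat (fst (snd t))) (VNum (snd (snd t))))"
  "val_fst (enc_edge e) = Some (val_nat (fst e))"
  "val_snd (enc_edge e) = Some (VCons (val_nat (fst (snd e))) (VCons (VNum (snd (snd e))) VNil))"
  by (simp_all add: enc_entry_def enc_edge_def)

definition p_visited :: prog where
  "p_visited = PFold (pOr (PVar 1) (pEq (PFst (PVar 0)) (PVar 2))) (PVar 1) PNil"

lemma den_visited [simp]:
  assumes "length ts \<le> N"
  shows "den N orc p_visited [val_nat v, enc_entries ts] = Some (val_bool (v \<in> fst ` set ts))"
proof -
  have "den N orc p_visited [val_nat v, enc_entries ts] =
      Some (val_bool (fold (\<lambda>t s. s \<or> fst t = v) ts False))"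
    unfolding p_visited_def
    by (rule den_fold[where enc = enc_entry]) (use assms in \<open>auto simp: val_bool_def\<close>)
  moreover have "(\<exists>t\<in>set ts. fst t = v) \<longleftrightarrow> v \<in> fst ` set ts" by (auto simp: image_iff)
  ultimately show ?thesis by (simp add: fold_or)
qed

definition p_grow_edge :: prog where
  "p_grow_edge = PIf (PApp p_visited [PFst (PVar 0), PVar 1])
     (PIf (PApp p_visited [PFst (PSnd (PVar 0)), PVar 1]) (PVar 1)
       (PCons (PCons (PFst (PSnd (PVar 0))) (PCons (PFst (PVar 0)) (PFst (PSnd (PSnd (PVar 0)))))) (PVar 1)))
     (PIf (PApp p_visited [PFst (PSnd (PVar 0)), PVar 1])
       (PCons (PCons (PFst (PVar 0)) (PCons (PFst (PSnd (PVar 0))) (PFst (PSnd (PSnd (PVar 0)))))) (PVar 1))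
       (PVar 1))"

lemma den_grow_edge:
  assumes "length ts \<le> N"
  shows "den N orc p_grow_edge [enc_edge e, enc_entries ts] = Some (enc_entries (grow_edge e ts))"
proof -
  obtain u v x where e: "e = (u, v, x)" by (rule prod_cases3)
  show ?thesis using assms unfolding p_grow_edge_def grow_edge_def e
    by (simp add: enc_entry_def[of "(_, _)"])
qed

definition p_grow_tree :: prog where
  "p_grow_tree = PFold (PFold (PApp p_grow_edge [PVar 0, PVar 1]) (PVar 3) (PVar 1)) (PVar 0)
     (PCons (PCons (PFst (PVar 0)) (PCons (PFst (PVar 0)) PZero)) PNil)"

lemma grow_edge_invariant:
  assumes "distinct (map fst ts) \<and> fst ` set ts \<subseteq> U" "fst e \<in> U" "fst (snd e) \<in> U"
  shows "distinct (map fst (grow_edge e ts)) \<and> fst ` set (grow_edge e ts) \<subseteq> U"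
  using assms by (auto simp: grow_edge_def split: prod.splits)

text \<open>The entries have distinct vertices in \<open>U\<close>, so the growing list never
  exceeds \<open>card U\<close> and the folds over it stay within \<open>N\<close>.\<close>

lemma den_grow_tree:
  assumes vs: "vs \<noteq> []" "set vs \<subseteq> U" "length vs \<le> N" and es: "length es \<le> N"
    and U: "finite U" "card U \<le> N" "\<forall>e\<in>set es. fst e \<in> U \<and> fst (snd e) \<in> U"
  shows "den N orc p_grow_tree [enc_nats vs, enc_edges es] = Some (enc_entries (grow_tree vs es))"
proof -
  let ?Inv = "\<lambda>ts :: entry list. distinct (map fst ts) \<and> fst ` set ts \<subseteq> U"
  have len: "length ts \<le> N" if "?Inv ts" for ts
    using that distinct_card[of "map fst ts"] card_mono[OF U(1), of "fst ` set ts"] U(2) by simp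
  have fold_inv: "?Inv (fold grow_edge fs ts)" if "?Inv ts" "set fs \<subseteq> set es" for fs ts
    using that
  proof (induction fs arbitrary: ts)
    case (Cons f fs)
    have "?Inv (grow_edge f ts)" using Cons.prems U(3) by (intro grow_edge_invariant) auto
    then show ?case using Cons.IH[of "grow_edge f ts"] Cons.prems(2) by simp
  qed simp
  have inner: "den N orc (PFold (PApp p_grow_edge [PVar 0, PVar 1]) (PVar 3) (PVar 1))
      [val_nat z, enc_entries ts, enc_nats vs, enc_edges es] = Some (enc_entries (fold grow_edge es ts))"
    if ts: "?Inv ts" for z ts
  proof (rule den_fold_inv[where enc = enc_edge and h = enc_entries and Inv = ?Inv])
    fix e s assume e: "e \<in> set es" and s: "?Inv s"
    show "den N orc (PApp p_grow_edge [PVar 0, PVar 1])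
        [enc_edge e, enc_entries s, val_nat z, enc_entries ts, enc_nats vs, enc_edges es] =
        Some (enc_entries (grow_edge e s)) \<and> ?Inv (grow_edge e s)"
      using den_grow_edge[OF len[OF s], of orc e] grow_edge_invariant[OF s] e U(3) by simp
  qed (use ts es in simp_all)
  show ?thesis unfolding p_grow_tree_def grow_tree_def
  proof (rule den_fold_inv[where enc = val_nat and h = enc_entries and Inv = ?Inv])
    fix z s assume s: "?Inv s"
    show "den N orc (PFold (PApp p_grow_edge [PVar 0, PVar 1]) (PVar 3) (PVar 1))
        [val_nat z, enc_entries s, enc_nats vs, enc_edges es] = Some (enc_entries (fold grow_edge es s)) \<and>
      ?Inv (fold grow_edge es s)"
      using inner[OF s] fold_inv[OF s] by simp
  next
    show "den N orc (PCons (PCons (PFst (PVar 0)) (PCons (PFst (PVar 0)) PZero)) PNil)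
        [enc_nats vs, enc_edges es] = Some (enc_entries [(hd vs, hd vs, 0)])"
      using vs(1) by (cases vs) (simp_all add: enc_entry_def)
    show "?Inv [(hd vs, hd vs, 0)]" using vs by (cases vs) auto
  qed (use vs in simp_all)
qed

definition p_elem :: "prog \<Rightarrow> prog \<Rightarrow> prog \<Rightarrow> prog \<Rightarrow> prog \<Rightarrow> prog" where
  "p_elem i a j b c = PCons (PCons i a) (PCons (PCons j b) c)"

abbreviation PTwo :: prog where "PTwo \<equiv> PAdd POne POne"

definition p_ground :: prog where
  "p_ground = PFold (PFold
       (PCons (p_elem POne (PFst (PVar 2)) PTwo (PFst (PVar 0))
           (PIf (pEq (PFst (PVar 2)) (PFst (PVar 0))) (PSnd (PSnd (PVar 2)))
             (PAdd (PSnd (PSnd (PVar 2))) (PSnd (PSnd (PVar 0)))))) (PVar 1))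
       (PVar 2)
       (PCons (p_elem PZero (PFst (PVar 0)) POne (PFst (PVar 0)) PZero)
       (PCons (p_elem POne (PFst (PVar 0)) POne (PFst (PVar 0)) PZero)
       (PCons (p_elem POne (PFst (PVar 0)) POne (PFst (PSnd (PVar 0))) PZero)
       (PCons (p_elem PTwo (PFst (PVar 0)) PTwo (PFst (PVar 0)) PZero)
       (PCons (p_elem PTwo (PFst (PSnd (PVar 0))) PTwo (PFst (PVar 0)) PZero)
       (PCons (p_elem PTwo (PFst (PVar 0)) PZero (PFst (PVar 0)) PZero) (PVar 1)))))))) (PVar 0) PNil"

lemma den_ground:
  assumes "length ts \<le> N"
  shows "den N orc p_ground [enc_entries ts] = Some (enc_elems (ground_list ts))"
  unfolding p_ground_def ground_list_def
proof (rule den_fold[where enc = enc_entry and h = enc_elems], goal_cases)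
  case (4 vt s)
  show ?case
    by (rule den_fold[where enc = enc_entry and h = enc_elems])
      (use assms in \<open>simp_all add: p_elem_def enc_elem_def enc_node_def val_nat_def val_bool_def\<close>)
qed (use assms in simp_all)

section \<open>Programs that read off the partition\<close>

definition cut_list :: "elem list \<Rightarrow> nat list" where
  "cut_list I = fold (\<lambda>e acc. if fst (lft e) = 1 \<and> fst (rgt e) = 2
     then snd (lft e) # snd (rgt e) # acc else acc) I []"

definition p_cut :: prog where
  "p_cut = PFold (PIf (pAnd (pEq (PFst (PFst (PVar 0))) POne) (pEq (PFst (PFst (PSnd (PVar 0)))) PTwo))
     (PCons (PSnd (PFst (PVar 0))) (PCons (PSnd (PFst (PSnd (PVar 0)))) (PVar 1))) (PVar 1)) (PVar 0) PNil"

lemma real_eq_numeral: "real n \<le> 2 \<and> 2 \<le> real n \<longleftrightarrow> n = 2" "real n \<le> 1 \<and> 1 \<le> real n \<longleftrightarrow> n = 1"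
  by linarith+

lemma den_cut:
  assumes "length I \<le> N"
  shows "den N orc p_cut [enc_elems I] = Some (enc_nats (cut_list I))"
  unfolding p_cut_def cut_list_def
proof (rule den_fold[where enc = enc_elem and h = enc_nats], goal_cases)
  case (4 e s)
  show ?case
    using real_eq_numeral[of "fst (lft e)"] real_eq_numeral[of "fst (rgt e)"]
    by (simp add: val_bool_def)
qed (use assms in simp_all)

text \<open>Every crossing contributes two vertices, hence the factor 2 that returns in the bound
  \<open>N\<close>.\<close>

lemma length_cut_list: "length (cut_list I) \<le> 2 * length I"
proof -
  have "length (fold (\<lambda>e acc. if fst (lft e) = 1 \<and> fst (rgt e) = 2
     then snd (lft e) # snd (rgt e) # acc else acc) I acc) \<le> 2 * length I + length acc" for acc
  proof (induction I arbitrary: acc)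
    case (Cons e I)
    show ?case using Cons.IH[of "snd (lft e) # snd (rgt e) # acc"] Cons.IH[of acc] by simp
  qed simp
  from this[of "[]"] show ?thesis unfolding cut_list_def by simp
qed

lemma set_cut_list:
  "set (cut_list I) = (\<Union>e\<in>{e \<in> set I. fst (lft e) = 1 \<and> fst (rgt e) = 2}. {snd (lft e), snd (rgt e)})"
proof -
  have "set (fold (\<lambda>e acc. if fst (lft e) = 1 \<and> fst (rgt e) = 2
     then snd (lft e) # snd (rgt e) # acc else acc) I acc) = set acc \<union>
    (\<Union>e\<in>{e \<in> set I. fst (lft e) = 1 \<and> fst (rgt e) = 2}. {snd (lft e), snd (rgt e)})" for acc
  proof (induction I arbitrary: acc)
    case (Cons e I)
    have "{a \<in> set (e # I). fst (lft a) = 1 \<and> fst (rgt a) = 2} =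
      (if fst (lft e) = 1 \<and> fst (rgt e) = 2 then {e} else {}) \<union>
      {a \<in> set I. fst (lft a) = 1 \<and> fst (rgt a) = 2}" by auto
    then show ?case
      using Cons.IH[of "snd (lft e) # snd (rgt e) # acc"] Cons.IH[of acc] by auto
  qed simp
  from this[of "[]"] show ?thesis unfolding cut_list_def by simp
qed

text \<open>The last match wins; in all uses the second component is a function of the first. The
  default \<open>d\<close> covers missing keys.\<close>

definition look :: "nat \<Rightarrow> nat \<Rightarrow> (nat \<times> nat) list \<Rightarrow> nat" where
  "look d key xs = fold (\<lambda>x cur. if fst x = key then snd x else cur) xs d"

definition p_look :: prog where
  "p_look = PFold (PIf (pEq (PFst (PVar 0)) (PVar 3)) (PSnd (PVar 0)) (PVar 1)) (PVar 2) (PVar 0)"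

lemma den_look [simp]:
  assumes "length xs \<le> N"
  shows "den N orc p_look [val_nat d, val_nat key, enc_pairs xs] = Some (val_nat (look d key xs))"
  unfolding p_look_def look_def
  by (rule den_fold[where enc = enc_node and h = val_nat]) (use assms in \<open>auto simp: val_bool_def\<close>)

lemma look_default: "key \<notin> fst ` set xs \<Longrightarrow> look d key xs = d"
  unfolding look_def by (induction xs arbitrary: d) auto

lemma look_eq: "\<forall>x\<in>set xs. snd x = f (fst x) \<Longrightarrow> key \<in> fst ` set xs \<Longrightarrow> look d key xs = f key"
proof (induction xs arbitrary: d)
  case (Cons x xs)
  show ?case
  proof (cases "key \<in> fst ` set xs")
    case True
    then show ?thesis using Cons.IH Cons.prems(1) unfolding look_def by simp
  next
    case False
    then have "fst x = key" using Cons.prems(2) by auto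
    then show ?thesis using look_default[OF False, of "f key"] Cons.prems(1) unfolding look_def by simp
  qed
qed simp

text \<open>Entries are processed from the root outwards, so that the top of the parent is known
  when it is looked up. The root is recognized as its own parent.\<close>

definition top_list :: "nat list \<Rightarrow> entry list \<Rightarrow> (nat \<times> nat) list" where
  "top_list F ts = fold (\<lambda>t acc. (fst t, if fst t = fst (snd t) \<or> fst t \<in> set F then fst t
     else look (fst t) (fst (snd t)) acc) # acc) (rev ts) []"

definition p_rev :: prog where
  "p_rev = PFold (PCons (PVar 0) (PVar 1)) (PVar 0) PNil"

lemma den_rev [simp]:
  assumes "length xs \<le> N"
  shows "den N orc p_rev [val_list (map enc xs)] = Some (val_list (map enc (rev xs)))"
proof -
  have "den N orc p_rev [val_list (map enc xs)] = Some (val_list (map enc (fold (\<lambda>x acc. x # acc) xs [])))"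
    unfolding p_rev_def
    by (rule den_fold[where enc = enc and h = "\<lambda>acc. val_list (map enc acc)"]) (use assms in simp_all)
  then show ?thesis using fold_Cons_map[of "\<lambda>x. x" xs "[]"] by simp
qed

definition p_tops :: prog where
  "p_tops = PFold (PCons (PCons (PFst (PVar 0))
       (PIf (pOr (pEq (PFst (PVar 0)) (PFst (PSnd (PVar 0)))) (PApp p_mem_nat [PFst (PVar 0), PVar 2]))
         (PFst (PVar 0)) (PApp p_look [PFst (PVar 0), PFst (PSnd (PVar 0)), PVar 1]))) (PVar 1))
     (PApp p_rev [PVar 1]) PNil"

text \<open>A bound on the length of the state is no invariant when every step lengthens the state;
  the remaining entries are counted along instead.\<close>

lemma bounded_fold_length:
  assumes "length xs \<le> n" and "length a + length xs \<le> N"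
    and "\<And>x s. x \<in> set xs \<Longrightarrow> length s \<le> N \<Longrightarrow>
      f (enc x) (h s) = Some (h (g x s)) \<and> length (g x s) = Suc (length s)"
  shows "bounded_fold n f (val_list (map enc xs)) (h a) = Some (h (fold g xs a))"
  using assms
proof (induction xs arbitrary: n a)
  case (Cons x xs)
  then obtain m where n: "n = Suc m" by (cases n) auto
  have "f (enc x) (h a) = Some (h (g x a)) \<and> length (g x a) = Suc (length a)"
    using Cons.prems(2) by (intro Cons.prems(3)) auto
  then show ?case using Cons.IH[of m "g x a"] Cons.prems n by simp
qed simp

lemma den_tops:
  assumes "length F \<le> N" "length ts \<le> N"
  shows "den N orc p_tops [enc_nats F, enc_entries ts] = Some (enc_pairs (top_list F ts))"
proof -
  let ?b = "PCons (PCons (PFst (PVar 0))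
       (PIf (pOr (pEq (PFst (PVar 0)) (PFst (PSnd (PVar 0)))) (PApp p_mem_nat [PFst (PVar 0), PVar 2]))
         (PFst (PVar 0)) (PApp p_look [PFst (PVar 0), PFst (PSnd (PVar 0)), PVar 1]))) (PVar 1)"
  let ?g = "\<lambda>t acc. (fst t, if fst t = fst (snd t) \<or> fst t \<in> set F then fst t
     else look (fst t) (fst (snd t)) acc) # acc"
  have "bounded_fold N (\<lambda>x a. den N orc ?b [x, a, enc_nats F, enc_entries ts])
      (val_list (map enc_entry (rev ts))) (enc_pairs []) = Some (enc_pairs (fold ?g (rev ts) []))"
  proof (rule bounded_fold_length)
    fix t s assume "length (s :: (nat \<times> nat) list) \<le> N"
    then show "den N orc ?b [enc_entry t, enc_pairs s, enc_nats F, enc_entries ts] =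
        Some (enc_pairs (?g t s)) \<and> length (?g t s) = Suc (length s)"
      using assms(1) by (auto simp: val_bool_def enc_node_def)
  qed (use assms in simp_all)
  then show ?thesis using assms(2) unfolding p_tops_def top_list_def by simp
qed

definition p_map_look :: prog where
  "p_map_look = PFold (PCons (PApp p_look [PVar 0, PVar 0, PVar 2]) (PVar 1)) (PVar 1) PNil"

lemma den_map_look [simp]:
  assumes "length tops \<le> N" "length bs \<le> N"
  shows "den N orc p_map_look [enc_pairs tops, enc_nats bs] =
    Some (enc_nats (rev (map (\<lambda>b. look b b tops) bs)))"
proof -
  have "den N orc p_map_look [enc_pairs tops, enc_nats bs] =
    Some (enc_nats (fold (\<lambda>b acc. look b b tops # acc) bs []))"
    unfolding p_map_look_def
    by (rule den_fold[where enc = val_nat and h = enc_nats]) (use assms in simp_all)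
  then show ?thesis by (simp add: fold_Cons_map)
qed

definition p_minus :: prog where
  "p_minus = PFold (PIf (PApp p_mem_nat [PVar 0, PVar 3]) (PVar 1) (PCons (PVar 0) (PVar 1))) (PVar 0) PNil"

lemma den_minus [simp]:
  assumes "length xs \<le> N" "length ys \<le> N"
  shows "den N orc p_minus [enc_nats xs, enc_nats ys] = Some (enc_nats (rev (filter (\<lambda>x. x \<notin> set ys) xs)))"
proof -
  have "den N orc p_minus [enc_nats xs, enc_nats ys] =
    Some (enc_nats (fold (\<lambda>x acc. if x \<notin> set ys then x # acc else acc) xs []))"
    unfolding p_minus_def
    by (rule den_fold[where enc = val_nat and h = enc_nats]) (use assms in \<open>simp_all add: val_bool_def\<close>)
  then show ?thesis by (simp add: fold_filter)
qed

text \<open>A zip in the form of a fold, with the rest of \<open>ys\<close> kept in the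
  state.\<close>

definition pair_up :: "nat list \<Rightarrow> nat list \<Rightarrow> (nat \<times> nat) list" where
  "pair_up xs ys = snd (fold (\<lambda>t s. if fst s = [] then s else (tl (fst s), (t, hd (fst s)) # snd s)) xs (ys, []))"

definition p_pair_up :: prog where
  "p_pair_up = PSnd (PFold (PIf (PFst (PVar 1))
     (PCons (PSnd (PFst (PVar 1))) (PCons (PCons (PVar 0) (PFst (PFst (PVar 1)))) (PSnd (PVar 1))))
     (PVar 1)) (PVar 0) (PCons (PVar 1) PNil))"

lemma den_pair_up [simp]:
  assumes "length xs \<le> N"
  shows "den N orc p_pair_up [enc_nats xs, enc_nats ys] = Some (enc_pairs (pair_up xs ys))"
proof -
  let ?h = "\<lambda>s :: nat list \<times> (nat \<times> nat) list. VCons (enc_nats (fst s)) (enc_pairs (snd s))"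
  have "den N orc (PFold (PIf (PFst (PVar 1))
     (PCons (PSnd (PFst (PVar 1))) (PCons (PCons (PVar 0) (PFst (PFst (PVar 1)))) (PSnd (PVar 1))))
     (PVar 1)) (PVar 0) (PCons (PVar 1) PNil)) [enc_nats xs, enc_nats ys] =
    Some (?h (fold (\<lambda>t s. if fst s = [] then s else (tl (fst s), (t, hd (fst s)) # snd s)) xs (ys, [])))"
  proof (rule den_fold[where enc = val_nat and h = ?h], goal_cases)
    case (4 x s)
    show ?case by (cases "fst s") (simp_all add: enc_node_def)
  qed (use assms in simp_all)
  then show ?thesis unfolding p_pair_up_def pair_up_def by simp
qed

lemma pair_up: "length xs \<le> length ys \<Longrightarrow> pair_up xs ys = rev (zip xs ys)"
proof -
  have "snd (fold (\<lambda>t s. if fst s = [] then s else (tl (fst s), (t, hd (fst s)) # snd s)) xs (ys, as)) =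
      rev (zip xs ys) @ as" if "length xs \<le> length ys" for as
    using that
  proof (induction xs arbitrary: ys as)
    case (Cons x xs)
    then show ?case by (cases ys) simp_all
  qed simp
  then show "length xs \<le> length ys \<Longrightarrow> ?thesis" unfolding pair_up_def by simp
qed

text \<open>Plays the part of \<open>g\<close> in \<open>labelled_partition\<close>. The default
  \<open>hd L1\<close> puts all components without terminals into one part.\<close>

definition glue :: "nat list \<Rightarrow> (nat \<times> nat) list \<Rightarrow> nat \<Rightarrow> nat" where
  "glue L1 as t = (if t \<in> set L1 then t else look (hd L1) t as)"

definition p_glue :: prog where
  "p_glue = PIf (PApp p_mem_nat [PVar 2, PVar 0]) (PVar 2) (PApp p_look [PFst (PVar 0), PVar 2, PVar 1])"

lemma den_glue [simp]:
  assumes "length L1 \<le> N" "length as \<le> N" "L1 \<noteq> []"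
  shows "den N orc p_glue [enc_nats L1, enc_pairs as, val_nat t] = Some (val_nat (glue L1 as t))"
proof -
  have "val_fst (enc_nats L1) = Some (val_nat (hd L1))" using assms(3) by (cases L1) simp_all
  then show ?thesis using assms unfolding p_glue_def glue_def by simp
qed

definition p_parts :: prog where
  "p_parts = PFold (PCons (PFold
       (PIf (pEq (PApp p_glue [PVar 5, PVar 6, PSnd (PVar 0)]) (PVar 2)) (PCons (PFst (PVar 0)) (PVar 1)) (PVar 1))
       (PVar 2) PNil) (PVar 1)) (PVar 1) PNil"

definition part_list :: "(nat \<times> nat) list \<Rightarrow> nat list \<Rightarrow> (nat \<times> nat) list \<Rightarrow> nat list list" where
  "part_list tops L1 as = rev (map (\<lambda>l. rev (map fst (filter (\<lambda>x. glue L1 as (snd x) = l) tops))) L1)"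

lemma fold_filter_map: "fold (\<lambda>x acc. if P x then f x # acc else acc) xs acc = rev (map f (filter P xs)) @ acc"
  by (induction xs arbitrary: acc) auto

lemma den_parts:
  assumes "length tops \<le> N" "length L1 \<le> N" "length as \<le> N" "L1 \<noteq> []"
  shows "den N orc p_parts [enc_pairs tops, enc_nats L1, enc_pairs as] =
    Some (val_list (map enc_nats (part_list tops L1 as)))"
proof -
  let ?inner = "PFold
       (PIf (pEq (PApp p_glue [PVar 5, PVar 6, PSnd (PVar 0)]) (PVar 2)) (PCons (PFst (PVar 0)) (PVar 1)) (PVar 1))
       (PVar 2) PNil"
  have inner: "den N orc ?inner [val_nat l, acc, enc_pairs tops, enc_nats L1, enc_pairs as] =
      Some (enc_nats (rev (map fst (filter (\<lambda>x. glue L1 as (snd x) = l) tops))))" for l acc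
  proof -
    have "den N orc ?inner [val_nat l, acc, enc_pairs tops, enc_nats L1, enc_pairs as] =
      Some (enc_nats (fold (\<lambda>x acc. if glue L1 as (snd x) = l then fst x # acc else acc) tops []))"
      by (rule den_fold[where enc = enc_node and h = enc_nats])
        (use assms in \<open>auto simp: val_bool_def\<close>)
    then show ?thesis by (simp add: fold_filter_map)
  qed
  have "den N orc p_parts [enc_pairs tops, enc_nats L1, enc_pairs as] =
    Some (val_list (map enc_nats
      (fold (\<lambda>l acc. rev (map fst (filter (\<lambda>x. glue L1 as (snd x) = l) tops)) # acc) L1 [])))"
    unfolding p_parts_def
  proof (rule den_fold[where enc = val_nat and h = "\<lambda>ps. val_list (map enc_nats ps)"], goal_cases)
    case (4 l s)
    show ?case unfolding den.simps(5) inner by simp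
  qed (use assms in simp_all)
  then show ?thesis by (simp add: fold_Cons_map part_list_def)
qed

definition p_output :: prog where
  "p_output = PLet (PApp p_tops [PApp p_cut [PVar 1], PVar 0])
     (PLet (PApp p_map_look [PVar 0, PApp (p_terminals True) [PVar 2]])
       (PLet (PApp p_map_look [PVar 1, PApp (p_terminals False) [PVar 3]])
         (PApp p_parts [PVar 2, PVar 1,
           PApp p_pair_up [PApp p_minus [PVar 0, PVar 1], PApp p_minus [PVar 1, PVar 0]]])))"

text \<open>Tops of the second basis alone are paired with tops of the first alone; common tops keep
  their own component.\<close>

definition solution :: "entry list \<Rightarrow> elem list \<Rightarrow> nat list list" where
  "solution ts I =
     (let tops = top_list (cut_list I) ts;
          L1 = rev (map (\<lambda>b. look b b tops) (terminal_list True I));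
          L2 = rev (map (\<lambda>b. look b b tops) (terminal_list False I))
      in part_list tops L1 (pair_up (rev (filter (\<lambda>x. x \<notin> set L1) L2)) (rev (filter (\<lambda>x. x \<notin> set L2) L1))))"

text \<open>For \<open>k = 0\<close> there is no partition into \<open>k\<close> parts, as a tree
  has a vertex. For \<open>k \<ge> 1\<close> a feasible partition always exists, so the comparison
  with 1 decides feasibility.\<close>

definition p_main :: prog where
  "p_main = PIf (PLeq POne (PFst (PSnd (PSnd (PVar 0)))))
     (PLet (PApp p_grow_tree [PFst (PVar 0), PFst (PSnd (PVar 0))])
       (PApp p_output [PVar 0, PApp p_intersect [PApp p_ground [PVar 0]]]))
     PZero"

lemma length_terminal_list: "length (terminal_list b xs) \<le> length xs"
proof -
  have "set (terminal_list b xs) \<subseteq> (\<lambda>e. snd (side b e)) ` set xs"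
  proof
    fix v assume "v \<in> set (terminal_list b xs)"
    then obtain e where "e \<in> set xs" "(0, v) = side b e" unfolding terminal_list(2) terminals_def by blast
    then show "v \<in> (\<lambda>e. snd (side b e)) ` set xs" by (intro image_eqI[of _ _ e]) (metis snd_conv)
  qed
  then have "card (set (terminal_list b xs)) \<le> card ((\<lambda>e. snd (side b e)) ` set xs)"
    by (intro card_mono) auto
  also have "\<dots> \<le> length xs" using card_image_le[of "set xs"] card_length[of xs] by (meson finite_set le_trans)
  finally show ?thesis using distinct_card[OF terminal_list(1)] by simp
qed

lemma length_top_list: "length (top_list F ts) = length ts"
proof -
  have "length (fold (\<lambda>t acc. (fst t, if fst t = fst (snd t) \<or> fst t \<in> set F then fst t
     else look (fst t) (fst (snd t)) acc) # acc) us acc) = length us + length acc" for us :: "entry list" and acc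
    by (induction us arbitrary: acc) auto
  then show ?thesis unfolding top_list_def by simp
qed

lemma length_pair_up: "length (pair_up xs ys) \<le> length xs"
proof -
  have "length (snd (fold (\<lambda>t s. if fst s = [] then s else (tl (fst s), (t, hd (fst s)) # snd s)) xs s)) \<le>
      length xs + length (snd s)" for s :: "nat list \<times> (nat \<times> nat) list"
  proof (induction xs arbitrary: s)
    case (Cons x xs)
    show ?case
      using Cons.IH[of s] Cons.IH[of "(tl (fst s), (x, hd (fst s)) # snd s)"] by (cases "fst s = []") simp_all
  qed simp
  from this[of "(ys, [])"] show ?thesis unfolding pair_up_def by simp
qed

lemma den_output:
  assumes "length ts \<le> N" "2 * length I \<le> N" "terminal_list True I \<noteq> []"
  shows "den N orc p_output [enc_entries ts, enc_elems I] = Some (val_list (map enc_nats (solution ts I)))"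
proof -
  define tops where "tops = top_list (cut_list I) ts"
  define L1 L2 where "L1 = rev (map (\<lambda>b. look b b tops) (terminal_list True I))"
    and "L2 = rev (map (\<lambda>b. look b b tops) (terminal_list False I))"
  define as where "as = pair_up (rev (filter (\<lambda>x. x \<notin> set L1) L2)) (rev (filter (\<lambda>x. x \<notin> set L2) L1))"
  have len: "length I \<le> N" "length (cut_list I) \<le> N" "length tops \<le> N" "length L1 \<le> N" "length L2 \<le> N"
    "length (terminal_list True I) \<le> N" "length (terminal_list False I) \<le> N"
    using assms length_cut_list[of I] length_terminal_list[of True I] length_terminal_list[of False I]
    unfolding tops_def L1_def L2_def by (simp_all add: length_top_list)
  have lenf: "length (rev (filter (\<lambda>x. x \<notin> set L1) L2)) \<le> N"
    using le_trans[OF length_filter_le len(5)] by simp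
  have lenas: "length as \<le> N" unfolding as_def using length_pair_up lenf by (rule le_trans)
  have ne: "L1 \<noteq> []" unfolding L1_def using assms(3) by simp
  have 1: "den N orc p_tops [enc_nats (cut_list I), enc_entries ts] = Some (enc_pairs tops)"
    unfolding tops_def using len assms(1) by (intro den_tops) auto
  have 2: "den N orc p_cut [enc_elems I] = Some (enc_nats (cut_list I))" using len by (intro den_cut)
  have 3: "den N orc p_map_look [enc_pairs tops, enc_nats (terminal_list True I)] = Some (enc_nats L1)"
    "den N orc p_map_look [enc_pairs tops, enc_nats (terminal_list False I)] = Some (enc_nats L2)"
    unfolding L1_def L2_def using len by (intro den_map_look; simp)+
  have 4: "den N orc p_pair_up [enc_nats (rev (filter (\<lambda>x. x \<notin> set L1) L2)),
      enc_nats (rev (filter (\<lambda>x. x \<notin> set L2) L1))] = Some (enc_pairs as)"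
    unfolding as_def using lenf by (rule den_pair_up)
  have 5: "den N orc p_parts [enc_pairs tops, enc_nats L1, enc_pairs as] =
      Some (val_list (map enc_nats (part_list tops L1 as)))"
    using len lenas ne by (intro den_parts)
  have out: "solution ts I = part_list tops L1 as"
    unfolding solution_def Let_def tops_def[symmetric] L1_def[symmetric] L2_def[symmetric] as_def[symmetric] ..
  have 6: "den N orc p_minus [enc_nats L2, enc_nats L1] = Some (enc_nats (rev (filter (\<lambda>x. x \<notin> set L1) L2)))"
    "den N orc p_minus [enc_nats L1, enc_nats L2] = Some (enc_nats (rev (filter (\<lambda>x. x \<notin> set L2) L1)))"
    using len by (intro den_minus; simp)+
  have 7: "den N orc (p_terminals True) [enc_elems I] = Some (enc_nats (terminal_list True I))"
    "den N orc (p_terminals False) [enc_elems I] = Some (enc_nats (terminal_list False I))"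
    using len by (intro den_terminals; simp)+
  show ?thesis unfolding p_output_def out by (simp add: 1 2 3 4 5 6 7)
qed

section \<open>Correctness\<close>

text \<open>Induction over the growth: the parent already has its entry, and an uncut vertex other
  than the root has the top of its parent.\<close>

lemma top_list:
  assumes R: "rooted_tree V r par pos w" and G: "grown E w r ts"
    and ts: "\<forall>(v, p, x)\<in>set ts. v \<in> V \<and> p = (if v = r then r else par v)"
  shows "fst ` set (top_list F ts) = fst ` set ts \<and>
    (\<forall>x\<in>set (top_list F ts). snd x = rooted_tree.top_of V r par (set F) (fst x))"
  using G ts
proof (induction rule: grown.induct)
  case 1
  interpret rooted_tree V r par pos w by fact
  show ?case using top_self[OF root, of "set F"] by (simp add: top_list_def)
next
  case (2 ts p v)
  interpret rooted_tree V r par pos w by fact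
  have IH: "fst ` set (top_list F ts) = fst ` set ts"
    "\<forall>x\<in>set (top_list F ts). snd x = top_of (set F) (fst x)"
    using "2.IH" "2.prems" by auto
  have "v \<noteq> r" using 2(3) imageI[OF grown_root[OF 2(1)], of fst] by auto
  then have v: "v \<in> V" "p = par v" using "2.prems" by auto
  have ne: "v \<noteq> p" using pos[OF v(1) \<open>v \<noteq> r\<close>] v(2) by auto
  have "top_list F ((v, p, w {v, p}) # ts) =
      (v, if v \<in> set F then v else look v p (top_list F ts)) # top_list F ts"
    using ne by (simp add: top_list_def)
  moreover have "(if v \<in> set F then v else look v p (top_list F ts)) = top_of (set F) v"
  proof (cases "v \<in> set F")
    case True
    then show ?thesis using top_self[OF v(1), of "set F"] by simp
  next
    case False
    have "look v p (top_list F ts) = top_of (set F) p"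
      using look_eq[OF IH(2), of p v] IH(1) 2(2) by simp
    then show ?thesis using top_par[OF v(1), of "set F"] False \<open>v \<noteq> r\<close> v(2) by simp
  qed
  ultimately show ?case using IH by simp
qed

text \<open>The solution costs at most \<open>2 * sum \<omega> F\<close>, which is at most twice the
  cost of the matching \<open>X\<close>. Any feasible \<open>P\<close> yields a matching of the same
  size that costs at most half as much as \<open>P\<close>, and \<open>X\<close> is a cheapest
  one.\<close>

theorem solution_optimal:
  assumes inst: "dmmc_instance V E w k I1 I2" and T: "tree V E" and k: "1 \<le> k"
    and G: "grown E w r ts" "fst ` set ts = V"
    and X: "X = intersect (side_indep (set (ground_list ts)) lft I1) (side_indep (set (ground_list ts)) rgt I2)
      cost (ground_list ts)"
  shows "dmmc_optimal V E w k I1 I2 (set (map set (solution ts X)))" "terminal_list True X \<noteq> []"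
proof -
  have M: "matroid V I1" "matroid V I2" and rk: "matroid_rank I1 = k" "matroid_rank I2 = k"
    and nonneg: "\<forall>e\<in>E. 0 \<le> w e"
    using inst unfolding dmmc_instance_def by auto
  obtain par pos where R: "rooted_tree V r par pos w" and edges: "rooted_tree.edges V r par = E"
    and entries: "\<And>v p x. (v, p, x) \<in> set ts \<Longrightarrow> p = (if v = r then r else par v)"
    and ground: "set (ground_list ts) = rooted_tree.ground V r par w"
    using grown_rooted_tree[OF G(1) T G(2) nonneg] by metis
  interpret rooted_tree V r par pos w by fact
  let ?A = "side_indep ground lft I1" and ?B = "side_indep ground rgt I2"
  let ?X = "set X"
  have MA: "matroid (set (ground_list ts)) ?A" and MB: "matroid (set (ground_list ts)) ?B"
    unfolding \<open>set (ground_list ts) = ground\<close> using side_matroid[OF finite_ground] M by auto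
  have X': "X = intersect ?A ?B cost (ground_list ts)" unfolding X ground ..
  note opt = intersect_optimal[OF MA MB, where c = cost, folded X']
  obtain B1 B2 where B: "B1 \<in> bases I1" "B2 \<in> bases I2"
    using bases_nonempty M by blast
  have cB: "card B1 = k" "card B2 = k" and BV: "B1 \<subseteq> V" "B2 \<subseteq> V"
    using B bases_iff[OF M(1)] bases_iff[OF M(2)] rk matroid_carrier[OF M(1)] matroid_carrier[OF M(2)] by auto
  have fB: "finite B1" "finite B2" using BV finite_V finite_subset by auto
  \<comment> \<open>Cut all edges, so that every vertex is its own top. The basis \<open>B2\<close>
    is sent to \<open>B1\<close> by a bijection, and the remaining vertices join
    \<open>b0\<close>.\<close>
  have "\<exists>Q. dmmc_feasible V k I1 I2 Q"
  proof -
    obtain \<sigma> where \<sigma>: "bij_betw \<sigma> B2 B1" "\<And>x. x \<in> B2 \<inter> B1 \<Longrightarrow> \<sigma> x = x"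
      using bij_fixing_common[OF fB(2,1)] cB by metis
    have "B1 \<noteq> {}" using cB k by auto
    then obtain b0 where b0: "b0 \<in> B1" by blast
    define g where "g t = (if t \<in> B1 then t else if t \<in> B2 then \<sigma> t else b0)" for t
    have self: "top_of V v = v" if "v \<in> V" for v using top_self[of v V] that by simp
    have tops: "top_of V ` B1 = B1" "top_of V ` B2 = B2" "inj_on (top_of V) B1" "inj_on (top_of V) B2"
      using self BV by (auto simp: inj_on_def subset_iff image_iff)
    have "inj_on g B2"
    proof (rule inj_on_cong[THEN iffD1])
      show "inj_on \<sigma> B2" using \<sigma>(1) unfolding bij_betw_def by blast
      show "\<sigma> a = g a" if "a \<in> B2" for a using that \<sigma>(2) unfolding g_def by auto
    qed
    moreover have "g (top_of V v) \<in> B1" if "v \<in> V" for v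
      using b0 \<sigma>(1) unfolding g_def bij_betw_def by auto
    ultimately show ?thesis
      using labelled_partition(1)[OF M rk B subset_refl tops(3,4), of g, unfolded tops(1,2), OF _ _ _ refl]
      unfolding g_def by auto
  qed
  then obtain Q0 where Q0: "dmmc_feasible V k I1 I2 Q0" ..
  obtain J0 where "J0 \<in> ?A" "J0 \<in> ?B" "card J0 = 2 * card V + k"
    using matching_of_partition[OF M rk Q0] by blast
  \<comment> \<open>A feasible partition shows that the upper bound on the size of a matching is
    attained, so \<open>X\<close> is a full matching.\<close>
  then have "2 * card V + k \<le> card ?X" using opt(3) by fastforce
  then have cX: "card ?X = 2 * card V + k" using matching_card_le[OF M(1) opt(1)] rk by simp
  note sep = matching_separates[OF M rk opt(1,2) cX]
  define F where "F = cut_of ?X"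
  have F: "set (cut_list X) = F" unfolding F_def set_cut_list cut_of_def ..
  define tops where "tops = top_list (cut_list X) ts"
  have "\<forall>(v, p, x)\<in>set ts. v \<in> V \<and> p = (if v = r then r else par v)"
    using entries G(2) by force
  from top_list[OF R G(1) this, of "cut_list X"]
  have tops: "fst ` set tops = V" "\<forall>x\<in>set tops. snd x = top_of F (fst x)"
    using G(2) unfolding tops_def F by auto
  have look_top: "look b b tops = top_of F b" if "b \<in> V" for b
    using look_eq[OF tops(2)] tops(1) that by simp
  let ?B1 = "terminals lft ?X" and ?B2 = "terminals rgt ?X"
  have t1: "set (terminal_list True X) = ?B1" "set (terminal_list False X) = ?B2"
    using terminal_list(2)[of True X] terminal_list(2)[of False X] by (simp_all add: side_def)
  have TV: "?B1 \<subseteq> V" "?B2 \<subseteq> V" and cT: "card ?B1 = k" "card ?B2 = k"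
    using sep(1,2) bases_iff[OF M(1)] bases_iff[OF M(2)] rk matroid_carrier[OF M(1)] matroid_carrier[OF M(2)] by auto
  show "terminal_list True X \<noteq> []" using t1(1) cT(1) k by auto
  define L1 L2 where "L1 = rev (map (\<lambda>b. look b b tops) (terminal_list True X))"
    and "L2 = rev (map (\<lambda>b. look b b tops) (terminal_list False X))"
  have L: "L1 = rev (map (top_of F) (terminal_list True X))" "L2 = rev (map (top_of F) (terminal_list False X))"
    unfolding L1_def L2_def using look_top TV t1 by (auto intro!: map_cong)
  have setL: "set L1 = top_of F ` ?B1" "set L2 = top_of F ` ?B2" unfolding L using t1 by auto
  have dL: "distinct L1" "distinct L2"
    unfolding L using sep(3,4) terminal_list(1) t1 by (simp_all add: distinct_map F_def)
  have lenL: "length L1 = k" "length L2 = k"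
    using distinct_card[OF terminal_list(1), of True X] distinct_card[OF terminal_list(1), of False X] t1 cT
    unfolding L by auto
  define M1 M2 where "M1 = rev (filter (\<lambda>x. x \<notin> set L2) L1)" and "M2 = rev (filter (\<lambda>x. x \<notin> set L1) L2)"
  have setM: "set M1 = set L1 - set L2" "set M2 = set L2 - set L1" "distinct M1" "distinct M2"
    unfolding M1_def M2_def using dL by auto
  have lenM: "length M1 = length M2"
  proof -
    have "card (set L1 - set L2) = card (set L2 - set L1)"
      using card_Diff_subset_Int[of "set L1" "set L2"] card_Diff_subset_Int[of "set L2" "set L1"]
        distinct_card[OF dL(1)] distinct_card[OF dL(2)] lenL by (simp add: Int_commute[of "set L2"])
    then show ?thesis using distinct_card[OF setM(3)] distinct_card[OF setM(4)] setM(1,2) by simp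
  qed
  define as where "as = pair_up M2 M1"
  define \<tau> where "\<tau> t = the (map_of (zip M2 M1) t)" for t
  have as: "as = rev (zip M2 M1)" unfolding as_def using lenM by (intro pair_up) simp
  have \<tau>_nth: "\<tau> (M2 ! i) = M1 ! i" if "i < length M2" for i
    unfolding \<tau>_def using map_of_zip_nth[OF _ setM(4), of M1 i] lenM that by simp
  have map\<tau>: "map \<tau> M2 = M1" using lenM \<tau>_nth by (intro nth_equalityI) auto
  have \<tau>: "inj_on \<tau> (set M2)" "\<tau> ` set M2 = set M1"
    using map\<tau> setM(3) distinct_map[of \<tau> M2] by (auto simp flip: set_map)
  have as_entries: "\<forall>x\<in>set as. snd x = \<tau> (fst x)" "fst ` set as = set M2"
  proof -
    show "\<forall>x\<in>set as. snd x = \<tau> (fst x)"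
      unfolding as using \<tau>_nth lenM by (auto simp: set_zip)
    have "map fst (zip M2 M1) = M2" using lenM by simp
    then show "fst ` set as = set M2" unfolding as by (metis set_map set_rev)
  qed
  define g where "g = glue L1 as"
  have ne: "L1 \<noteq> []" using lenL(1) k by auto
  have g1: "g t = t" if "t \<in> set L1" for t using that unfolding g_def glue_def by simp
  have g2: "g t = \<tau> t" if "t \<in> set M2" for t
    using that setM(2) look_eq[OF as_entries(1), of t] as_entries(2) unfolding g_def glue_def by simp
  have g3: "g t \<in> set L1" for t
  proof (cases "t \<in> set L1")
    case False
    show ?thesis
    proof (cases "t \<in> set M2")
      case True
      then show ?thesis using g2[OF True] \<tau>(2) setM(1) by auto
    next
      case f: False
      then show ?thesis using look_default[of t as "hd L1"] as_entries(2) False ne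
        unfolding g_def glue_def by simp
    qed
  qed (use g1 in simp)
  have g_inj: "inj_on g (set L2)"
  proof (rule inj_onI)
    fix s t assume st: "s \<in> set L2" "t \<in> set L2" "g s = g t"
    have *: False if "x \<in> set L2" "x \<in> set L1" "y \<in> set L2" "y \<notin> set L1" "g x = g y" for x y
    proof -
      have "g y \<in> set M1" using g2[of y] \<tau>(2) setM(2) that by auto
      then show False using that g1[of x] setM(1) by auto
    qed
    consider "s \<in> set L1" "t \<in> set L1" | "s \<in> set M2" "t \<in> set M2"
      | "s \<in> set L1" "t \<notin> set L1" | "s \<notin> set L1" "t \<in> set L1" using st setM(2) by blast
    then show "s = t"
    proof cases
      case 1
      then show ?thesis using g1 st(3) by simp
    next
      case 2
      then show ?thesis using g2 st(3) \<tau>(1) by (auto dest: inj_onD)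
    next
      case 3
      then show ?thesis using *[of s t] st by blast
    next
      case 4
      then show ?thesis using *[of t s] st by simp
    qed
  qed
  have sol: "solution ts X = part_list tops L1 as"
    unfolding solution_def Let_def tops_def[symmetric] L1_def[symmetric] L2_def[symmetric]
      M1_def[symmetric] M2_def[symmetric] as_def[symmetric] ..
  let ?Q = "(\<lambda>l. {v \<in> V. g (top_of F v) = l}) ` top_of F ` ?B1"
  have part: "set (rev (map fst (filter (\<lambda>x. g (snd x) = l) tops))) = {v \<in> V. g (top_of F v) = l}" for l
  proof (intro equalityI subsetI)
    fix v assume "v \<in> set (rev (map fst (filter (\<lambda>x. g (snd x) = l) tops)))"
    then obtain x where "x \<in> set tops" "g (snd x) = l" "v = fst x" by auto
    then show "v \<in> {v \<in> V. g (top_of F v) = l}" using tops by auto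
  next
    fix v assume v: "v \<in> {v \<in> V. g (top_of F v) = l}"
    then obtain x where x: "x \<in> set tops" "v = fst x" using tops(1) by auto
    then have "g (snd x) = l" using v tops(2) by simp
    then show "v \<in> set (rev (map fst (filter (\<lambda>x. g (snd x) = l) tops)))" using x by auto
  qed
  have Q: "set (map set (solution ts X)) = ?Q"
    unfolding sol part_list_def g_def[symmetric] setL(1)[symmetric]
    by (simp only: set_map set_rev image_image part[unfolded set_map set_rev])
  have feas: "dmmc_feasible V k I1 I2 ?Q" "(\<Sum>Y\<in>?Q. cut_weight edges w Y) \<le> 2 * sum \<omega> F"
  proof -
    note lp = labelled_partition[OF M rk sep(1,2,6,3,4), folded F_def, of g, OF _ _ _ refl]
    show "dmmc_feasible V k I1 I2 ?Q" "(\<Sum>Y\<in>?Q. cut_weight edges w Y) \<le> 2 * sum \<omega> F"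
      using g1 g3 g_inj unfolding setL by (intro lp; simp)+
  qed
  have "(\<Sum>Y\<in>?Q. cut_weight edges w Y) \<le> (\<Sum>Y\<in>P. cut_weight edges w Y)"
    if P: "dmmc_feasible V k I1 I2 P" for P
  proof -
    obtain J where J: "J \<in> ?A" "J \<in> ?B" "card J = 2 * card V + k"
      "2 * sum cost J \<le> (\<Sum>Y\<in>P. cut_weight edges w Y)"
      using matching_of_partition[OF M rk P] by blast
    have "sum cost ?X \<le> sum cost J" using opt(4)[OF J(1,2)] J(3) cX by simp
    then show ?thesis using J(4) feas(2) sep(5) unfolding F_def by linarith
  qed
  then show "dmmc_optimal V E w k I1 I2 (set (map set (solution ts X)))"
    unfolding dmmc_optimal_def Q using feas(1) \<open>edges = E\<close> by simp
qed

theorem theorem10: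
  shows "\<exists>(main :: expr) (fs :: expr list) (p :: nat poly).
    \<forall>(V :: nat set) (E :: nat set set) (w :: nat set \<Rightarrow> real) (k :: nat)
      (I\<^sub>1 :: nat set set) (I\<^sub>2 :: nat set set) (x :: val).
      dmmc_instance V E w k I\<^sub>1 I\<^sub>2 \<longrightarrow> tree V E \<longrightarrow> dmmc_input V E w k x \<longrightarrow>
        (\<exists>y t. eval fs (independence_oracles I\<^sub>1 I\<^sub>2) [x] main y t \<and>
               dmmc_answer V E w k I\<^sub>1 I\<^sub>2 y \<and>
               t \<le> poly p (card V + card E))"
proof -
  obtain main fs where compiled: "\<And>N orc \<rho> x. den N orc p_main \<rho> = Some x \<Longrightarrow> length \<rho> = 1 \<Longrightarrow>
      \<exists>t\<le>poly (time_poly 1 p_main) N. eval fs orc \<rho> main x t"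
    using compile[of p_main 1] by metis
  \<comment> \<open>Bounds the lengths of all lists folded over. For \<open>n\<close> vertices the
    ground list has \<open>n * (n + 6)\<close> elements, and the list of cuts is at most twice as
    long; the polynomial dominates \<open>2 * n * (n + 6) + 2\<close> and the numbers of vertices
    and edges.\<close>
  define q :: "nat poly" where "q = [:2, 13, 2:]"
  have "\<exists>y t. eval fs (independence_oracles I\<^sub>1 I\<^sub>2) [x] main y t \<and> dmmc_answer V E w k I\<^sub>1 I\<^sub>2 y \<and>
      t \<le> poly (pcompose (time_poly 1 p_main) q) (card V + card E)"
    if inst: "dmmc_instance V E w k I\<^sub>1 I\<^sub>2" and T: "tree V E" and input: "dmmc_input V E w k x"
    for V E w k I\<^sub>1 I\<^sub>2 x
  proof -
    let ?s = "card V + card E" and ?orc = "independence_oracles I\<^sub>1 I\<^sub>2"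
    define N where "N = poly q ?s"
    obtain vs es where vs: "distinct vs" "set vs = V"
      and es: "distinct (map (\<lambda>(u, v). {u, v}) es)" "set (map (\<lambda>(u, v). {u, v}) es) = E"
      and x: "x = val_list [enc_nats vs,
        val_list (map (\<lambda>(u, v). val_list [val_nat u, val_nat v, VNum (w {u, v})]) es), val_nat k]"
      using input unfolding dmmc_input_def by blast
    define es' where "es' = map (\<lambda>(u, v). (u, v, w {u, v})) es"
    have "map (\<lambda>(u, v). val_list [val_nat u, val_nat v, VNum (w {u, v})]) es = map enc_edge es'"
      unfolding es'_def by (simp add: enc_edge_def case_prod_unfold)
    then have x: "x = val_list [enc_nats vs, enc_edges es', val_nat k]" using x by simp
    have ans: "\<exists>y. den N ?orc p_main [x] = Some y \<and> dmmc_answer V E w k I\<^sub>1 I\<^sub>2 y"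
    proof (cases "1 \<le> k")
      case False
      have "V \<noteq> {}" using T unfolding tree_def graph_connected_def by blast
      have "finite V" using vs by auto
      have "\<not> dmmc_feasible V k I\<^sub>1 I\<^sub>2 P" for P
      proof
        assume P: "dmmc_feasible V k I\<^sub>1 I\<^sub>2 P"
        then have part: "partition_on V P" and "card P = 0" using False unfolding dmmc_feasible_def by auto
        then have "P = {}" using finite_elements[OF \<open>finite V\<close> part] by simp
        then show False using part \<open>V \<noteq> {}\<close> unfolding partition_on_def by simp
      qed
      then have "\<not> (\<exists>P. dmmc_feasible V k I\<^sub>1 I\<^sub>2 P)" by blast
      then have "dmmc_answer V E w k I\<^sub>1 I\<^sub>2 (VNum 0)" unfolding dmmc_answer_def by (simp only: if_False)
      moreover have "den N ?orc p_main [x] = Some (VNum 0)"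
        using False unfolding p_main_def x by simp
      ultimately show ?thesis by blast
    next
      case True
      define ts where "ts = grow_tree vs es'"
      define gs where "gs = ground_list ts"
      define X where "X = intersect (side_indep (set gs) lft I\<^sub>1) (side_indep (set gs) rgt I\<^sub>2) cost gs"
      have G: "grown E w (hd vs) ts" "fst ` set ts = V"
        unfolding ts_def using grow_tree[OF T vs es(2) es'_def] by auto
      have nV: "length ts = card V" "length vs = card V" "length es' = card E"
        using distinct_card[OF grown_distinct[OF G(1)]] G(2) distinct_card[OF vs(1)] vs(2)
          distinct_card[OF es(1)] es(2) unfolding es'_def by auto
      have N: "N = 2 + 13 * ?s + 2 * ?s * ?s" unfolding N_def q_def by (simp add: algebra_simps)
      have lg: "length gs = card V * (card V + 6)" unfolding gs_def length_ground_list nV ..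
      have "card V * (card V + 6) \<le> ?s * (?s + 6)" by (intro mult_le_mono) auto
      then have lgN: "2 * length gs + 2 \<le> N" unfolding N lg by (simp add: algebra_simps)
      have sN: "card V \<le> N" "card E \<le> N" unfolding N by auto
      have "vs \<noteq> []" using T vs unfolding tree_def graph_connected_def by auto
      have "den N ?orc p_grow_tree [enc_nats vs, enc_edges es'] = Some (enc_entries ts)"
        unfolding ts_def
      proof (rule den_grow_tree[where U = V])
        have EV: "e \<subseteq> V" if "e \<in> E" for e using T that unfolding tree_def simple_graph_def by blast
        show "\<forall>e\<in>set es'. fst e \<in> V \<and> fst (snd e) \<in> V"
        proof
          fix e assume "e \<in> set es'"
          then obtain u v where uv: "(u, v) \<in> set es" "e = (u, v, w {u, v})" unfolding es'_def by auto
          from imageI[OF uv(1), of "\<lambda>(u, v). {u, v}"] have "{u, v} \<in> E" using es(2) by simp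
          then show "fst e \<in> V \<and> fst (snd e) \<in> V" using EV uv(2) by auto
        qed
        show "finite V" using vs(2) by auto
      qed (use \<open>vs \<noteq> []\<close> vs nV sN in auto)
      moreover have "den N ?orc p_ground [enc_entries ts] = Some (enc_elems gs)"
        unfolding gs_def using nV sN by (intro den_ground) simp
      moreover have "den N ?orc p_intersect [enc_elems gs] = Some (enc_elems X)"
        unfolding X_def using lgN by (intro den_intersect) simp
      moreover note opt = solution_optimal[OF inst T True G X_def[unfolded gs_def]]
      have lX: "length X \<le> length gs" unfolding X_def by (rule length_intersect)
      have "den N ?orc p_output [enc_entries ts, enc_elems X] = Some (val_list (map enc_nats (solution ts X)))"
        using nV sN lX lgN opt(2) by (intro den_output) auto
      ultimately have "den N ?orc p_main [x] = Some (val_list (map enc_nats (solution ts X)))"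
        using True unfolding p_main_def x by simp
      moreover have "dmmc_answer V E w k I\<^sub>1 I\<^sub>2 (val_list (map enc_nats (solution ts X)))"
        using opt(1) unfolding dmmc_answer_def dmmc_optimal_def by auto
      ultimately show ?thesis by blast
    qed
    then obtain y where y: "den N ?orc p_main [x] = Some y" "dmmc_answer V E w k I\<^sub>1 I\<^sub>2 y" by blast
    obtain t where "t \<le> poly (time_poly 1 p_main) N" "eval fs ?orc [x] main y t"
      using compiled[OF y(1)] by auto
    then show ?thesis using y(2) unfolding N_def poly_pcompose by blast
  qed
  then show ?thesis by blast
qed

end
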